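(* Let $X$ be a Banach space with a normalized $1$-unconditional basis $(e_n)_n$, let $(Y_n)_n$ be a sequence of Banach spaces, and $Z=(\sum Y_n)_X$. Assume that there are common $\lambda\ge1$, $C\ge1$ and $K:(0,+\infty)\to\mathbb R$ so that each $Y_n$ has a normalized Schauder basis $(e_i^{(n)})_i$ that satisfies the following: (i) its basis constant is at most $\lambda$, (ii) it has the $K(\delta)$-diagonal factorization property, and (iii) it is $C$-strategically reproducible in $Y_n$. Let $(\tilde e_m)_{m\in\mathbb N}$ be an enumeration of $((e_i^{(n)})_i)_n$ such that for every $n$ and all $i<j$ the vector $e_i^{(n)}$ appears before $e_j^{(n)}$. Then $(\tilde e_m)_m$, as a basis of $Z$, has the $\lambda C^2K(\delta)$-factorization property.
   Context: All Banach spaces are real. $Z=(\sum Y_n)_X$ is the Banach space of all sequences $z=(y_n)_n$ with $y_n\in Y_n$ for which $\|z\|=\big\|\sum_{n}\|y_n\|_{Y_n}e_n\big\|_X$ is well defined (the series converges in $X$). Each $Y_k$ is identified isometrically with the subspace of $Z$ of sequences all of whose coordinates except possibly the $k$-th vanish. With the stated enumeration $(\tilde e_m)$ is a Schauder basis of $Z$ with basis constant at most $\lambda$. Factorization. Let $X$ be a Banach space with a normalized Schauder basis $(e_i)_i$ and biorthogonal functionals $(e_i^* )_i$. For $K>0$ and $T:X\to X$ bounded linear, the identity $K$-factors through $T$ if there are bounded linear $R,S:X\to X$ with $\|R\|\|S\|\le K$ and $I=STR$; it almost $K$-factors through $T$ if it $(K+\varepsilon)$-factors through $T$ for all $\varepsilon>0$.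 An operator $T$ is diagonal if $e_m^*(T(e_k))=0$ for $k\ne m$. Given $K:(0,\infty)\to\mathbb R$, $(e_i)_i$ has the $K(\delta)$-diagonal factorization property (resp. the $K(\delta)$-factorization property) if for every $\delta>0$ and every bounded diagonal operator (resp. every bounded linear operator) $T:X\to X$ with $\inf_n|e_n^*(T(e_n))|\ge\delta$, the identity almost $K(\delta)$-factors through $T$. Impartial equivalence: sequences $(x_i)$, $(y_i)$ in Banach spaces are impartially $C$-equivalent if $\frac1{\sqrt C}\|\sum a_iy_i\|\le\|\sum a_ix_i\|\le\sqrt C\|\sum a_iy_i\|$ for all finitely supported real sequences $(a_i)$. Strategical reproducibility. $\mathrm{cof}(X)$ is the set of closed finite-codimensional subspaces of $X$; $\mathrm{cof}_{w^*}(X^* )$ is the set of $w^*$-closed finite-codimensional subspaces of $X^*$. For $C\ge1$, $\eta>0$ the two-player game $\mathrm{Rep}_{(X,(e_i))}(C,\eta)$ is as follows. Before the first turn player (I) chooses a partition $\mathbb N=N_1\cup N_2$. For $k\in\mathbb N$, turn $k$ has three steps. Step 1: player (I) chooses $\eta_k>0$, $W_k\in\mathrm{cof}(X)$, $G_k\in\mathrm{cof}_{w^*}(X^* )$. Step 2: player (II) chooses $i_k\in\{1,2\}$, a finite set $E_k\subset N_{i_k}$ and non-negative reals $(\lambda_i^{(k)})_{i\in E_k}$, $(\mu_i^{(k)})_{i\in E_k}$ with $1-\eta<\sum_{i\in E_k}\lambda_i^{(k)}\mu_i^{(k)}<1+\eta$. Step 3: player (I) chooses signs $(\varepsilon_i^{(k)})_{i\in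 E_k}\in\{-1,1\}^{E_k}$. Put $x_k=\sum_{i\in E_k}\varepsilon_i^{(k)}\lambda_i^{(k)}e_i$ and $x_k^*=\sum_{i\in E_k}\varepsilon_i^{(k)}\mu_i^{(k)}e_i^*$. Player (II) wins if: (i) $(x_k)_k$ and $(e_k)_k$ are impartially $(C+\eta)$-equivalent; (ii) $(x_k^* )_k$ and $(e_k^* )_k$ are impartially $(C+\eta)$-equivalent; (iii) $\mathrm{dist}(x_k,W_k)<\eta_k$ for all $k$; (iv) $\mathrm{dist}(x_k^*,G_k)<\eta_k$ for all $k$. The basis $(e_i)_i$ is $C$-strategically reproducible in $X$ if for every $\eta>0$ player (II) has a winning strategy in $\mathrm{Rep}_{(X,(e_i))}(C,\eta)$. *)

theory Defs
  imports "HOL-Analysis.Analysis" "HOL-Library.Function_Algebras"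
begin

text \<open>
  The spaces \<open>Y\<^sub>n\<close> vary with \<open>n\<close> and the norm of \<open>Z\<close> depends on the norms of \<open>X\<close> and of the
  \<open>Y\<^sub>n\<close>, so a Banach space is represented by a pair \<open>(V, N)\<close>: a linear subspace \<open>V\<close> of an ambient
  real vector space (which carries no topology) and a norm \<open>N\<close> on \<open>V\<close>. The values of \<open>N\<close>, and of
  operators, outside \<open>V\<close> are irrelevant. This loses no generality: the members of any sequence of
  vector spaces are subspaces of their direct sum. Functions, with pointwise operations, form the
  ambient space of \<open>Z\<close> and of the dual spaces.
\<close>

instantiation "fun" :: (type, real_vector) real_vector
begin

definition scaleR_fun :: "real \<Rightarrow> ('a \<Rightarrow> 'b) \<Rightarrow> 'a \<Rightarrow> 'b"
  where "scaleR_fun c f = (\<lambda>x. c *\<^sub>R f x)"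

instance
  by standard (auto simp: scaleR_fun_def plus_fun_def scaleR_add_right scaleR_add_left)

end

section \<open>Banach spaces, operators and duals\<close>

definition normed_on :: "'a::real_vector set \<Rightarrow> ('a \<Rightarrow> real) \<Rightarrow> bool" where
  "normed_on V N \<longleftrightarrow> subspace V \<and>
     (\<forall>x\<in>V. 0 \<le> N x \<and> (N x = 0 \<longleftrightarrow> x = 0)) \<and>
     (\<forall>x\<in>V. \<forall>c. N (c *\<^sub>R x) = \<bar>c\<bar> * N x) \<and>
     (\<forall>x\<in>V. \<forall>y\<in>V. N (x + y) \<le> N x + N y)"

text \<open>The locale \<open>Metric_space\<close> requires a non-negative symmetric distance on the whole type, hence
  the default value outside \<open>V\<close>.\<close>

definition norm_dist :: "'a::real_vector set \<Rightarrow> ('a \<Rightarrow> real) \<Rightarrow> 'a \<Rightarrow> 'a \<Rightarrow> real" where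
  "norm_dist V N x y = (if x \<in> V \<and> y \<in> V then N (x - y) else 0)"

lemma Metric_space_norm_dist:
  assumes "normed_on V N"
  shows "Metric_space V (norm_dist V N)"
proof -
  have diff: "x - y \<in> V" if "x \<in> V" "y \<in> V" for x y
    using assms that by (simp add: normed_on_def subspace_diff)
  have nonneg: "0 \<le> N x" and zero: "N x = 0 \<longleftrightarrow> x = 0" if "x \<in> V" for x
    using assms that by (simp_all add: normed_on_def)
  have scale: "N (c *\<^sub>R x) = \<bar>c\<bar> * N x" if "x \<in> V" for x c
    using assms that by (simp add: normed_on_def)
  have tri: "N (x + y) \<le> N x + N y" if "x \<in> V" "y \<in> V" for x y
    using assms that by (simp add: normed_on_def)
  have sym: "N (x - y) = N (y - x)" if "x \<in> V" "y \<in> V" for x y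
    using scale [OF diff [OF that], of "-1"] by simp
  have tri': "N (x - z) \<le> N (x - y) + N (y - z)" if "x \<in> V" "y \<in> V" "z \<in> V" for x y z
    using tri [OF diff [OF that(1,2)] diff [OF that(2,3)]] by simp
  show ?thesis
    by (rule Metric_space.intro) (simp_all add: norm_dist_def nonneg zero diff sym tri')
qed

definition norm_topology :: "'a::real_vector set \<Rightarrow> ('a \<Rightarrow> real) \<Rightarrow> 'a topology" where
  "norm_topology V N = Metric_space.mtopology V (norm_dist V N)"

definition banach_on :: "'a::real_vector set \<Rightarrow> ('a \<Rightarrow> real) \<Rightarrow> bool" where
  "banach_on V N \<longleftrightarrow> normed_on V N \<and> Metric_space.mcomplete V (norm_dist V N)"

definition bounded_linear_on ::
    "'a::real_vector set \<Rightarrow> ('a \<Rightarrow> real) \<Rightarrow> 'b::real_vector set \<Rightarrow> ('b \<Rightarrow> real) \<Rightarrow> ('a \<Rightarrow> 'b) \<Rightarrow> bool" where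
  "bounded_linear_on V N W M T \<longleftrightarrow>
     (\<forall>x\<in>V. T x \<in> W) \<and>
     (\<forall>x\<in>V. \<forall>y\<in>V. T (x + y) = T x + T y) \<and>
     (\<forall>x\<in>V. \<forall>c. T (c *\<^sub>R x) = c *\<^sub>R T x) \<and>
     (\<exists>B. \<forall>x\<in>V. M (T x) \<le> B * N x)"

definition onorm_on :: "'a::real_vector set \<Rightarrow> ('a \<Rightarrow> real) \<Rightarrow> ('b \<Rightarrow> real) \<Rightarrow> ('a \<Rightarrow> 'b) \<Rightarrow> real" where
  "onorm_on V N M T = (SUP x\<in>V. M (T x) / N x)"

text \<open>Functionals are set to 0 outside \<open>V\<close>, so that every functional on \<open>V\<close> is represented by exactly
  one function and the dual is a linear subspace of the function space.\<close>

definition dual_on :: "'a::real_vector set \<Rightarrow> ('a \<Rightarrow> real) \<Rightarrow> ('a \<Rightarrow> real) set" where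
  "dual_on V N = {f. bounded_linear_on V N UNIV abs f \<and> (\<forall>x. x \<notin> V \<longrightarrow> f x = 0)}"

definition dual_norm_on :: "'a::real_vector set \<Rightarrow> ('a \<Rightarrow> real) \<Rightarrow> ('a \<Rightarrow> real) \<Rightarrow> real" where
  "dual_norm_on V N f = onorm_on V N abs f"

text \<open>Pointwise convergence on all of the ambient type is pointwise convergence on \<open>V\<close>, because
  members of the dual vanish outside \<open>V\<close>.\<close>

definition weak_star_topology :: "'a::real_vector set \<Rightarrow> ('a \<Rightarrow> real) \<Rightarrow> ('a \<Rightarrow> real) topology" where
  "weak_star_topology V N = subtopology (product_topology (\<lambda>_. euclideanreal) UNIV) (dual_on V N)"

section \<open>Schauder bases\<close>

definition expansion_on ::
    "'a::real_vector set \<Rightarrow> ('a \<Rightarrow> real) \<Rightarrow> (nat \<Rightarrow> 'a) \<Rightarrow> 'a \<Rightarrow> (nat \<Rightarrow> real) \<Rightarrow> bool" where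
  "expansion_on V N e x a \<longleftrightarrow> limitin (norm_topology V N) (\<lambda>n. \<Sum>i<n. a i *\<^sub>R e i) x sequentially"

definition schauder_basis_on :: "'a::real_vector set \<Rightarrow> ('a \<Rightarrow> real) \<Rightarrow> (nat \<Rightarrow> 'a) \<Rightarrow> bool" where
  "schauder_basis_on V N e \<longleftrightarrow> (\<forall>i. e i \<in> V) \<and> (\<forall>x\<in>V. \<exists>!a. expansion_on V N e x a)"

definition normalized_schauder_basis_on ::
    "'a::real_vector set \<Rightarrow> ('a \<Rightarrow> real) \<Rightarrow> (nat \<Rightarrow> 'a) \<Rightarrow> bool" where
  "normalized_schauder_basis_on V N e \<longleftrightarrow> schauder_basis_on V N e \<and> (\<forall>i. N (e i) = 1)"

definition unconditional_basis_on ::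
    "'a::real_vector set \<Rightarrow> ('a \<Rightarrow> real) \<Rightarrow> real \<Rightarrow> (nat \<Rightarrow> 'a) \<Rightarrow> bool" where
  "unconditional_basis_on V N C e \<longleftrightarrow> schauder_basis_on V N e \<and>
     (\<forall>n a \<epsilon>. (\<forall>i. \<epsilon> i \<in> {-1, 1}) \<longrightarrow>
        N (\<Sum>i<n. (\<epsilon> i * a i) *\<^sub>R e i) \<le> C * N (\<Sum>i<n. a i *\<^sub>R e i))"

text \<open>The biorthogonal functional \<open>e\<^sub>i\<^sup>*\<close>, as a member of the dual.\<close>

definition coord ::
    "'a::real_vector set \<Rightarrow> ('a \<Rightarrow> real) \<Rightarrow> (nat \<Rightarrow> 'a) \<Rightarrow> nat \<Rightarrow> 'a \<Rightarrow> real" where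
  "coord V N e i x = (if x \<in> V then (THE a. expansion_on V N e x a) i else 0)"

text \<open>The supremum of the norms of the partial sum projections. It is taken in the extended reals,
  so that it is meaningful without knowing beforehand that it is finite.\<close>

definition basis_constant ::
    "'a::real_vector set \<Rightarrow> ('a \<Rightarrow> real) \<Rightarrow> (nat \<Rightarrow> 'a) \<Rightarrow> ereal" where
  "basis_constant V N e =
     (SUP n. SUP x\<in>{x\<in>V. N x \<le> 1}. ereal (N (\<Sum>i<n. coord V N e i x *\<^sub>R e i)))"

section \<open>Factorization properties\<close>

definition identity_factors ::
    "'a::real_vector set \<Rightarrow> ('a \<Rightarrow> real) \<Rightarrow> real \<Rightarrow> ('a \<Rightarrow> 'a) \<Rightarrow> bool" where
  "identity_factors V N K T \<longleftrightarrow>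
     (\<exists>R S. bounded_linear_on V N V N R \<and> bounded_linear_on V N V N S \<and>
            onorm_on V N N R * onorm_on V N N S \<le> K \<and>
            (\<forall>x\<in>V. S (T (R x)) = x))"

definition identity_almost_factors ::
    "'a::real_vector set \<Rightarrow> ('a \<Rightarrow> real) \<Rightarrow> real \<Rightarrow> ('a \<Rightarrow> 'a) \<Rightarrow> bool" where
  "identity_almost_factors V N K T \<longleftrightarrow> (\<forall>\<epsilon>>0. identity_factors V N (K + \<epsilon>) T)"

definition diagonal_operator ::
    "'a::real_vector set \<Rightarrow> ('a \<Rightarrow> real) \<Rightarrow> (nat \<Rightarrow> 'a) \<Rightarrow> ('a \<Rightarrow> 'a) \<Rightarrow> bool" where
  "diagonal_operator V N e T \<longleftrightarrow> (\<forall>k m. k \<noteq> m \<longrightarrow> coord V N e m (T (e k)) = 0)"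

definition factorization_property ::
    "'a::real_vector set \<Rightarrow> ('a \<Rightarrow> real) \<Rightarrow> (nat \<Rightarrow> 'a) \<Rightarrow> (real \<Rightarrow> real) \<Rightarrow> bool" where
  "factorization_property V N e K \<longleftrightarrow>
     (\<forall>\<delta>>0. \<forall>T. bounded_linear_on V N V N T \<longrightarrow>
        (INF n. \<bar>coord V N e n (T (e n))\<bar>) \<ge> \<delta> \<longrightarrow>
        identity_almost_factors V N (K \<delta>) T)"

definition diagonal_factorization_property ::
    "'a::real_vector set \<Rightarrow> ('a \<Rightarrow> real) \<Rightarrow> (nat \<Rightarrow> 'a) \<Rightarrow> (real \<Rightarrow> real) \<Rightarrow> bool" where
  "diagonal_factorization_property V N e K \<longleftrightarrow>
     (\<forall>\<delta>>0. \<forall>T. bounded_linear_on V N V N T \<longrightarrow> diagonal_operator V N e T \<longrightarrow>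
        (INF n. \<bar>coord V N e n (T (e n))\<bar>) \<ge> \<delta> \<longrightarrow>
        identity_almost_factors V N (K \<delta>) T)"

section \<open>Strategical reproducibility\<close>

definition impartially_equivalent ::
    "('a::real_vector \<Rightarrow> real) \<Rightarrow> (nat \<Rightarrow> 'a) \<Rightarrow> ('b::real_vector \<Rightarrow> real) \<Rightarrow> (nat \<Rightarrow> 'b) \<Rightarrow> real \<Rightarrow> bool" where
  "impartially_equivalent N x M y C \<longleftrightarrow>
     (\<forall>a::nat \<Rightarrow> real. finite {i. a i \<noteq> 0} \<longrightarrow>
        1 / sqrt C * M (\<Sum>i | a i \<noteq> 0. a i *\<^sub>R y i) \<le> N (\<Sum>i | a i \<noteq> 0. a i *\<^sub>R x i) \<and>
        N (\<Sum>i | a i \<noteq> 0. a i *\<^sub>R x i) \<le> sqrt C * M (\<Sum>i | a i \<noteq> 0. a i *\<^sub>R y i))"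

definition finite_codim :: "'a::real_vector set \<Rightarrow> 'a set \<Rightarrow> bool" where
  "finite_codim V W \<longleftrightarrow> (\<exists>B. finite B \<and> B \<subseteq> V \<and> span (W \<union> B) = V)"

definition cof :: "'a::real_vector set \<Rightarrow> ('a \<Rightarrow> real) \<Rightarrow> 'a set set" where
  "cof V N = {W. subspace W \<and> closedin (norm_topology V N) W \<and> finite_codim V W}"

definition cof_weak_star :: "'a::real_vector set \<Rightarrow> ('a \<Rightarrow> real) \<Rightarrow> ('a \<Rightarrow> real) set set" where
  "cof_weak_star V N =
     {G. subspace G \<and> closedin (weak_star_topology V N) G \<and> finite_codim (dual_on V N) G}"

definition dist_to :: "('a::real_vector \<Rightarrow> real) \<Rightarrow> 'a \<Rightarrow> 'a set \<Rightarrow> real" where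
  "dist_to N x W = (INF w\<in>W. N (x - w))"

text \<open>
  The move of player (I) in step 1 is \<open>(\<eta>\<^sub>k, W\<^sub>k, G\<^sub>k)\<close>; the move of player (II) in step 2 is
  \<open>(i\<^sub>k, E\<^sub>k, \<lambda>\<^sup>k, \<mu>\<^sup>k)\<close>; the move of player (I) in step 3 is an element of \<open>{-1,1}\<close> to the power
  \<open>E\<^sub>k\<close>, as an extensional function.

  A strategy of player (II) sees the partition \<open>(N\<^sub>1, N\<^sub>2)\<close>, the step 1 moves of the turns up to and
  including the current one, and the signs of the earlier turns; player (II)'s own earlier moves are
  determined by these.
\<close>

type_synonym 'a rep_opening = "real \<times> 'a set \<times> ('a \<Rightarrow> real) set"
type_synonym rep_reply = "nat \<times> nat set \<times> (nat \<Rightarrow> real) \<times> (nat \<Rightarrow> real)"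
type_synonym 'a rep_strategy =
  "nat set \<times> nat set \<Rightarrow> 'a rep_opening list \<Rightarrow> (nat \<Rightarrow> real) list \<Rightarrow> rep_reply"

definition legal_opening ::
    "'a::real_vector set \<Rightarrow> ('a \<Rightarrow> real) \<Rightarrow> 'a rep_opening \<Rightarrow> bool" where
  "legal_opening V N = (\<lambda>(h, W, G). 0 < h \<and> W \<in> cof V N \<and> G \<in> cof_weak_star V N)"

definition legal_reply :: "nat set \<Rightarrow> nat set \<Rightarrow> real \<Rightarrow> rep_reply \<Rightarrow> bool" where
  "legal_reply N1 N2 \<eta> = (\<lambda>(i, E, l, m).
     i \<in> {1, 2} \<and> finite E \<and> E \<subseteq> (if i = 1 then N1 else N2) \<and>
     (\<forall>j\<in>E. 0 \<le> l j \<and> 0 \<le> m j) \<and>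
     1 - \<eta> < (\<Sum>j\<in>E. l j * m j) \<and> (\<Sum>j\<in>E. l j * m j) < 1 + \<eta>)"

definition reply_support :: "rep_reply \<Rightarrow> nat set" where
  "reply_support = (\<lambda>(i, E, l, m). E)"

definition reply_vector :: "(nat \<Rightarrow> 'a::real_vector) \<Rightarrow> rep_reply \<Rightarrow> (nat \<Rightarrow> real) \<Rightarrow> 'a" where
  "reply_vector e = (\<lambda>(i, E, l, m) \<epsilon>. \<Sum>j\<in>E. (\<epsilon> j * l j) *\<^sub>R e j)"

definition reply_functional ::
    "(nat \<Rightarrow> 'a::real_vector \<Rightarrow> real) \<Rightarrow> rep_reply \<Rightarrow> (nat \<Rightarrow> real) \<Rightarrow> 'a \<Rightarrow> real" where
  "reply_functional es = (\<lambda>(i, E, l, m) \<epsilon>. \<Sum>j\<in>E. (\<epsilon> j * m j) *\<^sub>R es j)"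

definition player_II_wins ::
    "'a::real_vector set \<Rightarrow> ('a \<Rightarrow> real) \<Rightarrow> (nat \<Rightarrow> 'a) \<Rightarrow> real \<Rightarrow> real \<Rightarrow>
     (nat \<Rightarrow> 'a rep_opening) \<Rightarrow> (nat \<Rightarrow> 'a) \<Rightarrow> (nat \<Rightarrow> 'a \<Rightarrow> real) \<Rightarrow> bool" where
  "player_II_wins V N e C \<eta> I x xs \<longleftrightarrow>
     impartially_equivalent N x N e (C + \<eta>) \<and>
     impartially_equivalent (dual_norm_on V N) xs (dual_norm_on V N) (coord V N e) (C + \<eta>) \<and>
     (\<forall>k. case I k of (h, W, G) \<Rightarrow>
        dist_to N (x k) W < h \<and> dist_to (dual_norm_on V N) (xs k) G < h)"

definition winning_strategy ::
    "'a::real_vector set \<Rightarrow> ('a \<Rightarrow> real) \<Rightarrow> (nat \<Rightarrow> 'a) \<Rightarrow> real \<Rightarrow> real \<Rightarrow> 'a rep_strategy \<Rightarrow> bool" where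
  "winning_strategy V N e C \<eta> \<sigma> \<longleftrightarrow>
     (\<forall>N1 N2 I \<epsilon>.
        let r = (\<lambda>k. \<sigma> (N1, N2) (map I [0..<Suc k]) (map \<epsilon> [0..<k])) in
        N1 \<union> N2 = UNIV \<longrightarrow> N1 \<inter> N2 = {} \<longrightarrow>
        (\<forall>k. legal_opening V N (I k)) \<longrightarrow>
        (\<forall>k. \<epsilon> k \<in> reply_support (r k) \<rightarrow>\<^sub>E {-1, 1}) \<longrightarrow>
        (\<forall>k. legal_reply N1 N2 \<eta> (r k)) \<and>
        player_II_wins V N e C \<eta> I
          (\<lambda>k. reply_vector e (r k) (\<epsilon> k))
          (\<lambda>k. reply_functional (coord V N e) (r k) (\<epsilon> k)))"

definition strategically_reproducible ::
    "'a::real_vector set \<Rightarrow> ('a \<Rightarrow> real) \<Rightarrow> (nat \<Rightarrow> 'a) \<Rightarrow> real \<Rightarrow> bool" where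
  "strategically_reproducible V N e C \<longleftrightarrow> (\<forall>\<eta>>0. \<exists>\<sigma>. winning_strategy V N e C \<eta> \<sigma>)"

section \<open>The sum of a sequence of Banach spaces\<close>

definition sum_space ::
    "(nat \<Rightarrow> 'x::banach) \<Rightarrow> (nat \<Rightarrow> 'a::real_vector set) \<Rightarrow> (nat \<Rightarrow> 'a \<Rightarrow> real) \<Rightarrow> (nat \<Rightarrow> 'a) set" where
  "sum_space e Y N = {z. (\<forall>n. z n \<in> Y n) \<and> summable (\<lambda>n. N n (z n) *\<^sub>R e n)}"

definition sum_norm ::
    "(nat \<Rightarrow> 'x::banach) \<Rightarrow> (nat \<Rightarrow> 'a::real_vector \<Rightarrow> real) \<Rightarrow> (nat \<Rightarrow> 'a) \<Rightarrow> real" where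
  "sum_norm e N z = norm (\<Sum>n. N n (z n) *\<^sub>R e n)"

definition sum_embed :: "nat \<Rightarrow> 'a::real_vector \<Rightarrow> nat \<Rightarrow> 'a" where
  "sum_embed n y = (\<lambda>k. if k = n then y else 0)"

end

theory Submission
  imports Defs
begin

text \<open>
  Let \<open>T\<close> be an operator on \<open>Z\<close> whose diagonal entries have modulus at least \<open>\<delta>\<close>. Play the
  reproducibility games of all the spaces \<open>Y\<^sub>n\<close> at the same time, a turn for each vector of the
  enumeration. Player (I) uses the openings to make each new \<open>x\<^sub>k\<close> and \<open>x\<^sub>k\<^sup>*\<close> almost orthogonal,
  through \<open>T\<close>, to all the earlier ones, in whichever spaces these live; the partition separates the
  positive from the negative diagonal entries, so that suitable signs keep \<open>|x\<^sub>k\<^sup>*(T x\<^sub>k)|\<close> above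
  \<open>\<delta>(1 - \<eta>)\<close> (\<open>reproduced_sequences\<close>). An opening needs only finitely many earlier vectors, and
  within each space the turns come in the order of its basis, which is all the games require.

  In each \<open>Y\<^sub>n\<close> the equivalences provide operators \<open>A\<^sub>n\<close>, sending basis vectors to the \<open>x\<^sub>k\<close>, and
  \<open>B\<^sub>n y = \<Sum>\<^sub>k x\<^sub>k\<^sup>*(y) b\<^sub>k\<close>, of norms at most \<open>\<surd>(C + \<eta>)\<close> and \<open>\<lambda>\<surd>(C + \<eta>)\<close>. Since the basis of \<open>X\<close>
  is 1-unconditional, uniformly bounded operators on the \<open>Y\<^sub>n\<close> act componentwise on \<open>Z\<close> with the
  same bound. The resulting \<open>B T A\<close> has the entries \<open>x\<^sub>k\<^sup>*(T x\<^sub>j)\<close>, so up to an error of small norm it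
  is a componentwise operator \<open>D = (D\<^sub>n)\<close> with every \<open>D\<^sub>n\<close> diagonal (\<open>almost_diagonal\<close>).

  The identity of each \<open>Y\<^sub>n\<close> factors as \<open>S\<^sub>n D\<^sub>n R\<^sub>n\<close>. Rescaling makes the norms of \<open>S\<^sub>n\<close> and of \<open>R\<^sub>n\<close>
  separately bounded in \<open>n\<close> (\<open>balanced_factorization\<close>), so they combine to operators \<open>S\<close>, \<open>R\<close> on
  \<open>Z\<close>. Then \<open>S B T A R\<close> is close to the identity and hence invertible on the Banach space \<open>Z\<close>
  (\<open>factorization_from_diagonals\<close>). As all the error parameters tend to \<open>0\<close>, the factorization
  constant tends to \<open>\<lambda> C K(\<delta>) \<le> \<lambda> C\<^sup>2 K(\<delta>)\<close>.
\<close>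

section \<open>Norms on subspaces\<close>

locale normed_subspace =
  fixes V :: "'a::real_vector set" and N :: "'a \<Rightarrow> real"
  assumes normed: "normed_on V N"
begin

lemma subspace_V: "subspace V"
  using normed by (simp add: normed_on_def)

lemma mem_0: "0 \<in> V" and mem_add: "x \<in> V \<Longrightarrow> y \<in> V \<Longrightarrow> x + y \<in> V"
  and mem_scale: "x \<in> V \<Longrightarrow> c *\<^sub>R x \<in> V" and mem_diff: "x \<in> V \<Longrightarrow> y \<in> V \<Longrightarrow> x - y \<in> V"
  and mem_sum: "(\<And>i. i \<in> A \<Longrightarrow> f i \<in> V) \<Longrightarrow> sum f A \<in> V"
  using subspace_V by (simp_all add: subspace_0 subspace_add subspace_scale subspace_diff subspace_sum)

lemmas mem = mem_0 mem_add mem_scale mem_diff mem_sum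

lemma nonneg: "x \<in> V \<Longrightarrow> 0 \<le> N x"
  and eq_0: "x \<in> V \<Longrightarrow> N x = 0 \<longleftrightarrow> x = 0"
  and scale: "x \<in> V \<Longrightarrow> N (c *\<^sub>R x) = \<bar>c\<bar> * N x"
  and triangle: "x \<in> V \<Longrightarrow> y \<in> V \<Longrightarrow> N (x + y) \<le> N x + N y"
  using normed by (simp_all add: normed_on_def)

lemma N_0: "N 0 = 0"
  using eq_0 mem_0 by blast

lemma N_minus: "x \<in> V \<Longrightarrow> N (- x) = N x"
  using scale[of x "-1"] by simp

lemma N_diff_commute: "x \<in> V \<Longrightarrow> y \<in> V \<Longrightarrow> N (x - y) = N (y - x)"
  using N_minus[of "x - y"] by (simp add: mem)

lemma triangle_diff: "x \<in> V \<Longrightarrow> y \<in> V \<Longrightarrow> N (x - y) \<le> N x + N y"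
  using triangle[of x "- y"] N_minus[of y] subspace_neg[OF subspace_V] by simp

lemma triangle_mid: "x \<in> V \<Longrightarrow> y \<in> V \<Longrightarrow> z \<in> V \<Longrightarrow> N (x - z) \<le> N (x - y) + N (y - z)"
  using triangle[of "x - y" "y - z"] by (simp add: mem)

lemma reverse_triangle: "x \<in> V \<Longrightarrow> y \<in> V \<Longrightarrow> \<bar>N x - N y\<bar> \<le> N (x - y)"
  using triangle_mid[of x y 0] triangle_mid[of y x 0] N_diff_commute[of x y] by (simp add: mem)

lemma N_sum_le: "(\<And>i. i \<in> A \<Longrightarrow> f i \<in> V) \<Longrightarrow> N (sum f A) \<le> (\<Sum>i\<in>A. N (f i))"
proof (induction A rule: infinite_finite_induct)
  case (insert x F)
  then have "N (sum f (insert x F)) \<le> N (f x) + N (sum f F)"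
    by (simp add: triangle mem)
  with insert show ?case by fastforce
qed (auto simp: N_0)

lemma limitin_iff:
  assumes "\<And>n. f n \<in> V"
  shows "limitin (norm_topology V N) f x sequentially \<longleftrightarrow> x \<in> V \<and> (\<lambda>n. N (f n - x)) \<longlonglongrightarrow> 0"
proof -
  interpret M: Metric_space V "norm_dist V N"
    using normed by (rule Metric_space_norm_dist)
  have "(\<lambda>n. N (f n - x)) \<longlonglongrightarrow> 0 \<longleftrightarrow> (\<forall>\<epsilon>>0. \<forall>\<^sub>F n in sequentially. N (f n - x) < \<epsilon>)" if "x \<in> V"
    using that assms by (simp add: tendsto_iff dist_real_def nonneg mem)
  then show ?thesis
    using assms by (auto simp: norm_topology_def M.limitin_metric norm_dist_def)
qed

lemma limit_unique:
  assumes "\<And>n. f n \<in> V" "x \<in> V" "y \<in> V"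
    "(\<lambda>n. N (f n - x)) \<longlonglongrightarrow> 0" "(\<lambda>n. N (f n - y)) \<longlonglongrightarrow> 0"
  shows "x = y"
proof -
  have "(\<lambda>n. N (f n - x) + N (f n - y)) \<longlonglongrightarrow> 0"
    using tendsto_add[OF assms(4,5)] by simp
  moreover have "N (x - y) \<le> N (f n - x) + N (f n - y)" for n
    using triangle_mid[of x "f n" y] N_diff_commute[of x "f n"] assms by simp
  ultimately have "N (x - y) \<le> 0"
    by (intro tendsto_lowerbound[of _ 0 sequentially]) auto
  then show ?thesis
    using eq_0[of "x - y"] nonneg[of "x - y"] assms by (simp add: mem)
qed

lemma N_tendsto:
  assumes "\<And>n. f n \<in> V" "x \<in> V" "(\<lambda>n. N (f n - x)) \<longlonglongrightarrow> 0"
  shows "(\<lambda>n. N (f n)) \<longlonglongrightarrow> N x"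
proof -
  have "(\<lambda>n. N (f n) - N x) \<longlonglongrightarrow> 0"
    by (rule Lim_null_comparison[OF _ assms(3)]) (use assms reverse_triangle in simp)
  then show ?thesis by (simp add: LIM_zero_iff)
qed

lemma N_limit_le:
  assumes "\<And>n. f n \<in> V" "x \<in> V" "(\<lambda>n. N (f n - x)) \<longlonglongrightarrow> 0" "\<And>n. N (f n) \<le> c"
  shows "N x \<le> c"
  using tendsto_upperbound[OF N_tendsto[OF assms(1-3)]] assms(4) by simp

lemma limit_add:
  assumes "\<And>n. f n \<in> V" "x \<in> V" "(\<lambda>n. N (f n - x)) \<longlonglongrightarrow> 0"
    "\<And>n. g n \<in> V" "y \<in> V" "(\<lambda>n. N (g n - y)) \<longlonglongrightarrow> 0"
  shows "(\<lambda>n. N (f n + g n - (x + y))) \<longlonglongrightarrow> 0"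
proof (rule Lim_null_comparison)
  show "(\<lambda>n. N (f n - x) + N (g n - y)) \<longlonglongrightarrow> 0"
    using tendsto_add[OF assms(3,6)] by simp
  have "N (f n + g n - (x + y)) \<le> N (f n - x) + N (g n - y)" for n
    using triangle[of "f n - x" "g n - y"] assms by (simp add: mem algebra_simps)
  then show "\<forall>\<^sub>F n in sequentially. norm (N (f n + g n - (x + y))) \<le> N (f n - x) + N (g n - y)"
    using assms by (simp add: nonneg mem)
qed

lemma limit_scale:
  assumes "\<And>n. f n \<in> V" "x \<in> V" "(\<lambda>n. N (f n - x)) \<longlonglongrightarrow> 0"
  shows "(\<lambda>n. N (c *\<^sub>R f n - c *\<^sub>R x)) \<longlonglongrightarrow> 0"
proof -
  have "N (c *\<^sub>R f n - c *\<^sub>R x) = \<bar>c\<bar> * N (f n - x)" for n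
    using scale[of "f n - x" c] assms by (simp add: mem scaleR_diff_right)
  then show ?thesis
    using tendsto_mult_left[OF assms(3), of "\<bar>c\<bar>"] by simp
qed

lemma metric_complete_iff:
  "Metric_space.mcomplete V (norm_dist V N) \<longleftrightarrow>
   (\<forall>f. (\<forall>n. f n \<in> V) \<longrightarrow> (\<forall>\<epsilon>>0. \<exists>m. \<forall>j\<ge>m. \<forall>k\<ge>m. N (f j - f k) < \<epsilon>) \<longrightarrow>
      (\<exists>x\<in>V. (\<lambda>n. N (f n - x)) \<longlonglongrightarrow> 0))" (is "_ \<longleftrightarrow> ?R")
proof -
  interpret M: Metric_space V "norm_dist V N"
    using normed by (rule Metric_space_norm_dist)
  have *: "M.MCauchy f \<longleftrightarrow> (\<forall>n. f n \<in> V) \<and> (\<forall>\<epsilon>>0. \<exists>m. \<forall>j\<ge>m. \<forall>k\<ge>m. N (f j - f k) < \<epsilon>)" for f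
    by (auto simp: M.MCauchy_def norm_dist_def subset_eq)
  have "(\<exists>x. limitin M.mtopology f x sequentially) \<longleftrightarrow> (\<exists>x\<in>V. (\<lambda>n. N (f n - x)) \<longlonglongrightarrow> 0)"
    if "\<forall>n. f n \<in> V" for f
    using limitin_iff[of f] that by (auto simp: norm_topology_def)
  then show ?thesis
    unfolding M.mcomplete_def * by blast
qed

end

section \<open>Bounded operators\<close>

text \<open>Carrying the constant explicitly lets bounds of composites and of componentwise operators be
  multiplied without computing operator norms; the norms enter only at both ends of the argument.\<close>

definition bounded_by ::
    "'a::real_vector set \<Rightarrow> ('a \<Rightarrow> real) \<Rightarrow> 'b::real_vector set \<Rightarrow> ('b \<Rightarrow> real) \<Rightarrow> real \<Rightarrow> ('a \<Rightarrow> 'b) \<Rightarrow> bool" where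
  "bounded_by V N W M c T \<longleftrightarrow>
     (\<forall>x\<in>V. T x \<in> W) \<and>
     (\<forall>x\<in>V. \<forall>y\<in>V. T (x + y) = T x + T y) \<and>
     (\<forall>x\<in>V. \<forall>c. T (c *\<^sub>R x) = c *\<^sub>R T x) \<and>
     (\<forall>x\<in>V. M (T x) \<le> c * N x)"

lemma bounded_linear_on_iff: "bounded_linear_on V N W M T \<longleftrightarrow> (\<exists>c. bounded_by V N W M c T)"
  by (auto simp: bounded_linear_on_def bounded_by_def)

lemma bounded_byD:
  assumes "bounded_by V N W M c T"
  shows "x \<in> V \<Longrightarrow> T x \<in> W" "x \<in> V \<Longrightarrow> y \<in> V \<Longrightarrow> T (x + y) = T x + T y"
    "x \<in> V \<Longrightarrow> T (r *\<^sub>R x) = r *\<^sub>R T x" "x \<in> V \<Longrightarrow> M (T x) \<le> c * N x"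
  using assms by (auto simp: bounded_by_def)

lemma bounded_by_compose:
  assumes "bounded_by V N W M c T" "bounded_by W M U L d S" "0 \<le> d"
  shows "bounded_by V N U L (d * c) (\<lambda>x. S (T x))"
proof -
  have "L (S (T x)) \<le> d * c * N x" if "x \<in> V" for x
  proof -
    have "L (S (T x)) \<le> d * M (T x)"
      using assms that by (auto simp: bounded_by_def)
    also have "\<dots> \<le> d * (c * N x)"
      using assms that by (auto simp: bounded_by_def intro: mult_left_mono)
    finally show ?thesis by simp
  qed
  then show ?thesis
    using assms by (auto simp: bounded_by_def)
qed

context normed_subspace
begin

lemma bounded_by_mono:
  assumes "bounded_by V N W M c T" "c \<le> d"
  shows "bounded_by V N W M d T"
  using assms nonneg unfolding bounded_by_def by (meson mult_right_mono order_trans)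

lemma bounded_by_scale:
  assumes "bounded_by W M V N c T"
  shows "bounded_by W M V N (\<bar>r\<bar> * c) (\<lambda>x. r *\<^sub>R T x)"
  using assms mult_left_mono[of "N (T _)" "c * M _" "\<bar>r\<bar>"]
  by (auto simp: bounded_by_def mem scale scaleR_add_right mult.assoc)

lemma bounded_by_minus: "bounded_by V N W M c T \<Longrightarrow> x \<in> V \<Longrightarrow> y \<in> V \<Longrightarrow> T (x - y) = T x - T y"
  using bounded_byD(2)[of V N W M c T x "(-1) *\<^sub>R y"] bounded_byD(3)[of V N W M c T y "-1"]
  by (simp add: mem_scale[of y "-1", simplified])

lemma bounded_by_0: "bounded_by V N W M c T \<Longrightarrow> T 0 = 0"
  using bounded_byD(3)[of V N W M c T 0 0] by (simp add: mem)

lemma bounded_by_sum: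
  assumes "bounded_by V N W M c T" "\<And>i. i \<in> A \<Longrightarrow> f i \<in> V"
  shows "T (sum f A) = (\<Sum>i\<in>A. T (f i))"
  using assms(2)
  by (induction A rule: infinite_finite_induct)
     (auto simp: bounded_by_0[OF assms(1)] bounded_byD(2)[OF assms(1)] mem)

lemma bounded_by_scaled_sum:
  assumes "bounded_by V N W M c T" "\<And>i. i \<in> A \<Longrightarrow> f i \<in> V"
  shows "T (\<Sum>i\<in>A. a i *\<^sub>R f i) = (\<Sum>i\<in>A. a i *\<^sub>R T (f i))"
  using bounded_by_sum[OF assms(1), of A "\<lambda>i. a i *\<^sub>R f i"] assms bounded_byD(3)[OF assms(1)]
  by (simp add: mem)

text \<open>The supremum in \<open>onorm_on\<close> includes the quotient \<open>0 / 0 = 0\<close> at the origin, so it is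
  nonnegative and is bounded by every nonnegative constant that bounds the operator.\<close>

lemma onorm_on_le:
  assumes "bounded_by V N W M c T" "0 \<le> c" "normed_on W M"
  shows "onorm_on V N M T \<le> c"
  unfolding onorm_on_def
proof (rule cSUP_least)
  fix x assume x: "x \<in> V"
  show "M (T x) / N x \<le> c"
  proof (cases "N x = 0")
    case False
    then have "N x > 0" using nonneg[OF x] by simp
    then show ?thesis using bounded_byD(4)[OF assms(1) x] by (simp add: field_simps)
  qed (use assms in simp)
qed (use mem_0 in auto)

lemma bounded_by_onorm_on:
  assumes "bounded_linear_on V N W M T" "normed_on W M"
  shows "bounded_by V N W M (onorm_on V N M T) T" "0 \<le> onorm_on V N M T"
proof -
  interpret W: normed_subspace W M by unfold_locales fact
  obtain c0 where c0: "bounded_by V N W M c0 T"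
    using assms by (auto simp: bounded_linear_on_iff)
  define c where "c = max c0 0"
  have c: "bounded_by V N W M c T" "c \<ge> 0"
    using bounded_by_mono[OF c0, of c] by (auto simp: c_def)
  have bdd: "bdd_above ((\<lambda>x. M (T x) / N x) ` V)"
  proof (rule bdd_aboveI2)
    fix x assume x: "x \<in> V"
    show "M (T x) / N x \<le> c"
    proof (cases "N x = 0")
      case False
      then have "N x > 0" using nonneg[OF x] by simp
      then show ?thesis using bounded_byD(4)[OF c(1) x] by (simp add: field_simps)
    qed (use c in simp)
  qed
  have le: "M (T x) / N x \<le> onorm_on V N M T" if "x \<in> V" for x
    unfolding onorm_on_def by (rule cSUP_upper[OF that bdd])
  show "0 \<le> onorm_on V N M T"
    using le[OF mem_0] by (simp add: N_0)
  have "M (T x) \<le> onorm_on V N M T * N x" if x: "x \<in> V" for x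
  proof (cases "N x = 0")
    case True
    then have "x = 0" using eq_0[OF x] by simp
    then show ?thesis using bounded_by_0[OF c(1)] by (simp add: W.N_0 N_0)
  next
    case False
    then have "N x > 0" using nonneg[OF x] by simp
    then show ?thesis using le[OF x] by (simp add: field_simps)
  qed
  then show "bounded_by V N W M (onorm_on V N M T) T"
    using c(1) by (simp add: bounded_by_def)
qed

end

lemma normed_on_real: "normed_on UNIV (abs :: real \<Rightarrow> real)"
  by (auto simp: normed_on_def abs_mult)

text \<open>A Neumann series argument, organised as the iteration \<open>z \<mapsto> z + (w - U z)\<close>: its residuals
  \<open>w - U z\<close> shrink by the factor \<open>\<theta>\<close>, and \<open>U\<close> is bounded below, so the iterates are Cauchy.\<close>

lemma perturbation_of_identity_inverse:
  assumes "banach_on V N" and U: "bounded_by V N V N c U"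
    and near: "\<And>x. x \<in> V \<Longrightarrow> N (U x - x) \<le> \<theta> * N x" and th: "0 \<le> \<theta>" "\<theta> < 1"
  shows "\<exists>G. bounded_by V N V N (1 / (1 - \<theta>)) G \<and> (\<forall>x\<in>V. G (U x) = x)"
proof -
  interpret normed_subspace V N
    using assms(1) by unfold_locales (simp add: banach_on_def)
  note UV = bounded_byD(1)[OF U]
  have lower: "(1 - \<theta>) * N x \<le> N (U x)" if "x \<in> V" for x
    using near[OF that] reverse_triangle[OF UV[OF that] that] by (simp add: algebra_simps)
  have inj: "x = y" if "x \<in> V" "y \<in> V" "U x = U y" for x y
    using lower[of "x - y"] that bounded_by_minus[OF U, of x y] eq_0[of "x - y"] nonneg[of "x - y"] th
    by (simp add: mem N_0 mult_le_0_iff)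
  have surj: "\<exists>z\<in>V. U z = w" if w: "w \<in> V" for w
  proof -
    define z where "z = rec_nat (0::'a) (\<lambda>_ u. u + (w - U u))"
    have z_Suc: "z (Suc k) = z k + (w - U (z k))" and z_0: "z 0 = 0" for k
      by (simp_all add: z_def)
    have zV: "z k \<in> V" for k
      by (induction k) (auto simp: z_0 z_Suc mem UV w)
    define r where "r k = w - U (z k)" for k
    have rV: "r k \<in> V" for k by (simp add: r_def mem UV w zV)
    have rN: "N (r k) \<le> \<theta> ^ k * N w" for k
    proof (induction k)
      case 0 show ?case by (simp add: r_def z_0 bounded_by_0[OF U])
    next
      case (Suc k)
      have "r (Suc k) = - (U (r k) - r k)"
        using bounded_byD(2)[OF U zV rV, of k k]
        by (simp add: r_def z_Suc)
      then have "N (r (Suc k)) \<le> \<theta> * N (r k)"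
        using near[OF rV, of k] by (simp only: N_minus mem UV rV)
      also have "\<dots> \<le> \<theta> * (\<theta> ^ k * N w)" using Suc th by (simp add: mult_left_mono)
      finally show ?case by simp
    qed
    have r0: "(\<lambda>k. N (r k)) \<longlonglongrightarrow> 0"
    proof (rule Lim_null_comparison)
      show "\<forall>\<^sub>F k in sequentially. norm (N (r k)) \<le> \<theta> ^ k * N w"
        using rN nonneg[OF rV] by simp
      show "(\<lambda>k. \<theta> ^ k * N w) \<longlonglongrightarrow> 0"
        using th LIMSEQ_power_zero[of \<theta>] by (intro tendsto_mult_left_zero) simp
    qed
    have dist: "(1 - \<theta>) * N (z j - z k) \<le> N (r j) + N (r k)" for j k
    proof -
      have "U (z j - z k) = r k - r j"
        by (simp add: bounded_by_minus[OF U] zV r_def)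
      then show ?thesis
        using lower[of "z j - z k"] triangle_diff[OF rV rV, of k j] by (simp add: mem zV)
    qed
    have "\<exists>m. \<forall>j\<ge>m. \<forall>k\<ge>m. N (z j - z k) < \<epsilon>" if "\<epsilon> > 0" for \<epsilon>
    proof -
      have "0 < (1 - \<theta>) * \<epsilon> / 2" using th that by simp
      then obtain m where m: "\<And>k. k \<ge> m \<Longrightarrow> N (r k) < (1 - \<theta>) * \<epsilon> / 2"
        using order_tendstoD(2)[OF r0] unfolding eventually_sequentially by meson
      have "N (z j - z k) < \<epsilon>" if "j \<ge> m" "k \<ge> m" for j k
      proof -
        have "(1 - \<theta>) * N (z j - z k) < (1 - \<theta>) * \<epsilon>"
          using dist[of j k] m[OF that(1)] m[OF that(2)] by linarith
        then show ?thesis using th by simp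
      qed
      then show ?thesis by blast
    qed
    moreover have "\<forall>f. (\<forall>n. f n \<in> V) \<longrightarrow> (\<forall>\<epsilon>>0. \<exists>m. \<forall>j\<ge>m. \<forall>k\<ge>m. N (f j - f k) < \<epsilon>) \<longrightarrow>
        (\<exists>x\<in>V. (\<lambda>n. N (f n - x)) \<longlonglongrightarrow> 0)"
      using assms(1) by (simp add: banach_on_def metric_complete_iff)
    ultimately obtain u where u: "u \<in> V" "(\<lambda>k. N (z k - u)) \<longlonglongrightarrow> 0"
      using zV by (blast dest: spec[of _ z])
    have "U u = w"
    proof (rule limit_unique[where f = "\<lambda>k. U (z k)"])
      show "(\<lambda>k. N (U (z k) - U u)) \<longlonglongrightarrow> 0"
      proof (rule Lim_null_comparison)
        show "\<forall>\<^sub>F k in sequentially. norm (N (U (z k) - U u)) \<le> c * N (z k - u)"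
          using bounded_byD(4)[OF U, of "z _ - u"] nonneg UV zV u(1)
          by (simp add: bounded_by_minus[OF U] mem)
        show "(\<lambda>k. c * N (z k - u)) \<longlonglongrightarrow> 0"
          using tendsto_mult_left[OF u(2), of c] by simp
      qed
      show "(\<lambda>k. N (U (z k) - w)) \<longlonglongrightarrow> 0"
        using r0 by (simp add: r_def N_diff_commute[OF w UV[OF zV]])
    qed (auto simp: UV zV u w)
    with u(1) show ?thesis by blast
  qed
  define G where "G = inv_into V U"
  have GV: "G w \<in> V" and UG: "U (G w) = w" if "w \<in> V" for w
    using surj[OF that] by (auto simp: G_def inv_into_into f_inv_into_f)
  have "N (G w) \<le> 1 / (1 - \<theta>) * N w" if "w \<in> V" for w
    using lower[OF GV[OF that]] th UG[OF that] by (simp add: field_simps)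
  moreover have "G (x + y) = G x + G y" if "x \<in> V" "y \<in> V" for x y
    by (rule inj) (use that in \<open>simp_all add: GV mem UG bounded_byD(2)[OF U]\<close>)
  moreover have "G (a *\<^sub>R x) = a *\<^sub>R G x" if "x \<in> V" for x a
    by (rule inj) (use that in \<open>simp_all add: GV mem UG bounded_byD(3)[OF U]\<close>)
  moreover have "G (U x) = x" if "x \<in> V" for x
    by (rule inj) (use that in \<open>simp_all add: GV UG UV\<close>)
  ultimately show ?thesis
    using GV unfolding bounded_by_def by (intro exI[of _ G]) auto
qed

section \<open>Dual spaces\<close>

lemma sum_fun_apply: "sum f A x = (\<Sum>i\<in>A. f i x)" for f :: "'i \<Rightarrow> 'a \<Rightarrow> 'b::comm_monoid_add"
  by (induction A rule: infinite_finite_induct) (auto simp: zero_fun_def plus_fun_def)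

lemma scaled_sum_fun_apply:
  "(\<Sum>i\<in>A. c i *\<^sub>R f i) x = (\<Sum>i\<in>A. c i *\<^sub>R f i x)" for f :: "'i \<Rightarrow> 'a \<Rightarrow> 'b::real_vector"
  by (simp add: sum_fun_apply scaleR_fun_def)

context normed_subspace
begin

lemma dual_on_iff: "f \<in> dual_on V N \<longleftrightarrow> (\<exists>c\<ge>0. bounded_by V N UNIV abs c f) \<and> (\<forall>x. x \<notin> V \<longrightarrow> f x = 0)"
proof -
  have "(\<exists>c. bounded_by V N UNIV abs c f) \<longleftrightarrow> (\<exists>c\<ge>0. bounded_by V N UNIV abs c f)"
    using bounded_by_mono[of UNIV abs _ f] by (metis max.cobounded1 max.cobounded2)
  then show ?thesis by (simp add: dual_on_def bounded_linear_on_iff)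
qed

lemma subspace_dual_on: "subspace (dual_on V N)"
proof (rule subspaceI)
  show "0 \<in> dual_on V N"
    by (auto simp: dual_on_iff bounded_by_def zero_fun_def intro: exI[of _ 0])
next
  fix f g assume "f \<in> dual_on V N" "g \<in> dual_on V N"
  then obtain c d where cd: "c \<ge> 0" "bounded_by V N UNIV abs c f" "d \<ge> 0" "bounded_by V N UNIV abs d g"
    and 0: "\<forall>x. x \<notin> V \<longrightarrow> f x = 0" "\<forall>x. x \<notin> V \<longrightarrow> g x = 0"
    by (auto simp: dual_on_iff)
  have "\<bar>f x + g x\<bar> \<le> (c + d) * N x" if "x \<in> V" for x
    using bounded_byD(4)[OF cd(2) that] bounded_byD(4)[OF cd(4) that] by (simp add: algebra_simps)
  then have "bounded_by V N UNIV abs (c + d) (f + g)"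
    using cd by (auto simp: bounded_by_def plus_fun_def algebra_simps)
  then show "f + g \<in> dual_on V N"
    using cd 0 by (auto simp: dual_on_iff plus_fun_def intro!: exI[of _ "c + d"])
next
  fix r f assume "f \<in> dual_on V N"
  then obtain c where c: "c \<ge> 0" "bounded_by V N UNIV abs c f" and 0: "\<forall>x. x \<notin> V \<longrightarrow> f x = 0"
    by (auto simp: dual_on_iff)
  interpret R: normed_subspace "UNIV :: real set" abs
    by unfold_locales (rule normed_on_real)
  have "bounded_by V N UNIV abs (\<bar>r\<bar> * c) (r *\<^sub>R f)"
    using R.bounded_by_scale[OF c(2), of r] by (simp add: scaleR_fun_def)
  then show "r *\<^sub>R f \<in> dual_on V N"
    using c 0 by (auto simp: dual_on_iff scaleR_fun_def intro!: exI[of _ "\<bar>r\<bar> * c"])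
qed

lemma dual_on_bounded_by:
  assumes "f \<in> dual_on V N"
  shows "bounded_by V N UNIV abs (dual_norm_on V N f) f" "0 \<le> dual_norm_on V N f"
  using assms bounded_by_onorm_on[OF _ normed_on_real] by (auto simp: dual_on_def dual_norm_on_def)

lemma dual_norm_on_le: "bounded_by V N UNIV abs c f \<Longrightarrow> 0 \<le> c \<Longrightarrow> dual_norm_on V N f \<le> c"
  using onorm_on_le[OF _ _ normed_on_real] by (simp add: dual_norm_on_def)

text \<open>One step of the Hahn-Banach extension. The functional \<open>f\<close> is linear on the whole ambient
  space, but is dominated by the norm only on \<open>W\<close>; this is possible because every linear map on a
  subspace extends algebraically.\<close>

lemma dominated_extension_step:
  fixes f :: "'a \<Rightarrow> real"
  assumes f: "linear f" and W: "subspace W" "W \<subseteq> V" and v: "v \<in> V" and dom: "\<And>w. w \<in> W \<Longrightarrow> f w \<le> N w"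
  shows "\<exists>g::'a \<Rightarrow> real. linear g \<and> (\<forall>w\<in>W. g w = f w) \<and> (\<forall>x\<in>span (insert v W). g x \<le> N x)"
proof (cases "v \<in> W")
  case True
  then have "span (insert v W) = W" using W by (simp add: insert_absorb)
  then show ?thesis using f dom by blast
next
  case False
  define L where "L = (\<lambda>w. f w - N (w - v)) ` W"
  have LU: "f w - N (w - v) \<le> N (w' + v) - f w'" if "w \<in> W" "w' \<in> W" for w w'
  proof -
    have "f w + f w' \<le> N ((w - v) + (w' + v))"
      using dom[of "w + w'"] that W by (simp add: linear_add[OF f] subspace_add)
    also have "\<dots> \<le> N (w - v) + N (w' + v)"
      using that W v by (intro triangle) (auto simp: mem)
    finally show ?thesis by simp
  qed
  define r where "r = Sup L"
  have 0: "0 \<in> W" using W by (simp add: subspace_0)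
  have "bdd_above L" using LU[OF _ 0] unfolding L_def by (intro bdd_aboveI2) simp
  then have lo: "f w - N (w - v) \<le> r" if "w \<in> W" for w
    unfolding r_def by (rule cSup_upper[rotated]) (use that in \<open>auto simp: L_def\<close>)
  have hi: "r \<le> N (w + v) - f w" if "w \<in> W" for w
    unfolding r_def by (rule cSup_least) (use that LU 0 in \<open>auto simp: L_def\<close>)
  obtain B where B: "B \<subseteq> W" "independent B" "W \<subseteq> span B"
    by (rule basis_exists[of W])
  have spB: "span B = W"
    using B W by (metis span_mono span_eq_iff subset_antisym)
  then have "independent (insert v B)"
    using False B by (simp add: independent_insert)
  then obtain g where g: "linear g" "\<forall>x\<in>insert v B. g x = (if x = v then r else f x)"
    using linear_independent_extend[of "insert v B" "\<lambda>x. if x = v then r else f x"] by blast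
  have gf: "g w = f w" if "w \<in> W" for w
    by (rule linear_eq_on[OF g(1) f, of w B]) (use that g(2) B False spB in auto)
  have gv: "g v = r" using g by simp
  have "g x \<le> N x" if x: "x \<in> span (insert v W)" for x
  proof -
    obtain k where k: "x - k *\<^sub>R v \<in> W"
      using x W span_breakdown_eq[of x v W] span_eq_iff[of W] by metis
    define w where "w = x - k *\<^sub>R v"
    have w: "w \<in> W" "x = w + k *\<^sub>R v" using k by (auto simp: w_def)
    have gx: "g x = f w + k * r"
      by (simp add: w(2) linear_add[OF g(1)] linear_cmul[OF g(1)] gv gf[OF w(1)])
    have wk: "(1 / \<bar>k\<bar>) *\<^sub>R w \<in> W" using w W by (simp add: subspace_scale)
    have fwk: "\<bar>k\<bar> * f ((1 / \<bar>k\<bar>) *\<^sub>R w) = f w" if "k \<noteq> 0"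
      using that by (simp add: linear_cmul[OF f])
    consider "k = 0" | "k > 0" | "k < 0" by linarith
    then show ?thesis
    proof cases
      case 1 then show ?thesis using dom w gx by simp
    next
      case 2
      have "k * r \<le> k * (N ((1 / \<bar>k\<bar>) *\<^sub>R w + v) - f ((1 / \<bar>k\<bar>) *\<^sub>R w))"
        using hi[OF wk] 2 by simp
      also have "\<dots> = N (k *\<^sub>R ((1 / \<bar>k\<bar>) *\<^sub>R w + v)) - f w"
        using 2 fwk wk W v by (subst scale) (auto simp: mem algebra_simps)
      also have "k *\<^sub>R ((1 / \<bar>k\<bar>) *\<^sub>R w + v) = x"
        using 2 by (simp add: w(2) scaleR_add_right)
      finally show ?thesis using gx by simp
    next
      case 3
      have "- k * (f ((1 / \<bar>k\<bar>) *\<^sub>R w) - N ((1 / \<bar>k\<bar>) *\<^sub>R w - v)) \<le> - k * r"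
        using lo[OF wk] 3 by (intro mult_left_mono) auto
      moreover have "- k * N ((1 / \<bar>k\<bar>) *\<^sub>R w - v) = N ((- k) *\<^sub>R ((1 / \<bar>k\<bar>) *\<^sub>R w - v))"
        using 3 wk W v by (subst scale) (auto simp: mem)
      moreover have "(- k) *\<^sub>R ((1 / \<bar>k\<bar>) *\<^sub>R w - v) = x"
        using 3 by (simp add: w(2) scaleR_diff_right)
      ultimately show ?thesis using gx fwk 3 by (simp add: algebra_simps)
    qed
  qed
  with g gf show ?thesis by blast
qed

text \<open>Finitely many extension steps suffice for a functional that norms \<open>v\<close> among the combinations
  of \<open>v\<close> and finitely many given vectors; composed with a partial sum projection, it becomes bounded on
  all of \<open>V\<close>.\<close>

lemma norming_functional_finite:
  assumes "finite F" "F \<subseteq> V" "v \<in> V"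
  shows "\<exists>f::'a \<Rightarrow> real. linear f \<and> f v = N v \<and> (\<forall>x\<in>span (insert v F). \<bar>f x\<bar> \<le> N x)"
proof -
  have "\<exists>f::'a \<Rightarrow> real. linear f \<and> f v = N v \<and> (\<forall>x\<in>span (insert v F). f x \<le> N x)"
    using assms(1,2)
  proof (induction F)
    case empty
    have "\<exists>f::'a \<Rightarrow> real. linear f \<and> f v = N v"
    proof (cases "v = 0")
      case True
      then show ?thesis by (auto simp: N_0 intro!: exI[of _ "\<lambda>_. 0"] linearI)
    next
      case False
      then have "independent {v}" by simp
      then show ?thesis
        using linear_independent_extend[of "{v}" "\<lambda>_. N v"] by auto
    qed
    then obtain f :: "'a \<Rightarrow> real" where f: "linear f" "f v = N v" by blast
    have "f x \<le> N x" if x: "x \<in> span {v}" for x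
    proof -
      obtain k where "x = k *\<^sub>R v" using x by (auto simp: span_singleton)
      then show ?thesis
        using f scale[OF assms(3)] nonneg[OF assms(3)]
        by (simp add: linear_cmul mult_right_mono)
    qed
    with f show ?case by auto
  next
    case (insert u F)
    then obtain f :: "'a \<Rightarrow> real" where f: "linear f" "f v = N v" "\<And>x. x \<in> span (insert v F) \<Longrightarrow> f x \<le> N x"
      by auto
    have sub: "span (insert v F) \<subseteq> V"
      using insert.prems assms(3) subspace_V by (intro span_minimal) auto
    obtain g :: "'a \<Rightarrow> real" where g: "linear g" "\<forall>w\<in>span (insert v F). g w = f w"
      "\<forall>x\<in>span (insert u (span (insert v F))). g x \<le> N x"
      using dominated_extension_step[OF f(1) subspace_span sub _ f(3), of u] insert.prems by blast
    have "span (insert v (insert u F)) \<subseteq> span (insert u (span (insert v F)))"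
      using span_superset[of "insert v F"] by (intro span_mono) auto
    moreover have "g v = N v" using g(2) f(2) by (simp add: span_base)
    ultimately show ?case using g by blast
  qed
  then obtain f :: "'a \<Rightarrow> real" where f: "linear f" "f v = N v" "\<And>x. x \<in> span (insert v F) \<Longrightarrow> f x \<le> N x"
    by blast
  have "\<bar>f x\<bar> \<le> N x" if x: "x \<in> span (insert v F)" for x
  proof -
    have "x \<in> V" using x span_minimal[OF _ subspace_V, of "insert v F"] assms by auto
    then show ?thesis
      using f(3)[OF x] f(3)[OF span_neg[OF x]] N_minus by (simp add: linear_neg[OF f(1)])
  qed
  with f show ?thesis by blast
qed

end

section \<open>Spaces with a Schauder basis\<close>

locale banach_subspace = normed_subspace +
  assumes complete: "Metric_space.mcomplete V (norm_dist V N)"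
begin

lemma Cauchy_convergent:
  assumes "\<And>n. f n \<in> V" "\<And>\<epsilon>. \<epsilon> > 0 \<Longrightarrow> \<exists>m. \<forall>j\<ge>m. \<forall>k\<ge>j. N (f k - f j) < \<epsilon>"
  shows "\<exists>x\<in>V. (\<lambda>n. N (f n - x)) \<longlonglongrightarrow> 0"
proof -
  have "\<exists>m. \<forall>j\<ge>m. \<forall>k\<ge>m. N (f j - f k) < \<epsilon>" if e: "\<epsilon> > 0" for \<epsilon>
  proof -
    obtain m where m: "\<And>j k. j \<ge> m \<Longrightarrow> k \<ge> j \<Longrightarrow> N (f k - f j) < \<epsilon>"
      using assms(2)[OF e] by blast
    have "N (f j - f k) < \<epsilon>" if "j \<ge> m" "k \<ge> m" for j k
      using m[of j k] m[of k j] that N_diff_commute[OF assms(1) assms(1), of j k]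
      by (cases "j \<le> k") auto
    then show ?thesis by blast
  qed
  then show ?thesis
    using complete[unfolded metric_complete_iff, THEN spec, of f] assms(1) by blast
qed

end

locale basis_space = banach_subspace V N for V :: "'a::real_vector set" and N +
  fixes b :: "nat \<Rightarrow> 'a" and lam :: real
  assumes basis: "normalized_schauder_basis_on V N b"
    and basis_constant: "basis_constant V N b \<le> ereal lam"
    and lam: "lam \<ge> 1"
begin

lemma b_mem: "b i \<in> V" and N_b: "N (b i) = 1"
  using basis by (auto simp: normalized_schauder_basis_on_def schauder_basis_on_def)

lemma expansion_iff:
  "expansion_on V N b x a \<longleftrightarrow> x \<in> V \<and> (\<lambda>n. N ((\<Sum>i<n. a i *\<^sub>R b i) - x)) \<longlonglongrightarrow> 0"
  unfolding expansion_on_def by (rule limitin_iff) (simp add: mem b_mem)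

lemma expansion_coord: "x \<in> V \<Longrightarrow> expansion_on V N b x (\<lambda>i. coord V N b i x)"
  using basis theI'[of "expansion_on V N b x"]
  by (auto simp: normalized_schauder_basis_on_def schauder_basis_on_def coord_def)

lemma coord_unique:
  assumes "expansion_on V N b x a"
  shows "coord V N b i x = a i"
proof -
  have x: "x \<in> V" using assms by (simp add: expansion_iff)
  then have "\<exists>!a. expansion_on V N b x a"
    using basis by (simp add: normalized_schauder_basis_on_def schauder_basis_on_def)
  then have "(THE a. expansion_on V N b x a) = a"
    using the1_equality[of "expansion_on V N b x" a] assms by blast
  with x show ?thesis by (simp add: coord_def)
qed

lemma coord_limit: "x \<in> V \<Longrightarrow> (\<lambda>n. N ((\<Sum>i<n. coord V N b i x *\<^sub>R b i) - x)) \<longlonglongrightarrow> 0"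
  by (rule expansion_coord[unfolded expansion_iff, THEN conjunct2])

lemma coord_add:
  assumes "x \<in> V" "y \<in> V"
  shows "coord V N b i (x + y) = coord V N b i x + coord V N b i y"
  by (rule coord_unique[where a = "\<lambda>i. coord V N b i x + coord V N b i y"])
     (use limit_add[OF _ assms(1) coord_limit[OF assms(1)] _ assms(2) coord_limit[OF assms(2)]] assms
       in \<open>simp add: expansion_iff mem b_mem scaleR_add_left sum.distrib\<close>)

lemma coord_scale:
  assumes "x \<in> V"
  shows "coord V N b i (r *\<^sub>R x) = r * coord V N b i x"
  by (rule coord_unique[where a = "\<lambda>i. r * coord V N b i x"])
     (use limit_scale[OF _ assms coord_limit[OF assms], of r] assms
       in \<open>simp add: expansion_iff mem b_mem scaleR_sum_right\<close>)

lemma coord_b: "coord V N b i (b j) = (if i = j then 1 else 0)"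
proof (rule coord_unique[where a = "\<lambda>i. if i = j then 1 else 0"])
  have *: "(\<Sum>i<n. (if i = j then 1 else 0) *\<^sub>R b i) = b j" if "n > j" for n
  proof -
    have "(\<Sum>i<n. (if i = j then 1 else 0) *\<^sub>R b i) = (\<Sum>i<n. if i = j then b i else 0)"
      by (intro sum.cong) auto
    then show ?thesis using that by (simp add: sum.delta)
  qed
  have "\<forall>\<^sub>F n in sequentially. N ((\<Sum>i<n. (if i = j then 1 else 0) *\<^sub>R b i) - b j) = 0"
    using eventually_gt_at_top[of j] by eventually_elim (simp only: * N_0 diff_self)
  then show "expansion_on V N b (b j) (\<lambda>i. if i = j then 1 else 0)"
    by (simp add: expansion_iff b_mem tendsto_eventually)
qed

lemma coord_eqI:
  assumes "x \<in> V" "y \<in> V" "\<And>i. coord V N b i x = coord V N b i y"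
  shows "x = y"
  using limit_unique[OF _ assms(1,2) coord_limit[OF assms(1)]] coord_limit[OF assms(2)] assms(3)
  by (simp add: mem b_mem)

lemma partial_sum_bound:
  assumes x: "x \<in> V"
  shows "N (\<Sum>i<k. coord V N b i x *\<^sub>R b i) \<le> lam * N x"
proof (cases "x = 0")
  case True
  then have "coord V N b i x = 0" for i using coord_scale[OF x, of i 0] by simp
  with True show ?thesis by (simp add: N_0)
next
  case False
  then have pos: "N x > 0" using eq_0[OF x] nonneg[OF x] by simp
  define y where "y = (1 / N x) *\<^sub>R x"
  have y: "y \<in> V" "N y \<le> 1" using pos x by (simp_all add: y_def mem scale)
  have "ereal (N (\<Sum>i<k. coord V N b i y *\<^sub>R b i)) \<le> basis_constant V N b"
    unfolding basis_constant_def using y by (intro SUP_upper2[of k] SUP_upper2[of y]) auto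
  then have "N (\<Sum>i<k. coord V N b i y *\<^sub>R b i) \<le> lam"
    using basis_constant by (metis ereal_less_eq(3) order_trans)
  moreover have "(\<Sum>i<k. coord V N b i y *\<^sub>R b i) = (1 / N x) *\<^sub>R (\<Sum>i<k. coord V N b i x *\<^sub>R b i)"
    using x by (simp add: y_def coord_scale scaleR_sum_right)
  ultimately show ?thesis
    using pos by (simp add: scale mem b_mem field_simps)
qed

text \<open>The term \<open>coord V N b i x *\<^sub>R b i\<close> is a difference of two consecutive partial sums, whence the
  factor 2.\<close>

lemma coord_bound: 
  assumes x: "x \<in> V"
  shows "\<bar>coord V N b i x\<bar> \<le> 2 * lam * N x"
proof -
  let ?P = "\<lambda>k. \<Sum>i<k. coord V N b i x *\<^sub>R b i"
  have "\<bar>coord V N b i x\<bar> = N (?P (Suc i) - ?P i)"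
    by (simp add: scale b_mem N_b)
  also have "\<dots> \<le> N (?P (Suc i)) + N (?P i)"
    by (rule triangle_diff) (simp_all add: mem b_mem)
  also have "\<dots> \<le> 2 * lam * N x"
    using partial_sum_bound[OF x, of "Suc i"] partial_sum_bound[OF x, of i] by linarith
  finally show ?thesis .
qed

lemma coord_bounded_by: "bounded_by V N UNIV abs (2 * lam) (coord V N b i)"
  using coord_add coord_scale coord_bound by (auto simp: bounded_by_def)

lemma coord_dual: "coord V N b i \<in> dual_on V N"
  using coord_bounded_by lam by (auto simp: dual_on_iff coord_def intro!: exI[of _ "2 * lam"])

text \<open>Maps are determined by coordinates, so linearity may be checked on them.\<close>

lemma bounded_byI_coord:
  assumes L: "\<And>x. x \<in> V \<Longrightarrow> L x \<in> V" and bd: "\<And>x. x \<in> V \<Longrightarrow> N (L x) \<le> c * N x"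
    and co: "\<And>x i. x \<in> V \<Longrightarrow> coord V N b i (L x) = \<phi> i x"
    and \<phi>: "\<And>i x y. x \<in> V \<Longrightarrow> y \<in> V \<Longrightarrow> \<phi> i (x + y) = \<phi> i x + \<phi> i y"
      "\<And>i x r. x \<in> V \<Longrightarrow> \<phi> i (r *\<^sub>R x) = r * \<phi> i x"
  shows "bounded_by V N V N c L"
proof -
  have "L (x + y) = L x + L y" if "x \<in> V" "y \<in> V" for x y
    by (rule coord_eqI) (use that in \<open>simp_all add: L mem co \<phi> coord_add\<close>)
  moreover have "L (r *\<^sub>R x) = r *\<^sub>R L x" if "x \<in> V" for x r
    by (rule coord_eqI) (use that in \<open>simp_all add: L mem co \<phi> coord_scale\<close>)
  ultimately show ?thesis using L bd by (simp add: bounded_by_def)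
qed

text \<open>As the basis vectors have norm one, absolutely summable coefficients always belong to a vector,
  although the basis may be conditional.\<close>

lemma absolutely_convergent_expansion:
  assumes t: "summable t" and a: "\<And>i. \<bar>a i\<bar> \<le> t i"
  shows "\<exists>y\<in>V. (\<forall>i. coord V N b i y = a i) \<and> N y \<le> suminf t"
proof -
  let ?S = "\<lambda>n. \<Sum>i<n. a i *\<^sub>R b i"
  have t0: "t i \<ge> 0" for i using a[of i] by simp
  have bd: "N (\<Sum>i\<in>A. a i *\<^sub>R b i) \<le> sum t A" for A
    using N_sum_le[of A "\<lambda>i. a i *\<^sub>R b i"] sum_mono[of A "\<lambda>i. \<bar>a i\<bar>" t] a
    by (simp add: mem b_mem scale N_b)
  have "\<exists>m. \<forall>j\<ge>m. \<forall>k\<ge>j. N (?S k - ?S j) < \<epsilon>" if e: "\<epsilon> > 0" for \<epsilon>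
  proof -
    obtain m where m: "\<And>j k. j \<ge> m \<Longrightarrow> norm (sum t {j..<k}) < \<epsilon>"
      using t e unfolding summable_Cauchy by blast
    have "N (?S k - ?S j) < \<epsilon>" if "j \<ge> m" "k \<ge> j" for j k
    proof -
      have "?S k - ?S j = (\<Sum>i\<in>{j..<k}. a i *\<^sub>R b i)"
        using that by (simp add: sum_diff_nat_ivl lessThan_atLeast0)
      then show ?thesis using bd[of "{j..<k}"] m[OF that(1), of k] by simp
    qed
    then show ?thesis by blast
  qed
  then obtain y where y: "y \<in> V" "(\<lambda>n. N (?S n - y)) \<longlonglongrightarrow> 0"
    using Cauchy_convergent[of ?S] by (auto simp: mem b_mem)
  have "N (?S n) \<le> suminf t" for n
    using bd[of "{..<n}"] sum_le_suminf[OF t, of "{..<n}"] t0 by fastforce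
  then have "N y \<le> suminf t"
    using N_limit_le[OF _ y] by (simp add: mem b_mem)
  moreover have "coord V N b i y = a i" for i
    by (rule coord_unique[where a = a]) (simp add: expansion_iff y)
  ultimately show ?thesis using y(1) by blast
qed

lemma N_le_suminf_coord:
  assumes "y \<in> V" "summable t" "\<And>i. \<bar>coord V N b i y\<bar> \<le> t i"
  shows "N y \<le> suminf t"
  using absolutely_convergent_expansion[OF assms(2), of "\<lambda>i. coord V N b i y"] assms coord_eqI by metis

text \<open>The operator is \<open>A y = \<Sum>\<^sub>i b\<^sub>i\<^sup>*(y) x\<^sub>i\<close>: each block of this series is dominated by the
  corresponding block of the expansion of \<open>y\<close>, so the series is Cauchy.\<close>

lemma operator_of_dominated_sequence:
  assumes x: "\<And>i. x i \<in> V" and c: "0 \<le> c"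
    and dom: "\<And>a k. N (\<Sum>i<k. a i *\<^sub>R x i) \<le> c * N (\<Sum>i<k. a i *\<^sub>R b i)"
  shows "\<exists>A. bounded_by V N V N c A \<and> (\<forall>i. A (b i) = x i)"
proof -
  let ?S = "\<lambda>y n. \<Sum>i<n. coord V N b i y *\<^sub>R x i"
  let ?P = "\<lambda>y n. \<Sum>i<n. coord V N b i y *\<^sub>R b i"
  have SV: "?S y n \<in> V" for y n by (simp add: mem x)
  have PV: "?P y n \<in> V" for y n by (simp add: mem b_mem)
  have cut: "(\<Sum>i<k. (if i < j then 0 else f i) *\<^sub>R g i) = (\<Sum>i<k. f i *\<^sub>R g i) - (\<Sum>i<j. f i *\<^sub>R g i)"
    if "j \<le> k" for f :: "nat \<Rightarrow> real" and g :: "nat \<Rightarrow> 'a" and j k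
  proof -
    have "(\<Sum>i<k. (if i < j then 0 else f i) *\<^sub>R g i) = (\<Sum>i\<in>{j..<k}. f i *\<^sub>R g i)"
      using that by (intro sum.mono_neutral_cong_right) auto
    then show ?thesis using that by (simp add: sum_diff_nat_ivl lessThan_atLeast0)
  qed
  have diff: "N (?S y k - ?S y j) \<le> c * N (?P y k - ?P y j)" if "j \<le> k" for y j k
    using dom[where a = "\<lambda>i. if i < j then 0 else coord V N b i y" and k = k] cut[OF that] by simp
  have ex: "\<exists>u\<in>V. (\<lambda>n. N (?S y n - u)) \<longlonglongrightarrow> 0" if y: "y \<in> V" for y
  proof (rule Cauchy_convergent[OF SV])
    fix \<epsilon> :: real assume "\<epsilon> > 0"
    then have "0 < \<epsilon> / (c + 1) / 2" using c by simp
    then obtain m where m: "\<And>n. n \<ge> m \<Longrightarrow> N (?P y n - y) < \<epsilon> / (c + 1) / 2"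
      using order_tendstoD(2)[OF coord_limit[OF y]] unfolding eventually_sequentially by meson
    have "N (?S y k - ?S y j) < \<epsilon>" if "j \<ge> m" "k \<ge> j" for j k
    proof -
      have "N (?P y k - ?P y j) \<le> N (?P y k - y) + N (?P y j - y)"
        using triangle_mid[OF PV y PV, of y k y j] N_diff_commute[OF PV y, of y j] by simp
      also have "\<dots> \<le> \<epsilon> / (c + 1)"
      proof -
        have "N (?P y k - y) < \<epsilon> / (c + 1) / 2" "N (?P y j - y) < \<epsilon> / (c + 1) / 2"
          using m[of k] m[of j] that by auto
        then show ?thesis by linarith
      qed
      finally have "(c + 1) * N (?P y k - ?P y j) \<le> \<epsilon>"
        using c by (simp add: field_simps)
      moreover have "c * N (?P y k - ?P y j) < (c + 1) * N (?P y k - ?P y j)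
          \<or> N (?P y k - ?P y j) = 0"
        using nonneg[OF mem_diff[OF PV PV], of y k y j] by (auto simp: algebra_simps)
      ultimately show ?thesis
        using diff[OF that(2), of y] \<open>\<epsilon> > 0\<close> by auto
    qed
    then show "\<exists>m. \<forall>j\<ge>m. \<forall>k\<ge>j. N (?S y k - ?S y j) < \<epsilon>" by blast
  qed
  define A where "A y = (SOME u. u \<in> V \<and> (\<lambda>n. N (?S y n - u)) \<longlonglongrightarrow> 0)" for y
  have A: "A y \<in> V" "(\<lambda>n. N (?S y n - A y)) \<longlonglongrightarrow> 0" if "y \<in> V" for y
    using someI_ex[of "\<lambda>u. u \<in> V \<and> (\<lambda>n. N (?S y n - u)) \<longlonglongrightarrow> 0"] ex[OF that] by (auto simp: A_def)
  have A_unique: "A y = u" if "y \<in> V" "u \<in> V" "(\<lambda>n. N (?S y n - u)) \<longlonglongrightarrow> 0" for y u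
    using limit_unique[OF SV A(1) that(2) A(2)] that by blast
  have "N (A y) \<le> c * N y" if y: "y \<in> V" for y
  proof (rule tendsto_le[of sequentially])
    show "(\<lambda>n. c * N (?P y n)) \<longlonglongrightarrow> c * N y"
      by (intro tendsto_mult_left N_tendsto[OF PV y coord_limit[OF y]])
    show "(\<lambda>n. N (?S y n)) \<longlonglongrightarrow> N (A y)"
      by (rule N_tendsto[OF SV A[OF y]])
  qed (use dom in auto)
  moreover have "A (y + z) = A y + A z" if "y \<in> V" "z \<in> V" for y z
    using limit_add[OF SV A[OF that(1)] SV A[OF that(2)]] that
    by (intro A_unique) (simp_all add: mem A coord_add scaleR_add_left sum.distrib)
  moreover have "A (r *\<^sub>R y) = r *\<^sub>R A y" if "y \<in> V" for y r
    using limit_scale[OF SV A[OF that], of r] that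
    by (intro A_unique) (simp_all add: mem A coord_scale scaleR_sum_right)
  moreover have "A (b i) = x i" for i
  proof (rule A_unique[OF b_mem x])
    have *: "?S (b i) n = x i" if "n > i" for n
    proof -
      have "?S (b i) n = (\<Sum>j<n. if j = i then x j else 0)"
        by (intro sum.cong) (auto simp: coord_b)
      then show ?thesis using that by (simp add: sum.delta)
    qed
    have "\<forall>\<^sub>F n in sequentially. N (?S (b i) n - x i) = 0"
      using eventually_gt_at_top[of i] by eventually_elim (simp only: * N_0 diff_self)
    then show "(\<lambda>n. N (?S (b i) n - x i)) \<longlonglongrightarrow> 0"
      by (rule tendsto_eventually)
  qed
  ultimately show ?thesis
    using A(1) unfolding bounded_by_def by (intro exI[of _ A]) auto
qed

text \<open>The operator \<open>y \<mapsto> \<Sum>\<^sub>k f\<^sub>k(y) b\<^sub>k\<close>, a pre-adjoint of \<open>b\<^sub>k\<^sup>* \<mapsto> f\<^sub>k\<close>. Its partial sums are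
  bounded because a norming functional on the span of \<open>b\<^sub>0, \<dots>, b\<^bsub>m-1\<^esub>\<close>, composed with the partial
  sum projection, is a combination of the \<open>b\<^sub>k\<^sup>*\<close>; here the factor \<open>lam\<close> appears. Boundedness of the
  partial sums does not give convergence, which is why the \<open>f\<^sub>k(b\<^sub>j)\<close> must also be summable.\<close>

lemma operator_of_dominated_functionals:
  assumes f: "\<And>k. f k \<in> dual_on V N" and c: "0 \<le> c"
    and dom: "\<And>a m. dual_norm_on V N (\<Sum>k<m. a k *\<^sub>R f k) \<le> c * dual_norm_on V N (\<Sum>k<m. a k *\<^sub>R coord V N b k)"
    and sm: "\<And>j. summable (\<lambda>k. \<bar>f k (b j)\<bar>)"
  shows "\<exists>B. bounded_by V N V N (c * lam) B \<and> (\<forall>y\<in>V. \<forall>k. coord V N b k (B y) = f k y)"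
proof -
  let ?S = "\<lambda>y n. \<Sum>k<n. f k y *\<^sub>R b k"
  let ?P = "\<lambda>y n. \<Sum>i<n. coord V N b i y *\<^sub>R b i"
  have SV: "?S y n \<in> V" for y n by (simp add: mem b_mem)
  have PV: "?P y n \<in> V" for y n by (simp add: mem b_mem)
  note fb = dual_on_bounded_by(1)[OF f]
  have bound: "N (?S y m) \<le> c * lam * N y" if y: "y \<in> V" for y m
  proof -
    obtain g :: "'a \<Rightarrow> real" where g: "linear g" "g (?S y m) = N (?S y m)"
      "\<forall>x\<in>span (insert (?S y m) (b ` {..<m})). \<bar>g x\<bar> \<le> N x"
      using norming_functional_finite[of "b ` {..<m}" "?S y m"] SV b_mem by auto
    define h where "h = (\<Sum>k<m. g (b k) *\<^sub>R coord V N b k)"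
    have hx: "h x = g (?P x m)" for x
      by (simp add: h_def scaled_sum_fun_apply linear_sum[OF g(1)] linear_cmul[OF g(1)] mult.commute)
    have hd: "h \<in> dual_on V N"
      unfolding h_def by (intro subspace_sum[OF subspace_dual_on] subspace_scale[OF subspace_dual_on] coord_dual)
    have "\<bar>h x\<bar> \<le> lam * N x" if "x \<in> V" for x
    proof -
      have "?P x m \<in> span (insert (?S y m) (b ` {..<m}))"
        by (intro span_sum span_scale span_base) auto
      then show ?thesis
        using g(3) partial_sum_bound[OF that, of m] by (fastforce simp: hx)
    qed
    then have "bounded_by V N UNIV abs lam h"
      using dual_on_bounded_by(1)[OF hd] by (simp add: bounded_by_def)
    then have hn: "dual_norm_on V N h \<le> lam"
      using lam by (intro dual_norm_on_le) auto
    define F where "F = (\<Sum>k<m. g (b k) *\<^sub>R f k)"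
    have Fd: "F \<in> dual_on V N"
      unfolding F_def by (intro subspace_sum[OF subspace_dual_on] subspace_scale[OF subspace_dual_on] f)
    have "N (?S y m) = F y"
      by (subst g(2)[symmetric])
         (simp add: F_def scaled_sum_fun_apply linear_sum[OF g(1)] linear_cmul[OF g(1)] mult.commute)
    also have "\<dots> \<le> dual_norm_on V N F * N y"
      using bounded_byD(4)[OF dual_on_bounded_by(1)[OF Fd] y] by simp
    also have "dual_norm_on V N F \<le> c * dual_norm_on V N h"
      using dom[of "\<lambda>k. g (b k)" m] by (simp add: F_def h_def)
    also have "\<dots> \<le> c * lam" using hn c by (simp add: mult_left_mono)
    finally show ?thesis using nonneg[OF y] by (simp add: mult_right_mono)
  qed
  have S_add: "?S (x + y) n = ?S x n + ?S y n" if "x \<in> V" "y \<in> V" for x y n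
    using that by (simp add: bounded_byD(2)[OF fb] scaleR_add_left sum.distrib)
  have S_diff: "?S (x - y) n = ?S x n - ?S y n" if "x \<in> V" "y \<in> V" for x y n
    using that by (simp add: bounded_by_minus[OF fb] scaleR_diff_left sum_subtractf)
  have ex: "\<exists>u\<in>V. (\<lambda>n. N (?S y n - u)) \<longlonglongrightarrow> 0" if y: "y \<in> V" for y
  proof (rule Cauchy_convergent[OF SV])
    fix \<epsilon> :: real assume e: "\<epsilon> > 0"
    have cl: "c * lam \<ge> 0" using c lam by simp
    then have "0 < \<epsilon> / (4 * (c * lam + 1))" using e by simp
    then obtain J where J: "N (?P y J - y) < \<epsilon> / (4 * (c * lam + 1))"
      using order_tendstoD(2)[OF coord_limit[OF y]] unfolding eventually_sequentially by (meson order_refl)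
    define w where "w = ?P y J"
    have wV: "w \<in> V" by (simp add: w_def PV)
    have small: "N (?S (y - w) n) \<le> \<epsilon> / 4" for n
    proof -
      have "N (?S (y - w) n) \<le> c * lam * N (y - w)"
        by (rule bound) (simp add: mem y wV)
      also have "\<dots> \<le> (c * lam + 1) * N (y - w)"
        using nonneg[of "y - w"] y wV by (simp add: mem mult_right_mono)
      also have "\<dots> \<le> \<epsilon> / 4"
        using J N_diff_commute[OF y wV] cl by (simp add: w_def field_simps)
      finally show ?thesis .
    qed
    define t where "t k = (\<Sum>j<J. \<bar>coord V N b j y\<bar> * \<bar>f k (b j)\<bar>)" for k
    have "summable t"
      unfolding t_def by (intro summable_sum summable_mult sm)
    then obtain m where m: "\<And>j k. j \<ge> m \<Longrightarrow> norm (sum t {j..<k}) < \<epsilon> / 2"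
      using e unfolding summable_Cauchy by (meson half_gt_zero)
    have ft: "\<bar>f k w\<bar> \<le> t k" for k
    proof -
      have "f k w = (\<Sum>j<J. coord V N b j y * f k (b j))"
        using bounded_by_scaled_sum[OF fb, of "{..<J}" b] by (simp add: w_def b_mem)
      then show ?thesis
        using sum_abs[of "\<lambda>j. coord V N b j y * f k (b j)" "{..<J}"] by (simp add: t_def abs_mult)
    qed
    have "N (?S y k - ?S y j) < \<epsilon>" if "j \<ge> m" "k \<ge> j" for j k
    proof -
      have "?S w k - ?S w j = (\<Sum>i\<in>{j..<k}. f i w *\<^sub>R b i)"
        using that by (simp add: sum_diff_nat_ivl lessThan_atLeast0)
      then have "N (?S w k - ?S w j) \<le> (\<Sum>i\<in>{j..<k}. \<bar>f i w\<bar>)"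
        using N_sum_le[of "{j..<k}" "\<lambda>i. f i w *\<^sub>R b i"] by (simp add: mem b_mem scale N_b)
      also have "\<dots> \<le> sum t {j..<k}" by (intro sum_mono ft)
      also have "\<dots> < \<epsilon> / 2" using m[OF that(1), of k] by simp
      finally have 1: "N (?S w k - ?S w j) < \<epsilon> / 2" .
      have "?S y k - ?S y j = (?S w k - ?S w j) + (?S (y - w) k - ?S (y - w) j)"
        by (simp add: S_diff y wV)
      then have "N (?S y k - ?S y j) \<le> N (?S w k - ?S w j) + N (?S (y - w) k - ?S (y - w) j)"
        using triangle[of "?S w k - ?S w j" "?S (y - w) k - ?S (y - w) j"] by (simp only: SV mem)
      also have "N (?S (y - w) k - ?S (y - w) j) \<le> N (?S (y - w) k) + N (?S (y - w) j)"
        by (rule triangle_diff[OF SV SV])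
      finally show ?thesis using 1 small[of k] small[of j] by linarith
    qed
    then show "\<exists>m. \<forall>j\<ge>m. \<forall>k\<ge>j. N (?S y k - ?S y j) < \<epsilon>" by blast
  qed
  define B where "B y = (SOME u. u \<in> V \<and> (\<lambda>n. N (?S y n - u)) \<longlonglongrightarrow> 0)" for y
  have B: "B y \<in> V" "(\<lambda>n. N (?S y n - B y)) \<longlonglongrightarrow> 0" if "y \<in> V" for y
    using someI_ex[of "\<lambda>u. u \<in> V \<and> (\<lambda>n. N (?S y n - u)) \<longlonglongrightarrow> 0"] ex[OF that] by (auto simp: B_def)
  have co: "coord V N b k (B y) = f k y" if "y \<in> V" for y k
    by (rule coord_unique[where a = "\<lambda>k. f k y"]) (simp add: expansion_iff B that)
  have "bounded_by V N V N (c * lam) B"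
    by (rule bounded_byI_coord[where \<phi> = f])
       (use B N_limit_le[OF SV B bound] bounded_byD[OF fb] in \<open>auto simp: co\<close>)
  with co show ?thesis by blast
qed

text \<open>For a conditional basis, multiplying the coordinates by a bounded sequence \<open>d\<close> need not define
  an operator. It does here because the result differs from \<open>L y\<close> by a vector with absolutely summable
  coordinates.\<close>

lemma diagonal_part:
  assumes L: "bounded_by V N V N c L" and t: "summable t"
    and off: "\<And>y i. y \<in> V \<Longrightarrow> \<bar>coord V N b i (L y) - d i * coord V N b i y\<bar> \<le> t i * N y"
  shows "\<exists>D. bounded_by V N V N (c + suminf t) D \<and> (\<forall>y\<in>V. \<forall>i. coord V N b i (D y) = d i * coord V N b i y)"
proof -
  note LV = bounded_byD(1)[OF L]
  define \<psi> where "\<psi> i y = coord V N b i (L y) - d i * coord V N b i y" for i y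
  have "\<exists>u\<in>V. (\<forall>i. coord V N b i u = \<psi> i y) \<and> N u \<le> suminf t * N y" if "y \<in> V" for y
    using absolutely_convergent_expansion[of "\<lambda>i. t i * N y" "\<lambda>i. \<psi> i y"] off[OF that] t
    by (simp add: \<psi>_def summable_mult2 suminf_mult2[symmetric])
  then obtain F where F: "\<And>y. y \<in> V \<Longrightarrow> F y \<in> V" "\<And>y i. y \<in> V \<Longrightarrow> coord V N b i (F y) = \<psi> i y"
    "\<And>y. y \<in> V \<Longrightarrow> N (F y) \<le> suminf t * N y"
    by metis
  have co: "coord V N b i (L y - F y) = d i * coord V N b i y" if "y \<in> V" for y i
    using bounded_by_minus[OF coord_bounded_by LV[OF that] F(1)[OF that], of i] F(2)[OF that]
    by (simp add: \<psi>_def)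
  have "bounded_by V N V N (c + suminf t) (\<lambda>y. L y - F y)"
  proof (rule bounded_byI_coord[where \<phi> = "\<lambda>i y. d i * coord V N b i y"])
    fix y assume y: "y \<in> V"
    show "N (L y - F y) \<le> (c + suminf t) * N y"
      using triangle_diff[OF LV[OF y] F(1)[OF y]] bounded_byD(4)[OF L y] F(3)[OF y]
      by (simp add: algebra_simps)
  qed (auto simp: mem LV F co coord_add coord_scale algebra_simps)
  with co show ?thesis by blast
qed

end

section \<open>Moves in the reproducibility game\<close>

text \<open>Adding one functional \<open>\<phi>\<close> cuts the common kernel down by at most one dimension: any vector of it
  on which \<open>\<phi>\<close> does not vanish restores what was lost.\<close>

lemma kernel_finite_codim:
  fixes \<Phi> :: "('a::real_vector \<Rightarrow> real) set"
  assumes V: "subspace V" and "finite \<Phi>"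
    and lin: "\<And>\<phi> x y. \<phi> \<in> \<Phi> \<Longrightarrow> x \<in> V \<Longrightarrow> y \<in> V \<Longrightarrow> \<phi> (x + y) = \<phi> x + \<phi> y"
      "\<And>\<phi> x c. \<phi> \<in> \<Phi> \<Longrightarrow> x \<in> V \<Longrightarrow> \<phi> (c *\<^sub>R x) = c * \<phi> x"
  shows "subspace {x \<in> V. \<forall>\<phi>\<in>\<Phi>. \<phi> x = 0} \<and> finite_codim V {x \<in> V. \<forall>\<phi>\<in>\<Phi>. \<phi> x = 0}"
  using assms(2) lin
proof (induction \<Phi>)
  case empty
  then show ?case using V by (auto simp: finite_codim_def span_eq_iff[THEN iffD2] intro!: exI[of _ "{}"])
next
  case (insert \<phi> \<Phi>)
  define W where "W = {x \<in> V. \<forall>\<phi>\<in>\<Phi>. \<phi> x = 0}"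
  define W' where "W' = {x \<in> V. \<forall>\<phi>\<in>insert \<phi> \<Phi>. \<phi> x = 0}"
  have W': "W' = {x \<in> W. \<phi> x = 0}" by (auto simp: W_def W'_def)
  have W: "subspace W" "finite_codim V W"
    using insert by (auto simp: W_def)
  have WV: "W \<subseteq> V" by (auto simp: W_def)
  have add: "\<phi> (x + y) = \<phi> x + \<phi> y" and sc: "\<phi> (c *\<^sub>R x) = c * \<phi> x" if "x \<in> V" "y \<in> V" for x y c
    using insert.prems that by auto
  have "\<phi> 0 = 0" using sc[of 0 0 0] V by (simp add: subspace_0)
  then have sub: "subspace W'"
    using W(1) WV add sc unfolding W' subspace_def by (auto simp: subset_eq)
  obtain B where B: "finite B" "B \<subseteq> V" "span (W \<union> B) = V"
    using W(2) by (auto simp: finite_codim_def)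
  have "finite_codim V W'"
  proof (cases "\<exists>w\<in>W. \<phi> w \<noteq> 0")
    case False
    then have "W' = W" by (auto simp: W')
    then show ?thesis using W(2) by simp
  next
    case True
    then obtain w where w: "w \<in> W" "\<phi> w \<noteq> 0" by blast
    have "W \<subseteq> span (W' \<union> insert w B)"
    proof
      fix x assume x: "x \<in> W"
      let ?c = "\<phi> x / \<phi> w"
      have "x + (- ?c) *\<^sub>R w \<in> W'"
      proof -
        have cw: "(- ?c) *\<^sub>R w \<in> W" using w W(1) by (intro subspace_scale)
        moreover have "\<phi> (x + (- ?c) *\<^sub>R w) = 0"
          using add[of x "(- ?c) *\<^sub>R w"] sc[of w w "- ?c"] x w cw WV by (auto simp: subset_eq)
        ultimately show ?thesis using subspace_add[OF W(1) x cw] by (simp add: W')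
      qed
      then have "(x + (- ?c) *\<^sub>R w) + ?c *\<^sub>R w \<in> span (W' \<union> insert w B)"
        by (intro span_add[OF span_base span_scale[OF span_base]]) blast+
      then show "x \<in> span (W' \<union> insert w B)" by simp
    qed
    then have "span (W \<union> B) \<subseteq> span (W' \<union> insert w B)"
      by (intro span_minimal) (auto intro: span_base)
    moreover have "span (W' \<union> insert w B) \<subseteq> V"
      using B w WV V by (intro span_minimal) (auto simp: W')
    ultimately show ?thesis
      unfolding finite_codim_def using B w WV by (intro exI[of _ "insert w B"]) auto
  qed
  with sub show ?case by (simp add: W'_def)
qed

lemma common_radius:
  assumes "finite A" "\<And>r t. (r, t) \<in> A \<Longrightarrow> 0 < t"
  shows "\<exists>h>0::real. \<forall>(r, t)\<in>A. r * h \<le> t"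
  using assms
proof (induction A)
  case empty show ?case by (auto intro: exI[of _ 1])
next
  case (insert a A)
  obtain r t where a: "a = (r, t)" by (cases a)
  obtain h where h: "h > 0" "\<forall>(r, t)\<in>A. r * h \<le> t" using insert by force
  have t: "t > 0" using insert.prems a by auto
  define h' where "h' = min h (t / (\<bar>r\<bar> + 1))"
  have h': "h' > 0" "h' \<le> h" using h t by (auto simp: h'_def)
  have "r * h' \<le> \<bar>r\<bar> * h'" using h' by (simp add: mult_right_mono)
  also have "\<dots> \<le> (\<bar>r\<bar> + 1) * (t / (\<bar>r\<bar> + 1))"
    by (intro mult_mono) (use h' t in \<open>auto simp: h'_def\<close>)
  also have "\<dots> = t" by simp
  finally have 1: "r * h' \<le> t" .
  have "r' * h' \<le> t'" if "(r', t') \<in> A" for r' t'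
  proof (cases "r' \<ge> 0")
    case True
    then have "r' * h' \<le> r' * h" using h' by (simp add: mult_left_mono)
    then show ?thesis using h that by fastforce
  next
    case False
    then have "r' * h' \<le> 0" using h' by (simp add: mult_nonpos_nonneg)
    then show ?thesis using insert.prems that by fastforce
  qed
  with 1 h' a show ?case by auto
qed

context normed_subspace
begin

lemma kernel_in_cof:
  assumes "finite \<Phi>" "\<And>\<phi>. \<phi> \<in> \<Phi> \<Longrightarrow> bounded_linear_on V N UNIV abs \<phi>"
  shows "{x \<in> V. \<forall>\<phi>\<in>\<Phi>. \<phi> x = 0} \<in> cof V N"
proof -
  let ?W = "{x \<in> V. \<forall>\<phi>\<in>\<Phi>. \<phi> x = 0}"
  interpret M: Metric_space V "norm_dist V N"
    using normed by (rule Metric_space_norm_dist)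
  have "closedin (norm_topology V N) ?W"
    unfolding norm_topology_def M.metric_closedin_iff_sequentially_closed
  proof (intro conjI allI impI)
    fix \<sigma> l assume *: "range \<sigma> \<subseteq> ?W \<and> limitin M.mtopology \<sigma> l sequentially"
    then have \<sigma>: "\<sigma> n \<in> V" "\<And>\<phi>. \<phi> \<in> \<Phi> \<Longrightarrow> \<phi> (\<sigma> n) = 0" for n by (auto simp: subset_eq)
    then have l: "l \<in> V" "(\<lambda>n. N (\<sigma> n - l)) \<longlonglongrightarrow> 0"
      using limitin_iff[of \<sigma> l] * by (auto simp: norm_topology_def)
    have "\<phi> l = 0" if \<phi>: "\<phi> \<in> \<Phi>" for \<phi>
    proof -
      obtain c where c: "bounded_by V N UNIV abs c \<phi>"
        using assms(2)[OF \<phi>] by (auto simp: bounded_linear_on_iff)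
      have "\<bar>\<phi> l\<bar> \<le> c * N (\<sigma> n - l)" for n
        using bounded_byD(4)[OF c, of "\<sigma> n - l"] bounded_by_minus[OF c \<sigma>(1) l(1)] \<sigma>(1) \<sigma>(2)[OF \<phi>] l
        by (simp add: mem)
      moreover have "(\<lambda>n. c * N (\<sigma> n - l)) \<longlonglongrightarrow> 0"
        using tendsto_mult_left[OF l(2), of c] by simp
      ultimately have "\<bar>\<phi> l\<bar> \<le> 0"
        by (intro tendsto_lowerbound[of _ 0 sequentially]) auto
      then show ?thesis by simp
    qed
    with l show "l \<in> ?W" by auto
  qed auto
  then show ?thesis
    using kernel_finite_codim[OF subspace_V assms(1)] assms(2)
    by (auto simp: cof_def bounded_linear_on_def)
qed

lemma annihilator_in_cof_weak_star:
  assumes "finite F" "F \<subseteq> V"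
  shows "{f \<in> dual_on V N. \<forall>v\<in>F. f v = 0} \<in> cof_weak_star V N"
proof -
  let ?G = "{f \<in> dual_on V N. \<forall>v\<in>F. f v = 0}"
  have "closed (\<Inter>v\<in>F. {f :: 'a \<Rightarrow> real. f v = 0})"
    by (intro closed_INT ballI closed_Collect_eq continuous_on_product_coordinates continuous_on_const)
  moreover have "?G = (\<Inter>v\<in>F. {f. f v = 0}) \<inter> dual_on V N" by auto
  ultimately have cl: "closedin (weak_star_topology V N) ?G"
    unfolding weak_star_topology_def closedin_subtopology euclidean_product_topology closed_closedin[symmetric]
    by (intro exI conjI)
  have eq: "?G = {f \<in> dual_on V N. \<forall>\<phi>\<in>(\<lambda>v f. f v) ` F. \<phi> f = 0}" by auto
  have "subspace ?G \<and> finite_codim (dual_on V N) ?G"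
    unfolding eq using assms(1)
    by (intro kernel_finite_codim[OF subspace_dual_on]) (auto simp: plus_fun_def scaleR_fun_def)
  with cl show ?thesis by (simp add: cof_weak_star_def)
qed

lemma near_subspace:
  assumes "dist_to M x W < h" "W \<noteq> {}"
  shows "\<exists>w\<in>W. M (x - w) < h"
  using cInf_lessD[of "(\<lambda>w. M (x - w)) ` W" h] assms by (auto simp: dist_to_def)

text \<open>By this opening player (I) forces finitely many functionals to be small at \<open>x\<^sub>k\<close>, and \<open>x\<^sub>k\<^sup>*\<close> to
  be small at finitely many vectors. A functional that vanishes on \<open>W\<close> is at most \<open>h\<close> times its norm at
  a point within distance \<open>h\<close> of \<open>W\<close>, and likewise for \<open>G\<close>, so a small \<open>h\<close> meets all tolerances.\<close>

lemma exists_opening: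
  assumes "finite \<Phi>" "\<And>\<phi> t. (\<phi>, t) \<in> \<Phi> \<Longrightarrow> 0 < t \<and> bounded_linear_on V N UNIV abs \<phi>"
    and "finite F" "\<And>v t. (v, t) \<in> F \<Longrightarrow> 0 < t \<and> v \<in> V"
  shows "\<exists>h W G. legal_opening V N (h, W, G) \<and>
    (\<forall>x\<in>V. dist_to N x W < h \<longrightarrow> (\<forall>(\<phi>, t)\<in>\<Phi>. \<bar>\<phi> x\<bar> \<le> t)) \<and>
    (\<forall>f\<in>dual_on V N. dist_to (dual_norm_on V N) f G < h \<longrightarrow> (\<forall>(v, t)\<in>F. \<bar>f v\<bar> \<le> t))"
proof -
  define A where "A = (\<lambda>(\<phi>, t). (onorm_on V N abs \<phi>, t)) ` \<Phi> \<union> (\<lambda>(v, t). (N v, t)) ` F"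
  have "\<exists>h>0. \<forall>(r, t)\<in>A. r * h \<le> t"
    by (rule common_radius) (use assms in \<open>auto simp: A_def\<close>)
  then obtain h where h: "h > 0" "\<forall>(r, t)\<in>A. r * h \<le> t" by blast
  define W where "W = {x \<in> V. \<forall>\<phi>\<in>fst ` \<Phi>. \<phi> x = 0}"
  define G where "G = {f \<in> dual_on V N. \<forall>v\<in>fst ` F. f v = 0}"
  have W: "W \<in> cof V N" unfolding W_def
    using assms(1,2) by (intro kernel_in_cof) auto
  have G: "G \<in> cof_weak_star V N" unfolding G_def
    using assms(3,4) by (intro annihilator_in_cof_weak_star) auto
  have ne: "W \<noteq> {}" "G \<noteq> {}"
    using W G subspace_0 by (auto simp: cof_def cof_weak_star_def)
  have 1: "\<bar>\<phi> x\<bar> \<le> t" if x: "x \<in> V" "dist_to N x W < h" and \<phi>: "(\<phi>, t) \<in> \<Phi>" for x \<phi> t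
  proof -
    obtain w where w: "w \<in> W" "N (x - w) < h" using near_subspace[OF x(2) ne(1)] by blast
    have wV: "w \<in> V" "\<phi> w = 0" using w \<phi> by (force simp: W_def)+
    note b = bounded_by_onorm_on[OF conjunct2[OF assms(2)[OF \<phi>]] normed_on_real]
    have "\<bar>\<phi> x\<bar> = \<bar>\<phi> (x - w)\<bar>" using bounded_by_minus[OF b(1) x(1) wV(1)] wV by simp
    also have "\<dots> \<le> onorm_on V N abs \<phi> * N (x - w)"
      using bounded_byD(4)[OF b(1)] x wV by (simp add: mem)
    also have "\<dots> \<le> onorm_on V N abs \<phi> * h" using w b(2) by (simp add: mult_left_mono)
    also have "\<dots> \<le> t" using h(2) \<phi> by (force simp: A_def)
    finally show ?thesis .
  qed
  have 2: "\<bar>f v\<bar> \<le> t" if f: "f \<in> dual_on V N" "dist_to (dual_norm_on V N) f G < h" and v: "(v, t) \<in> F" for f v t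
  proof -
    obtain g where g: "g \<in> G" "dual_norm_on V N (f - g) < h" using near_subspace[OF f(2) ne(2)] by blast
    have gV: "g \<in> dual_on V N" "g v = 0" using g v by (force simp: G_def)+
    have vV: "v \<in> V" using assms(4)[OF v] by simp
    have "f - g \<in> dual_on V N" using f gV by (simp add: subspace_diff[OF subspace_dual_on])
    then have "\<bar>f v\<bar> \<le> dual_norm_on V N (f - g) * N v"
      using bounded_byD(4)[OF dual_on_bounded_by(1) vV, of "f - g"] gV by simp
    also have "\<dots> \<le> N v * h" using g(2) nonneg[OF vV] mult_right_mono[of "dual_norm_on V N (f - g)" h "N v"]
      by (simp add: mult.commute)
    also have "\<dots> \<le> t" using h(2) v by (force simp: A_def)
    finally show ?thesis .
  qed
  show ?thesis
    using h(1) W G 1 2 by (intro exI[of _ h] exI[of _ W] exI[of _ G]) (auto simp: legal_opening_def)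
qed

end

text \<open>Averaging over all signs kills the off-diagonal terms of the quadratic form; choosing the signs
  one at a time, each so that the terms linear in it are nonnegative, achieves at least the average.\<close>

lemma exists_signs:
  fixes M :: "'i \<Rightarrow> 'i \<Rightarrow> real"
  assumes "finite E"
  shows "\<exists>\<epsilon> \<in> E \<rightarrow>\<^sub>E {-1, 1}. (\<Sum>i\<in>E. M i i) \<le> (\<Sum>i\<in>E. \<Sum>j\<in>E. \<epsilon> i * \<epsilon> j * M i j)"
  using assms
proof (induction E)
  case empty show ?case by auto
next
  case (insert x E)
  then obtain \<epsilon> where \<epsilon>: "\<epsilon> \<in> E \<rightarrow>\<^sub>E {-1, 1}" "(\<Sum>i\<in>E. M i i) \<le> (\<Sum>i\<in>E. \<Sum>j\<in>E. \<epsilon> i * \<epsilon> j * M i j)"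
    by blast
  define L where "L = (\<Sum>j\<in>E. \<epsilon> j * (M x j + M j x))"
  define s :: real where "s = (if L \<ge> 0 then 1 else -1)"
  have s: "s * s = 1" "s * L \<ge> 0" by (auto simp: s_def)
  define \<epsilon>' where "\<epsilon>' = \<epsilon>(x := s)"
  have "\<epsilon>' \<in> insert x E \<rightarrow>\<^sub>E {-1, 1}"
    using \<epsilon>(1) by (auto simp: \<epsilon>'_def s_def PiE_iff extensional_def)
  moreover have eq: "\<epsilon>' i = \<epsilon> i" if "i \<in> E" for i using that insert by (auto simp: \<epsilon>'_def)
  have "(\<Sum>i\<in>insert x E. \<Sum>j\<in>insert x E. \<epsilon>' i * \<epsilon>' j * M i j)
      = s * s * M x x + s * L + (\<Sum>i\<in>E. \<Sum>j\<in>E. \<epsilon> i * \<epsilon> j * M i j)"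
    using insert(1,2)
    by (simp add: eq sum.distrib L_def sum_distrib_left algebra_simps) (simp add: \<epsilon>'_def)
  ultimately show ?case using s \<epsilon>(2) insert(1,2)
    by (intro bexI[of _ \<epsilon>']) auto
qed

section \<open>Factorizations of the identity\<close>

context normed_subspace
begin

text \<open>Only the product of the two norms is controlled by the definition of a factorization. Multiplying
  \<open>R\<close> by a constant and \<open>S\<close> by its inverse makes the norms equal, so that each is at most the square
  root of the product; this makes factorizations in infinitely many spaces combine.\<close>

lemma balanced_factorization:
  assumes fac: "identity_factors V N \<kappa> T" and T: "bounded_linear_on V N V N T"
    and x0: "x0 \<in> V" "N x0 \<noteq> 0"
  shows "\<exists>R S. bounded_by V N V N (sqrt \<kappa>) R \<and> bounded_by V N V N (sqrt \<kappa>) S \<and> (\<forall>x\<in>V. S (T (R x)) = x)"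
    and "0 \<le> \<kappa>"
proof -
  obtain R0 S0 where R0: "bounded_linear_on V N V N R0" and S0: "bounded_linear_on V N V N S0"
    and le: "onorm_on V N N R0 * onorm_on V N N S0 \<le> \<kappa>" and id: "\<forall>x\<in>V. S0 (T (R0 x)) = x"
    using fac by (auto simp: identity_factors_def)
  define r s where "r = onorm_on V N N R0" and "s = onorm_on V N N S0"
  note Rb = bounded_by_onorm_on[OF R0 normed, folded r_def]
  note Sb = bounded_by_onorm_on[OF S0 normed, folded s_def]
  obtain c where Tb: "bounded_by V N V N c T" using T by (auto simp: bounded_linear_on_iff)
  show "0 \<le> \<kappa>" using le Rb(2) Sb(2) by (simp add: r_def[symmetric] s_def[symmetric]) (meson mult_nonneg_nonneg order_trans)
  have rpos: "r > 0"
  proof (rule ccontr)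
    assume "\<not> r > 0"
    then have "R0 x0 = 0"
      using Rb x0 bounded_byD(4)[OF Rb(1) x0(1)] bounded_byD(1)[OF Rb(1) x0(1)] nonneg eq_0 by fastforce
    then have "x0 = 0" using id x0 bounded_by_0[OF Tb] bounded_by_0[OF Sb(1)] by force
    then show False using x0 N_0 by simp
  qed
  have spos: "s > 0"
  proof (rule ccontr)
    assume "\<not> s > 0"
    moreover have "T (R0 x0) \<in> V" using x0 Rb Tb by (simp add: bounded_byD(1))
    ultimately have "N x0 \<le> 0"
      using Sb id x0 bounded_byD(4)[OF Sb(1), of "T (R0 x0)"] by simp
    then show False using x0 nonneg[OF x0(1)] by simp
  qed
  define a where "a = sqrt s / sqrt r"
  have a: "a > 0" using rpos spos by (simp add: a_def)
  have 1: "\<bar>a\<bar> * r \<le> sqrt \<kappa>"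
  proof -
    have "\<bar>a\<bar> * r = sqrt s * (r / sqrt r)" using rpos spos by (simp add: a_def)
    also have "\<dots> = sqrt (r * s)" using rpos by (simp add: real_div_sqrt real_sqrt_mult)
    finally show ?thesis using le by (simp add: r_def s_def)
  qed
  have 2: "\<bar>1 / a\<bar> * s \<le> sqrt \<kappa>"
  proof -
    have "\<bar>1 / a\<bar> * s = sqrt r * (s / sqrt s)" using a rpos spos by (simp add: a_def)
    also have "\<dots> = sqrt (r * s)" using spos by (simp add: real_div_sqrt real_sqrt_mult)
    finally show ?thesis using le by (simp add: r_def s_def)
  qed
  have "bounded_by V N V N (sqrt \<kappa>) (\<lambda>x. a *\<^sub>R R0 x)"
    by (rule bounded_by_mono[OF bounded_by_scale[OF Rb(1)] 1])
  moreover have "bounded_by V N V N (sqrt \<kappa>) (\<lambda>x. (1 / a) *\<^sub>R S0 x)"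
    by (rule bounded_by_mono[OF bounded_by_scale[OF Sb(1)] 2])
  moreover have "\<forall>x\<in>V. (1 / a) *\<^sub>R S0 (T (a *\<^sub>R R0 x)) = x"
    using a id bounded_byD(1,3)[OF Rb(1)] bounded_byD(1,3)[OF Tb] bounded_byD(3)[OF Sb(1)] by simp
  ultimately show "\<exists>R S. bounded_by V N V N (sqrt \<kappa>) R \<and> bounded_by V N V N (sqrt \<kappa>) S \<and> (\<forall>x\<in>V. S (T (R x)) = x)"
    by (intro exI[of _ "\<lambda>x. a *\<^sub>R R0 x"] exI[of _ "\<lambda>x. (1 / a) *\<^sub>R S0 x"] conjI)
qed

end

lemma impartially_equivalent_upper:
  assumes "impartially_equivalent N x M y C"
  shows "N (\<Sum>i<k. a i *\<^sub>R x i) \<le> sqrt C * M (\<Sum>i<k. a i *\<^sub>R y i)"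
proof -
  define a' where "a' i = (if i < k then a i else 0)" for i
  have fin: "finite {i. a' i \<noteq> 0}"
    by (rule finite_subset[of _ "{..<k}"]) (auto simp: a'_def split: if_splits)
  have sx: "(\<Sum>i | a' i \<noteq> 0. a' i *\<^sub>R x i) = (\<Sum>i<k. a i *\<^sub>R x i)"
    by (rule sum.mono_neutral_cong_left) (auto simp: a'_def split: if_splits)
  have sy: "(\<Sum>i | a' i \<noteq> 0. a' i *\<^sub>R y i) = (\<Sum>i<k. a i *\<^sub>R y i)"
    by (rule sum.mono_neutral_cong_left) (auto simp: a'_def split: if_splits)
  show ?thesis
    using assms[unfolded impartially_equivalent_def, THEN spec, of a', THEN mp, OF fin]
    unfolding sx sy by (rule conjunct2)
qed

section \<open>Unconditional sums of Banach spaces\<close>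

text \<open>Contracting one coefficient averages the given vector with its reflection in that coordinate.\<close>

lemma unconditional_mono:
  fixes e :: "nat \<Rightarrow> 'x::real_normed_vector"
  assumes unc: "\<And>n a \<epsilon>. (\<forall>i. \<epsilon> i \<in> {-1, 1}) \<Longrightarrow>
      norm (\<Sum>i<n. (\<epsilon> i * a i) *\<^sub>R e i) \<le> norm (\<Sum>i<n. a i *\<^sub>R e i)"
    and le: "\<And>i. i < n \<Longrightarrow> \<bar>s i\<bar> \<le> \<bar>t i\<bar>"
  shows "norm (\<Sum>i<n. s i *\<^sub>R e i) \<le> norm (\<Sum>i<n. t i *\<^sub>R e i)"
proof -
  define c where "c i = s i / t i" for i
  have c: "\<bar>c i\<bar> \<le> 1" "s i = c i * t i" if "i < n" for i
    using le[OF that] by (auto simp: c_def abs_divide divide_le_eq_1)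
  define d where "d k i = (if i < k then c i else 1) * t i" for k i
  have "norm (\<Sum>i<n. d k i *\<^sub>R e i) \<le> norm (\<Sum>i<n. t i *\<^sub>R e i)" if "k \<le> n" for k
    using that
  proof (induction k)
    case (Suc k)
    define \<epsilon> :: "nat \<Rightarrow> real" where "\<epsilon> i = (if i = k then -1 else 1)" for i
    define A where "A = norm (\<Sum>i<n. d k i *\<^sub>R e i)"
    have ck: "\<bar>c k\<bar> \<le> 1" using c Suc by simp
    have "d (Suc k) i = (1 + c k) / 2 * d k i + (1 - c k) / 2 * (\<epsilon> i * d k i)" for i
      by (cases "i = k") (auto simp: d_def \<epsilon>_def field_simps)
    then have "(\<Sum>i<n. d (Suc k) i *\<^sub>R e i)
      = ((1 + c k) / 2) *\<^sub>R (\<Sum>i<n. d k i *\<^sub>R e i) + ((1 - c k) / 2) *\<^sub>R (\<Sum>i<n. (\<epsilon> i * d k i) *\<^sub>R e i)"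
      by (simp add: scaleR_sum_right scaleR_add_left sum.distrib)
    then have "norm (\<Sum>i<n. d (Suc k) i *\<^sub>R e i)
      \<le> norm (((1 + c k) / 2) *\<^sub>R (\<Sum>i<n. d k i *\<^sub>R e i)) + norm (((1 - c k) / 2) *\<^sub>R (\<Sum>i<n. (\<epsilon> i * d k i) *\<^sub>R e i))"
      by (simp only: norm_triangle_ineq)
    also have "\<dots> = (1 + c k) / 2 * A + (1 - c k) / 2 * norm (\<Sum>i<n. (\<epsilon> i * d k i) *\<^sub>R e i)"
      using ck by (simp add: A_def)
    also have "\<dots> \<le> (1 + c k) / 2 * A + (1 - c k) / 2 * A"
      unfolding A_def using ck by (intro add_left_mono mult_left_mono unc) (auto simp: \<epsilon>_def)
    also have "\<dots> = A" by (simp add: field_simps)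
    finally show ?case using Suc by (simp add: A_def)
  qed (simp add: d_def)
  moreover have "(\<Sum>i<n. d n i *\<^sub>R e i) = (\<Sum>i<n. s i *\<^sub>R e i)"
    by (rule sum.cong) (auto simp: d_def c(2))
  ultimately show ?thesis by (metis order_refl)
qed

locale banach_sum =
  fixes e :: "nat \<Rightarrow> 'x::banach" and Y :: "nat \<Rightarrow> 'a::real_vector set" and N :: "nat \<Rightarrow> 'a \<Rightarrow> real"
  assumes norm_e: "\<And>n. norm (e n) = 1"
    and unconditional: "\<And>n a \<epsilon>. (\<forall>i. \<epsilon> i \<in> {-1, 1}) \<Longrightarrow>
      norm (\<Sum>i<n. (\<epsilon> i * a i) *\<^sub>R e i) \<le> norm (\<Sum>i<n. a i *\<^sub>R e i)"
    and banach_Y: "\<And>n. banach_on (Y n) (N n)"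
begin

sublocale Y: banach_subspace "Y n" "N n" for n
  using banach_Y[of n] by unfold_locales (auto simp: banach_on_def)

abbreviation Z :: "(nat \<Rightarrow> 'a) set" where "Z \<equiv> sum_space e Y N"
abbreviation NZ :: "(nat \<Rightarrow> 'a) \<Rightarrow> real" where "NZ \<equiv> sum_norm e N"

lemma unconditional_suminf:
  assumes "\<And>i. \<bar>s i\<bar> \<le> t i" "summable (\<lambda>i. t i *\<^sub>R e i)"
  shows "summable (\<lambda>i. s i *\<^sub>R e i)" "norm (\<Sum>i. s i *\<^sub>R e i) \<le> norm (\<Sum>i. t i *\<^sub>R e i)"
proof -
  have t: "\<bar>s i\<bar> \<le> \<bar>t i\<bar>" for i using assms(1)[of i] by simp
  have cut: "(\<Sum>i\<in>{j..<k}. f i *\<^sub>R e i) = (\<Sum>i<k. (if i < j then 0 else f i) *\<^sub>R e i)" for f :: "nat \<Rightarrow> real" and j k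
    by (rule sum.mono_neutral_cong_left) auto
  have blk: "norm (\<Sum>i\<in>{j..<k}. s i *\<^sub>R e i) \<le> norm (\<Sum>i\<in>{j..<k}. t i *\<^sub>R e i)" for j k
    unfolding cut by (rule unconditional_mono[OF unconditional]) (simp_all add: t)
  show sm: "summable (\<lambda>i. s i *\<^sub>R e i)"
    unfolding summable_Cauchy
  proof (intro allI impI)
    fix \<epsilon> :: real assume "\<epsilon> > 0"
    then obtain m where "\<forall>j\<ge>m. \<forall>k. norm (\<Sum>i\<in>{j..<k}. t i *\<^sub>R e i) < \<epsilon>"
      using assms(2) unfolding summable_Cauchy by blast
    then show "\<exists>m. \<forall>j\<ge>m. \<forall>k. norm (\<Sum>i\<in>{j..<k}. s i *\<^sub>R e i) < \<epsilon>"
      using blk by (meson le_less_trans)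
  qed
  show "norm (\<Sum>i. s i *\<^sub>R e i) \<le> norm (\<Sum>i. t i *\<^sub>R e i)"
  proof (rule tendsto_le[OF sequentially_bot])
    show "(\<lambda>k. norm (\<Sum>i<k. t i *\<^sub>R e i)) \<longlonglongrightarrow> norm (\<Sum>i. t i *\<^sub>R e i)"
      by (intro tendsto_norm summable_LIMSEQ assms)
    show "(\<lambda>k. norm (\<Sum>i<k. s i *\<^sub>R e i)) \<longlonglongrightarrow> norm (\<Sum>i. s i *\<^sub>R e i)"
      by (intro tendsto_norm summable_LIMSEQ sm)
    show "\<forall>\<^sub>F k in sequentially. norm (\<Sum>i<k. s i *\<^sub>R e i) \<le> norm (\<Sum>i<k. t i *\<^sub>R e i)"
      using blk[of 0] by (simp add: lessThan_atLeast0)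
  qed
qed

lemma Z_comp: "z \<in> Z \<Longrightarrow> z n \<in> Y n" and Z_summable: "z \<in> Z \<Longrightarrow> summable (\<lambda>n. N n (z n) *\<^sub>R e n)"
  by (auto simp: sum_space_def)

text \<open>The norm of \<open>X\<close> is monotone in the moduli of the coefficients, so \<open>Z\<close> is solid: it contains
  every sequence dominated by one of its members.\<close>

lemma dominated_in_Z:
  assumes z: "z \<in> Z" and w: "\<And>n. w n \<in> Y n" "\<And>n. N n (w n) \<le> c * N n (z n)" and c: "0 \<le> c"
  shows "w \<in> Z" "NZ w \<le> c * NZ z"
proof -
  have sm: "summable (\<lambda>n. (c * N n (z n)) *\<^sub>R e n)"
    using summable_scaleR_right[OF Z_summable[OF z], of c] by simp
  have le: "\<bar>N n (w n)\<bar> \<le> c * N n (z n)" for n using w Y.nonneg by simp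
  show "w \<in> Z" using unconditional_suminf(1)[OF le sm] w by (simp add: sum_space_def)
  have "NZ w \<le> norm (\<Sum>n. (c * N n (z n)) *\<^sub>R e n)"
    using unconditional_suminf(2)[OF le sm] by (simp add: sum_norm_def)
  also have "\<dots> = c * NZ z"
    using suminf_scaleR_right[OF Z_summable[OF z], of c, symmetric] c by (simp add: sum_norm_def)
  finally show "NZ w \<le> c * NZ z" .
qed

lemma finite_in_Z:
  assumes "\<And>n. w n \<in> Y n" "\<And>n. n \<ge> L \<Longrightarrow> w n = 0"
  shows "w \<in> Z" "NZ w = norm (\<Sum>n<L. N n (w n) *\<^sub>R e n)"
proof -
  have *: "N n (w n) *\<^sub>R e n = 0" if "n \<notin> {..<L}" for n
    using assms(2)[of n] that by (simp add: Y.N_0)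
  show "w \<in> Z"
    unfolding sum_space_def using assms(1) summable_finite[OF finite_lessThan *] by auto
  show "NZ w = norm (\<Sum>n<L. N n (w n) *\<^sub>R e n)"
    unfolding sum_norm_def by (rule arg_cong[OF suminf_finite[OF finite_lessThan *]])
qed

lemma comp_le: 
  assumes z: "z \<in> Z" 
  shows "N n (z n) \<le> NZ z"
proof -
  define w where "w k = (if k = n then z k else 0)" for k
  have w: "w k \<in> Y k" "N k (w k) \<le> 1 * N k (z k)" for k
    using Z_comp[OF z] Y.nonneg by (auto simp: w_def Y.mem Y.N_0)
  have "(\<Sum>k<Suc n. N k (w k) *\<^sub>R e k) = N n (z n) *\<^sub>R e n"
    by (subst sum.mono_neutral_right[of _ "{n}"]) (auto simp: w_def Y.N_0)
  moreover have "NZ w = norm (\<Sum>k<Suc n. N k (w k) *\<^sub>R e k)"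
    by (rule finite_in_Z) (use w in \<open>auto simp: w_def\<close>)
  ultimately have "NZ w = N n (z n)"
    using norm_e Y.nonneg[OF Z_comp[OF z]] by simp
  then show ?thesis using dominated_in_Z(2)[OF z w] by simp
qed

lemma embed_in_Z: 
  assumes "y \<in> Y n" shows "sum_embed n y \<in> Z" "NZ (sum_embed n y) = N n y"
proof -
  have w: "sum_embed n y k \<in> Y k" for k using assms by (simp add: sum_embed_def Y.mem)
  have eq: "(\<Sum>k<Suc n. N k (sum_embed n y k) *\<^sub>R e k) = N n y *\<^sub>R e n"
    by (subst sum.mono_neutral_right[of _ "{n}"]) (auto simp: sum_embed_def Y.N_0)
  show "sum_embed n y \<in> Z"
    by (rule finite_in_Z[where L = "Suc n"]) (use w in \<open>auto simp: sum_embed_def\<close>)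
  have "NZ (sum_embed n y) = norm (\<Sum>k<Suc n. N k (sum_embed n y k) *\<^sub>R e k)"
    by (rule finite_in_Z) (use w in \<open>auto simp: sum_embed_def\<close>)
  then show "NZ (sum_embed n y) = N n y"
    using norm_e Y.nonneg[OF assms] by (simp only: eq) simp
qed

lemma normed_Z: "normed_on Z NZ"
proof -
  have add: "z + w \<in> Z \<and> NZ (z + w) \<le> NZ z + NZ w" if zw: "z \<in> Z" "w \<in> Z" for z w
  proof -
    have sm: "summable (\<lambda>n. (N n (z n) + N n (w n)) *\<^sub>R e n)"
      using summable_add[OF Z_summable[OF zw(1)] Z_summable[OF zw(2)]] by (simp add: scaleR_add_left)
    have le: "\<bar>N n ((z + w) n)\<bar> \<le> N n (z n) + N n (w n)" for n
      using Z_comp zw Y.triangle[of "z n" n "w n"] Y.nonneg[of "z n + w n" n] by (simp add: plus_fun_def Y.mem)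
    have "z + w \<in> Z" using unconditional_suminf(1)[OF le sm] Z_comp zw
      by (simp add: sum_space_def plus_fun_def Y.mem)
    moreover have "NZ (z + w) \<le> norm (\<Sum>n. (N n (z n) + N n (w n)) *\<^sub>R e n)"
      using unconditional_suminf(2)[OF le sm] by (simp add: sum_norm_def)
    moreover have "(\<Sum>n. (N n (z n) + N n (w n)) *\<^sub>R e n) = (\<Sum>n. N n (z n) *\<^sub>R e n) + (\<Sum>n. N n (w n) *\<^sub>R e n)"
      using suminf_add[OF Z_summable[OF zw(1)] Z_summable[OF zw(2)]] by (simp add: scaleR_add_left)
    ultimately show ?thesis
      using norm_triangle_ineq[of "\<Sum>n. N n (z n) *\<^sub>R e n" "\<Sum>n. N n (w n) *\<^sub>R e n"]
      by (simp add: sum_norm_def)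
  qed
  have sc: "c *\<^sub>R z \<in> Z \<and> NZ (c *\<^sub>R z) = \<bar>c\<bar> * NZ z" if z: "z \<in> Z" for c z
  proof -
    have eq: "N n ((c *\<^sub>R z) n) *\<^sub>R e n = \<bar>c\<bar> *\<^sub>R (N n (z n) *\<^sub>R e n)" for n
      using Y.scale[OF Z_comp[OF z]] by (simp add: scaleR_fun_def)
    have "c *\<^sub>R z \<in> Z"
      using summable_scaleR_right[OF Z_summable[OF z], of "\<bar>c\<bar>"] Z_comp[OF z]
      unfolding sum_space_def by (simp add: eq) (simp add: scaleR_fun_def Y.mem)
    moreover have "NZ (c *\<^sub>R z) = \<bar>c\<bar> * NZ z"
      using suminf_scaleR_right[OF Z_summable[OF z], of "\<bar>c\<bar>", symmetric]
      unfolding sum_norm_def by (simp only: eq norm_scaleR abs_abs)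
    ultimately show ?thesis by blast
  qed
  have 0: "0 \<in> Z" "NZ 0 = 0"
    using finite_in_Z[of 0 0] by (auto simp: zero_fun_def Y.mem)
  have "subspace Z" using add sc 0 by (auto simp: subspace_def)
  moreover have "z = 0" if z: "z \<in> Z" "NZ z = 0" for z
  proof
    fix n
    have "N n (z n) = 0" using comp_le[OF z(1), of n] z Y.nonneg[OF Z_comp[OF z(1)], of n] by simp
    then show "z n = 0 n" using Y.eq_0[OF Z_comp[OF z(1)]] by (simp add: zero_fun_def)
  qed
  ultimately show ?thesis
    using add sc 0 by (auto simp: normed_on_def sum_norm_def)
qed

sublocale Z: normed_subspace Z NZ
  by unfold_locales (rule normed_Z)

lemma NZ_limit:
  assumes z: "z \<in> Z"
  shows "(\<lambda>L. norm (\<Sum>n<L. N n (z n) *\<^sub>R e n)) \<longlonglongrightarrow> NZ z"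
  unfolding sum_norm_def by (intro tendsto_norm summable_LIMSEQ Z_summable z)

lemma partial_le_NZ:
  assumes z: "z \<in> Z"
  shows "norm (\<Sum>n<L. N n (z n) *\<^sub>R e n) \<le> NZ z"
proof -
  define w where "w k = (if k < L then z k else 0)" for k
  have w: "w k \<in> Y k" "N k (w k) \<le> 1 * N k (z k)" for k
    using Z_comp[OF z] Y.nonneg by (auto simp: w_def Y.mem Y.N_0)
  have "NZ w = norm (\<Sum>k<L. N k (w k) *\<^sub>R e k)"
    by (rule finite_in_Z) (use w in \<open>auto simp: w_def\<close>)
  also have "(\<Sum>k<L. N k (w k) *\<^sub>R e k) = (\<Sum>k<L. N k (z k) *\<^sub>R e k)"
    by (rule sum.cong) (auto simp: w_def)
  finally show ?thesis using dominated_in_Z(2)[OF z w] by simp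
qed

text \<open>The limit of a Cauchy sequence is taken in each component. Estimates on finitely many components
  pass to the limit with a bound independent of their number; membership of the limit in \<open>Z\<close> follows
  by comparing its tails with those of one member of the sequence.\<close>

lemma banach_Z: "banach_on Z NZ"
proof -
  have "\<exists>z\<in>Z. (\<lambda>k. NZ (f k - z)) \<longlonglongrightarrow> 0"
    if fZ: "\<And>k. f k \<in> Z" and cau: "\<And>\<epsilon>. \<epsilon> > 0 \<Longrightarrow> \<exists>m. \<forall>j\<ge>m. \<forall>k\<ge>m. NZ (f j - f k) < \<epsilon>" for f
  proof -
    have fY: "f k n \<in> Y n" for k n using Z_comp[OF fZ] .
    have "\<exists>y\<in>Y n. (\<lambda>k. N n (f k n - y)) \<longlonglongrightarrow> 0" for n
    proof (rule Y.Cauchy_convergent[OF fY])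
      fix \<epsilon> :: real assume "\<epsilon> > 0"
      then obtain m where m: "\<forall>j\<ge>m. \<forall>k\<ge>m. NZ (f j - f k) < \<epsilon>" using cau by blast
      have "N n (f k n - f j n) < \<epsilon>" if "j \<ge> m" "k \<ge> j" for j k
        using comp_le[OF Z.mem_diff[OF fZ fZ], of n k j] m that by (force simp: le_less_trans)
      then show "\<exists>m. \<forall>j\<ge>m. \<forall>k\<ge>j. N n (f k n - f j n) < \<epsilon>" by blast
    qed
    then obtain z where zY: "\<And>n. z n \<in> Y n" and z: "\<And>n. (\<lambda>k. N n (f k n - z n)) \<longlonglongrightarrow> 0" by metis
    have part: "norm (\<Sum>n<L. N n (f k n - z n) *\<^sub>R e n) \<le> \<epsilon>"
      if m: "\<forall>j\<ge>m. \<forall>k\<ge>m. NZ (f j - f k) < \<epsilon>" and k: "k \<ge> m" for L k m \<epsilon>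
    proof (rule tendsto_upperbound[OF _ _ sequentially_bot])
      have "(\<lambda>j. N n (f k n - f j n)) \<longlonglongrightarrow> N n (f k n - z n)" for n
      proof (rule Y.N_tendsto)
        have "N n (f k n - f j n - (f k n - z n)) = N n (f j n - z n)" for j
          using Y.N_diff_commute[OF fY zY, of n j] by (simp add: algebra_simps)
        then show "(\<lambda>j. N n (f k n - f j n - (f k n - z n))) \<longlonglongrightarrow> 0" using z by simp
      qed (simp_all add: Y.mem fY zY)
      then show "(\<lambda>j. norm (\<Sum>n<L. N n (f k n - f j n) *\<^sub>R e n)) \<longlonglongrightarrow> norm (\<Sum>n<L. N n (f k n - z n) *\<^sub>R e n)"
        by (intro tendsto_norm tendsto_sum tendsto_scaleR tendsto_const)
      have "norm (\<Sum>n<L. N n (f k n - f j n) *\<^sub>R e n) \<le> \<epsilon>" if "j \<ge> m" for j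
        using partial_le_NZ[OF Z.mem_diff[OF fZ[of k] fZ[of j]], of L] m k that by force
      then show "\<forall>\<^sub>F j in sequentially. norm (\<Sum>n<L. N n (f k n - f j n) *\<^sub>R e n) \<le> \<epsilon>"
        by (auto simp: eventually_sequentially)
    qed
    have "summable (\<lambda>n. N n (z n) *\<^sub>R e n)"
      unfolding summable_Cauchy
    proof (intro allI impI)
      fix \<epsilon> :: real assume "\<epsilon> > 0"
      then obtain m where m: "\<forall>j\<ge>m. \<forall>k\<ge>m. NZ (f j - f k) < \<epsilon> / 2" using cau half_gt_zero by blast
      obtain p where p: "\<forall>j\<ge>p. \<forall>k. norm (\<Sum>n\<in>{j..<k}. N n (f m n) *\<^sub>R e n) < \<epsilon> / 2"
        using Z_summable[OF fZ, of m] \<open>\<epsilon> > 0\<close> unfolding summable_Cauchy by (meson half_gt_zero)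
      have "norm (\<Sum>n\<in>{j..<k}. N n (z n) *\<^sub>R e n) < \<epsilon>" if "j \<ge> p" for j k
      proof -
        have cut: "(\<Sum>n\<in>{j..<k}. g n *\<^sub>R e n) = (\<Sum>n<k. (if n < j then 0 else g n) *\<^sub>R e n)" for g :: "nat \<Rightarrow> real"
          by (rule sum.mono_neutral_cong_left) auto
        have le: "N n (z n) \<le> N n (f m n - z n) + N n (f m n)" for n
          using Y.triangle_diff[OF fY[of m n] Y.mem_diff[OF fY[of m n] zY]] by simp
        have "norm (\<Sum>n\<in>{j..<k}. N n (z n) *\<^sub>R e n)
          \<le> norm (\<Sum>n\<in>{j..<k}. (N n (f m n - z n) + N n (f m n)) *\<^sub>R e n)"
          unfolding cut using le Y.nonneg[OF zY]
          by (intro unconditional_mono[OF unconditional]) (auto intro: order_trans[OF _ abs_ge_self])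
        also have "\<dots> \<le> norm (\<Sum>n\<in>{j..<k}. N n (f m n - z n) *\<^sub>R e n) + norm (\<Sum>n\<in>{j..<k}. N n (f m n) *\<^sub>R e n)"
          by (simp add: scaleR_add_left sum.distrib norm_triangle_ineq)
        also have "norm (\<Sum>n\<in>{j..<k}. N n (f m n - z n) *\<^sub>R e n) \<le> norm (\<Sum>n<k. N n (f m n - z n) *\<^sub>R e n)"
          unfolding cut by (intro unconditional_mono[OF unconditional]) auto
        also have "\<dots> \<le> \<epsilon> / 2" by (rule part[OF m order_refl])
        finally show ?thesis using p that by (smt (verit) field_sum_of_halves)
      qed
      then show "\<exists>p. \<forall>j\<ge>p. \<forall>k. norm (\<Sum>n\<in>{j..<k}. N n (z n) *\<^sub>R e n) < \<epsilon>" by blast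
    qed
    then have zZ: "z \<in> Z" using zY by (simp add: sum_space_def)
    have "\<forall>\<^sub>F k in sequentially. NZ (f k - z) < \<epsilon>" if \<epsilon>: "\<epsilon> > 0" for \<epsilon>
    proof -
      obtain m where m: "\<forall>j\<ge>m. \<forall>k\<ge>m. NZ (f j - f k) < \<epsilon> / 2" using cau \<epsilon> half_gt_zero by blast
      have "NZ (f k - z) \<le> \<epsilon> / 2" if "k \<ge> m" for k
      proof (rule tendsto_upperbound[OF NZ_limit[OF Z.mem_diff[OF fZ zZ]] _ sequentially_bot])
        show "\<forall>\<^sub>F L in sequentially. norm (\<Sum>n<L. N n ((f k - z) n) *\<^sub>R e n) \<le> \<epsilon> / 2"
          using part[OF m that] by simp
      qed
      then show ?thesis using \<epsilon> unfolding eventually_sequentially by (intro exI[of _ m]) fastforce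
    qed
    then have "(\<lambda>k. NZ (f k - z)) \<longlonglongrightarrow> 0"
      using Z.nonneg[OF Z.mem_diff[OF fZ zZ]] by (simp add: tendsto_iff dist_real_def)
    with zZ show ?thesis by blast
  qed
  then have "Metric_space.mcomplete Z (norm_dist Z NZ)"
    unfolding Z.metric_complete_iff by blast
  then show ?thesis by (simp add: banach_on_def normed_Z)
qed

text \<open>Dominated convergence in \<open>Z\<close>: the tails of the dominating element are small, uniformly in \<open>m\<close>,
  and the remaining finitely many components tend to zero.\<close>

lemma dominated_null:
  assumes z: "z \<in> Z" and wY: "\<And>m n. w m n \<in> Y n" and dom: "\<And>m n. N n (w m n) \<le> c * N n (z n)"
    and c: "0 \<le> c" and lim: "\<And>n. (\<lambda>m. N n (w m n)) \<longlonglongrightarrow> 0"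
  shows "(\<lambda>m. NZ (w m)) \<longlonglongrightarrow> 0"
proof -
  have wZ: "w m \<in> Z" for m by (rule dominated_in_Z[OF z wY dom c])
  have "\<forall>\<^sub>F m in sequentially. NZ (w m) < \<epsilon>" if \<epsilon>: "\<epsilon> > 0" for \<epsilon>
  proof -
    have sm: "summable (\<lambda>n. (c * N n (z n)) *\<^sub>R e n)"
      using summable_scaleR_right[OF Z_summable[OF z], of c] by simp
    then obtain L where L: "\<forall>j\<ge>L. \<forall>k. norm (\<Sum>n\<in>{j..<k}. (c * N n (z n)) *\<^sub>R e n) < \<epsilon> / 2"
      using \<epsilon> unfolding summable_Cauchy by (meson half_gt_zero)
    have cut: "(\<Sum>n\<in>{L..<k}. g n *\<^sub>R e n) = (\<Sum>n<k. (if n < L then 0 else g n) *\<^sub>R e n)" for g :: "nat \<Rightarrow> real" and k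
      by (rule sum.mono_neutral_cong_left) auto
    have bd: "NZ (w m) \<le> (\<Sum>n<L. N n (w m n)) + \<epsilon> / 2" for m
    proof (rule tendsto_upperbound[OF NZ_limit[OF wZ] _ sequentially_bot])
      have "norm (\<Sum>n<k. N n (w m n) *\<^sub>R e n) \<le> (\<Sum>n<L. N n (w m n)) + \<epsilon> / 2" if "k \<ge> L" for k
      proof -
        have "(\<Sum>n<k. N n (w m n) *\<^sub>R e n) = (\<Sum>n<L. N n (w m n) *\<^sub>R e n) + (\<Sum>n\<in>{L..<k}. N n (w m n) *\<^sub>R e n)"
          using that by (simp add: lessThan_atLeast0 sum.atLeastLessThan_concat)
        then have "norm (\<Sum>n<k. N n (w m n) *\<^sub>R e n)
          \<le> norm (\<Sum>n<L. N n (w m n) *\<^sub>R e n) + norm (\<Sum>n\<in>{L..<k}. N n (w m n) *\<^sub>R e n)"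
          by (simp only: norm_triangle_ineq)
        also have "norm (\<Sum>n<L. N n (w m n) *\<^sub>R e n) \<le> (\<Sum>n<L. N n (w m n))"
          using norm_sum[of "\<lambda>n. N n (w m n) *\<^sub>R e n" "{..<L}"] Y.nonneg[OF wY] by (simp add: norm_e)
        also have "norm (\<Sum>n\<in>{L..<k}. N n (w m n) *\<^sub>R e n) \<le> norm (\<Sum>n\<in>{L..<k}. (c * N n (z n)) *\<^sub>R e n)"
          unfolding cut using dom Y.nonneg[OF wY]
          by (intro unconditional_mono[OF unconditional]) (auto intro: order_trans[OF _ abs_ge_self])
        also have "\<dots> \<le> \<epsilon> / 2" using L by (simp add: less_imp_le)
        finally show ?thesis by simp
      qed
      then show "\<forall>\<^sub>F k in sequentially. norm (\<Sum>n<k. N n (w m n) *\<^sub>R e n) \<le> (\<Sum>n<L. N n (w m n)) + \<epsilon> / 2"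
        by (auto simp: eventually_sequentially)
    qed
    have "(\<lambda>m. \<Sum>n<L. N n (w m n)) \<longlonglongrightarrow> (\<Sum>n<L. 0)"
      by (intro tendsto_sum lim)
    then have "\<forall>\<^sub>F m in sequentially. (\<Sum>n<L. N n (w m n)) < \<epsilon> / 2"
      using \<epsilon> by (intro order_tendstoD) auto
    then show ?thesis by eventually_elim (use bd in \<open>smt (verit) field_sum_of_halves\<close>)
  qed
  then show ?thesis
    using Z.nonneg[OF wZ] by (simp add: tendsto_iff dist_real_def)
qed

lemma absolute_in_Z:
  assumes zY: "\<And>n. z n \<in> Y n" and t: "summable t" "\<And>n. N n (z n) \<le> t n"
  shows "z \<in> Z" "NZ z \<le> suminf t"
proof -
  have t0: "0 \<le> t n" for n using Y.nonneg[OF zY, of n] t(2)[of n] by simp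
  have "summable (\<lambda>n. norm (N n (z n) *\<^sub>R e n))"
    by (rule summable_comparison_test'[OF t(1), of 0]) (use t(2) Y.nonneg[OF zY] norm_e in simp)
  then have "summable (\<lambda>n. N n (z n) *\<^sub>R e n)"
    by (rule summable_norm_cancel)
  with zY show z: "z \<in> Z"
    by (simp add: sum_space_def)
  have "norm (\<Sum>n<L. N n (z n) *\<^sub>R e n) \<le> suminf t" for L
  proof -
    have "norm (\<Sum>n<L. N n (z n) *\<^sub>R e n) \<le> (\<Sum>n<L. N n (z n))"
      using norm_sum[of "\<lambda>n. N n (z n) *\<^sub>R e n" "{..<L}"] Y.nonneg[OF zY] by (simp add: norm_e)
    also have "\<dots> \<le> (\<Sum>n<L. t n)" by (intro sum_mono t)
    also have "\<dots> \<le> suminf t" using t t0 by (intro sum_le_suminf) auto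
    finally show ?thesis .
  qed
  then show "NZ z \<le> suminf t"
    by (intro tendsto_upperbound[OF NZ_limit[OF z] _ sequentially_bot]) simp
qed

lemma bounded_by_componentwise:
  assumes "\<And>n. bounded_by (Y n) (N n) (Y n) (N n) c (L n)" "0 \<le> c"
  shows "bounded_by Z NZ Z NZ c (\<lambda>z n. L n (z n))"
  using assms dominated_in_Z[of _ "\<lambda>n. L n (_ n)" c] Z_comp
  unfolding bounded_by_def by (auto simp: plus_fun_def scaleR_fun_def fun_eq_iff)

lemma bounded_by_embed: "bounded_by (Y n) (N n) Z NZ 1 (sum_embed n)"
  by (auto simp: bounded_by_def embed_in_Z) (auto simp: sum_embed_def plus_fun_def scaleR_fun_def)

lemma bounded_by_comp: "bounded_by Z NZ (Y n) (N n) 1 (\<lambda>z. z n)"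
  by (auto simp: bounded_by_def comp_le Z_comp plus_fun_def scaleR_fun_def)

end

section \<open>The enumerated basis of the sum\<close>

locale basis_sum = banach_sum e Y N for e :: "nat \<Rightarrow> 'x::banach" and Y :: "nat \<Rightarrow> 'a::real_vector set" and N +
  fixes b :: "nat \<Rightarrow> nat \<Rightarrow> 'a" and lam :: real and p :: "nat \<Rightarrow> nat \<times> nat"
  assumes basis_Y: "\<And>n. normalized_schauder_basis_on (Y n) (N n) (b n)"
    and constant_Y: "\<And>n. basis_constant (Y n) (N n) (b n) \<le> ereal lam"
    and lam1: "lam \<ge> 1"
    and bij_p: "bij p"
    and p_order: "\<And>n i j k l. i < j \<Longrightarrow> p k = (n, i) \<Longrightarrow> p l = (n, j) \<Longrightarrow> k < l"
begin

sublocale B: basis_space "Y n" "N n" "b n" lam for n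
  using basis_Y constant_Y lam1 by unfold_locales auto

abbreviation co :: "nat \<Rightarrow> nat \<Rightarrow> 'a \<Rightarrow> real" where
  "co n \<equiv> coord (Y n) (N n) (b n)"

abbreviation bt :: "nat \<Rightarrow> nat \<Rightarrow> 'a" where
  "bt \<equiv> \<lambda>m. case p m of (n, i) \<Rightarrow> sum_embed n (b n i)"

definition index :: "nat \<times> nat \<Rightarrow> nat" where "index = inv p"

lemma p_index: "p (index q) = q" and index_p: "index (p m) = m"
  using bij_p by (simp_all add: index_def bij_is_surj surj_f_inv_f bij_is_inj)

lemma index_eq_iff: "index q = index q' \<longleftrightarrow> q = q'"
  using p_index by metis

lemma index_less: "i < j \<Longrightarrow> index (n, i) < index (n, j)"
  using p_order p_index by blast

lemma index_le: "i \<le> j \<Longrightarrow> index (n, i) \<le> index (n, j)"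
  using index_less by (cases "i = j") (auto simp: less_imp_le)

lemma strict_mono_index: "strict_mono (\<lambda>i. index (n, i))"
  by (rule strict_monoI) (rule index_less)

lemma finite_index_less: "finite {q. index q < M}"
proof -
  have "q \<in> p ` {..<M}" if "index q < M" for q
    using that p_index[of q] by (intro image_eqI[of _ _ "index q"]) auto
  then have "{q. index q < M} \<subseteq> p ` {..<M}" by blast
  then show ?thesis by (rule finite_subset) simp
qed

text \<open>The number of vectors of the \<open>n\<close>-th basis among the first \<open>M\<close> vectors of the enumeration.\<close>

definition initial :: "nat \<Rightarrow> nat \<Rightarrow> nat" where "initial n M = (LEAST i. M \<le> index (n, i))"

lemma less_initial_iff: "i < initial n M \<longleftrightarrow> index (n, i) < M"
proof
  assume "i < initial n M"
  then show "index (n, i) < M" using not_less_Least[of i "\<lambda>i. M \<le> index (n, i)"] by (simp add: initial_def)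
next
  assume *: "index (n, i) < M"
  have "M \<le> index (n, initial n M)"
    unfolding initial_def by (rule LeastI[of _ M]) (rule strict_mono_imp_increasing[OF strict_mono_index])
  then show "i < initial n M" using * index_le[of "initial n M" i n] by linarith
qed

lemma initial_index: "initial n (index (n, i)) = i"
proof -
  have "j < initial n (index (n, i)) \<longleftrightarrow> j < i" for j
    using strict_mono_less[OF strict_mono_index, of n j i] by (simp add: less_initial_iff)
  from this[of i] this[of "initial n (index (n, i))"] show ?thesis by simp
qed

lemma filterlim_initial: "filterlim (initial n) at_top sequentially"
  unfolding filterlim_at_top eventually_sequentially
proof
  fix K
  show "\<exists>M0. \<forall>M\<ge>M0. K \<le> initial n M"
  proof (intro exI allI impI)
    fix M assume "Suc (index (n, K)) \<le> M"
    then show "K \<le> initial n M" using less_initial_iff[of K n M] by simp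
  qed
qed

lemma bt_mem: "bt m \<in> Z"
  by (auto split: prod.split intro: embed_in_Z B.b_mem)

lemma partial_sum_component:
  "(\<Sum>m<M. a m *\<^sub>R bt m) n = (\<Sum>i<initial n M. a (index (n, i)) *\<^sub>R b n i)"
proof -
  have "(\<Sum>m<M. a m *\<^sub>R bt m) n = (\<Sum>m<M. a m *\<^sub>R bt m n)"
    by (simp add: scaled_sum_fun_apply)
  also have "\<dots> = (\<Sum>m\<in>(\<lambda>i. index (n, i)) ` {..<initial n M}. a m *\<^sub>R bt m n)"
  proof (rule sum.mono_neutral_right)
    show "(\<lambda>i. index (n, i)) ` {..<initial n M} \<subseteq> {..<M}" by (auto simp: less_initial_iff)
    show "\<forall>m\<in>{..<M} - (\<lambda>i. index (n, i)) ` {..<initial n M}. a m *\<^sub>R bt m n = 0"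
    proof
      fix m assume m: "m \<in> {..<M} - (\<lambda>i. index (n, i)) ` {..<initial n M}"
      obtain n' i where pm: "p m = (n', i)" by (cases "p m")
      then have rm: "index (n', i) = m" using index_p[of m] by simp
      have "n' \<noteq> n"
      proof
        assume "n' = n"
        then have "i < initial n M" using rm m by (simp add: less_initial_iff)
        then show False using m rm \<open>n' = n\<close> by blast
      qed
      then show "a m *\<^sub>R bt m n = 0" by (simp add: pm sum_embed_def)
    qed
  qed simp
  also have "\<dots> = (\<Sum>i<initial n M. a (index (n, i)) *\<^sub>R bt (index (n, i)) n)"
    by (subst sum.reindex) (auto simp: inj_on_def index_eq_iff)
  finally show ?thesis by (simp only: p_index prod.case) (simp add: sum_embed_def)
qed

lemma expansion_Z_iff:
  "expansion_on Z NZ bt z a \<longleftrightarrow> z \<in> Z \<and> (\<lambda>M. NZ ((\<Sum>m<M. a m *\<^sub>R bt m) - z)) \<longlonglongrightarrow> 0"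
  unfolding expansion_on_def by (rule Z.limitin_iff) (intro Z.mem_sum Z.mem_scale bt_mem)

text \<open>The enumeration lists each basis in its own order, so every component of a partial sum in \<open>Z\<close> is
  a partial sum of the expansion of that component. These are bounded by \<open>lam\<close> times the norm of the
  component, and dominated convergence applies.\<close>

lemma expansion_Z:
  assumes z: "z \<in> Z"
  shows "(\<lambda>M. NZ ((\<Sum>m<M. (case p m of (n, i) \<Rightarrow> co n i (z n)) *\<^sub>R bt m) - z)) \<longlonglongrightarrow> 0"
proof (rule dominated_null[OF z])
  let ?a = "\<lambda>m. case p m of (n, i) \<Rightarrow> co n i (z n)"
  let ?P = "\<lambda>n k. \<Sum>i<k. co n i (z n) *\<^sub>R b n i"
  have zn: "z n \<in> Y n" for n using Z_comp[OF z] .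
  have comp: "((\<Sum>m<M. ?a m *\<^sub>R bt m) - z) n = ?P n (initial n M) - z n" for M n
    by (simp only: minus_apply partial_sum_component p_index prod.case)
  have PY: "?P n k \<in> Y n" for n k by (simp add: Y.mem B.b_mem)
  show "((\<Sum>m<M. ?a m *\<^sub>R bt m) - z) n \<in> Y n" for M n
    unfolding comp by (intro Y.mem_diff PY zn)
  show "N n (((\<Sum>m<M. ?a m *\<^sub>R bt m) - z) n) \<le> (lam + 1) * N n (z n)" for M n
    unfolding comp
    using Y.triangle_diff[OF PY[of n "initial n M"] zn[of n]] B.partial_sum_bound[OF zn[of n], of "initial n M"]
    by (simp add: distrib_right)
  show "(\<lambda>M. N n (((\<Sum>m<M. ?a m *\<^sub>R bt m) - z) n)) \<longlonglongrightarrow> 0" for n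
    unfolding comp by (rule filterlim_compose[OF B.coord_limit[OF zn] filterlim_initial])
qed (use lam1 in simp)

text \<open>Just before the vector with index \<open>(n, k)\<close> is reached, the \<open>n\<close>-th component of the partial sum
  consists of exactly \<open>k\<close> terms; along these indices the expansion in \<open>Z\<close> becomes the one in \<open>Y n\<close>.\<close>

lemma expansion_Z_unique:
  assumes "expansion_on Z NZ bt z a"
  shows "a m = (case p m of (n, i) \<Rightarrow> co n i (z n))"
proof -
  obtain n i where pm: "p m = (n, i)" by (cases "p m")
  note lim = assms[unfolded expansion_Z_iff, THEN conjunct2]
    and z = assms[unfolded expansion_Z_iff, THEN conjunct1]
  have lim0: "(\<lambda>k. NZ ((\<Sum>m<index (n, k). a m *\<^sub>R bt m) - z)) \<longlonglongrightarrow> 0"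
    using LIMSEQ_subseq_LIMSEQ[OF lim strict_mono_index] by (simp only: o_def)
  have up: "N n ((\<Sum>i<k. a (index (n, i)) *\<^sub>R b n i) - z n) \<le> NZ ((\<Sum>m<index (n, k). a m *\<^sub>R bt m) - z)" for k
  proof -
    have "(\<Sum>m<index (n, k). a m *\<^sub>R bt m) - z \<in> Z"
      by (intro Z.mem_diff Z.mem_sum Z.mem_scale bt_mem z)
    from comp_le[OF this, of n] show ?thesis
      by (simp only: minus_apply partial_sum_component initial_index)
  qed
  have lo: "0 \<le> N n ((\<Sum>i<k. a (index (n, i)) *\<^sub>R b n i) - z n)" for k
    by (intro Y.nonneg Y.mem_diff Y.mem_sum Y.mem_scale B.b_mem Z_comp[OF z])
  have "(\<lambda>k. N n ((\<Sum>i<k. a (index (n, i)) *\<^sub>R b n i) - z n)) \<longlonglongrightarrow> 0"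
    by (rule tendsto_sandwich[OF always_eventually always_eventually tendsto_const lim0])
       (use lo up in simp_all)
  then have "expansion_on (Y n) (N n) (b n) (z n) (\<lambda>i. a (index (n, i)))"
    using Z_comp[OF z] by (simp add: B.expansion_iff)
  from B.coord_unique[OF this] show ?thesis
    using index_p[of m] by (simp add: pm)
qed

lemma coord_Z: "z \<in> Z \<Longrightarrow> coord Z NZ bt m z = (case p m of (n, i) \<Rightarrow> co n i (z n))"
proof -
  assume z: "z \<in> Z"
  let ?a = "\<lambda>m. case p m of (n, i) \<Rightarrow> co n i (z n)"
  have "(THE a. expansion_on Z NZ bt z a) = ?a"
  proof (rule the_equality)
    show "expansion_on Z NZ bt z ?a" using z expansion_Z by (simp only: expansion_Z_iff simp_thms)
  next
    fix a assume "expansion_on Z NZ bt z a"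
    then show "a = ?a" by (intro ext expansion_Z_unique)
  qed
  then show ?thesis using z by (simp add: coord_def)
qed

lemma functional_expansion:
  assumes z: "z \<in> Z" and g: "bounded_by Z NZ UNIV abs c g"
  shows "(\<lambda>m. (case p m of (n, i) \<Rightarrow> co n i (z n)) * g (bt m)) sums g z"
proof -
  let ?a = "\<lambda>m. case p m of (n, i) \<Rightarrow> co n i (z n)"
  let ?S = "\<lambda>M. \<Sum>m<M. ?a m *\<^sub>R bt m"
  have SZ: "?S M \<in> Z" for M by (intro Z.mem_sum Z.mem_scale bt_mem)
  have gS: "g (?S M) = (\<Sum>m<M. ?a m * g (bt m))" for M
    using Z.bounded_by_scaled_sum[OF g bt_mem, where A = "{..<M}" and a = ?a] by (simp only: real_scaleR_def)
  have "(\<lambda>M. g (?S M) - g z) \<longlonglongrightarrow> 0"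
  proof (rule Lim_null_comparison)
    show "\<forall>\<^sub>F M in sequentially. norm (g (?S M) - g z) \<le> c * NZ (?S M - z)"
      using bounded_byD(4)[OF g Z.mem_diff[OF SZ z]] Z.bounded_by_minus[OF g SZ z] by (simp only: real_norm_def) simp
    show "(\<lambda>M. c * NZ (?S M - z)) \<longlonglongrightarrow> 0"
      by (rule tendsto_mult_right_zero[OF expansion_Z[OF z]])
  qed
  then show ?thesis unfolding sums_def gS LIM_zero_iff .
qed

section \<open>Reduction of an operator to componentwise diagonal operators\<close>

text \<open>Weights for off-diagonal entries, summable both over the enumeration and over the pairs.\<close>

definition weight :: "nat \<times> nat \<Rightarrow> real" where
  "weight q = (1 / 2) ^ (index q + fst q + snd q)"

lemma weight_pos: "0 < weight q"
  by (simp add: weight_def)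

lemma weight_enum: "summable (\<lambda>m. weight (p m))" "(\<Sum>m. weight (p m)) \<le> 2"
proof -
  have le: "weight (p m) \<le> (1 / 2) ^ m" for m
    unfolding weight_def index_p by (intro power_decreasing) auto
  have g: "summable (\<lambda>m. (1 / 2 :: real) ^ m)" by (rule summable_geometric) simp
  show s: "summable (\<lambda>m. weight (p m))"
    by (rule summable_comparison_test'[OF g, of 0]) (use le weight_pos in \<open>simp add: less_imp_le\<close>)
  have "(\<Sum>m. weight (p m)) \<le> (\<Sum>m. (1 / 2 :: real) ^ m)" by (rule suminf_le[OF le s g])
  also have "\<dots> = 2" by (subst suminf_geometric) auto
  finally show "(\<Sum>m. weight (p m)) \<le> 2" .
qed

lemma weight_row: "summable (\<lambda>i. weight (n, i))" "(\<Sum>i. weight (n, i)) \<le> 2 * (1 / 2) ^ n"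
proof -
  have le: "weight (n, i) \<le> (1 / 2) ^ n * (1 / 2) ^ i" for i
    unfolding weight_def power_add[symmetric] by (intro power_decreasing) auto
  have g: "summable (\<lambda>i. (1 / 2) ^ n * (1 / 2 :: real) ^ i)" by (intro summable_mult summable_geometric) simp
  show s: "summable (\<lambda>i. weight (n, i))"
    by (rule summable_comparison_test'[OF g, of 0]) (use le weight_pos in \<open>simp add: less_imp_le\<close>)
  have "(\<Sum>i. weight (n, i)) \<le> (\<Sum>i. (1 / 2) ^ n * (1 / 2 :: real) ^ i)" by (rule suminf_le[OF le s g])
  also have "\<dots> = 2 * (1 / 2) ^ n" by (subst suminf_mult) (auto simp: suminf_geometric)
  finally show "(\<Sum>i. weight (n, i)) \<le> 2 * (1 / 2) ^ n" .
qed

text \<open>With \<open>A\<close> and \<open>B\<close> acting componentwise, the coordinates of \<open>B T A z\<close> are the numbers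
  \<open>f n i (T (A z) n)\<close>. Expanding
  \<open>z\<close> in the basis of \<open>Z\<close>, such a coordinate is its diagonal term plus an absolutely convergent sum of
  off-diagonal ones, each at most \<open>2 lam \<tau>\<close> times two weights and the norm of \<open>z\<close>. The weights sum to at
  most 2 over the columns, to at most \<open>2 (1/2)\<^sup>n\<close> over a row block and thus to at most 4 over all rows,
  which gives the constant \<open>16 = 2 * 2 * 4\<close>. The operators \<open>D n\<close> are individually bounded as the
  diagonal parts of the compressions of \<open>B T A\<close> to the components.\<close>

lemma almost_diagonal:
  assumes T: "bounded_by Z NZ Z NZ cT T" and cT: "0 \<le> cT" and \<kappa>: "0 \<le> \<kappa>" and \<tau>: "0 \<le> \<tau>"
    and x: "\<And>n i. x n i \<in> Y n" and f: "\<And>n i. f n i \<in> dual_on (Y n) (N n)"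
    and xdom: "\<And>n a k. N n (\<Sum>i<k. a i *\<^sub>R x n i) \<le> \<kappa> * N n (\<Sum>i<k. a i *\<^sub>R b n i)"
    and fdom: "\<And>n a k. dual_norm_on (Y n) (N n) (\<Sum>i<k. a i *\<^sub>R f n i)
      \<le> \<kappa> * dual_norm_on (Y n) (N n) (\<Sum>i<k. a i *\<^sub>R co n i)"
    and fb: "\<And>n i k. i < k \<Longrightarrow> \<bar>f n k (b n i)\<bar> \<le> (1 / 2) ^ k"
    and off: "\<And>n i n' i'. (n, i) \<noteq> (n', i') \<Longrightarrow>
      \<bar>f n i (T (sum_embed n' (x n' i')) n)\<bar> \<le> \<tau> * weight (n, i) * weight (n', i')"
  shows "\<exists>A B D.
     (\<forall>n. bounded_by (Y n) (N n) (Y n) (N n) \<kappa> (A n)) \<and>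
     (\<forall>n. bounded_by (Y n) (N n) (Y n) (N n) (\<kappa> * lam) (B n)) \<and>
     (\<forall>n. bounded_linear_on (Y n) (N n) (Y n) (N n) (D n)) \<and>
     (\<forall>n. \<forall>y\<in>Y n. \<forall>i. co n i (D n y) = f n i (T (sum_embed n (x n i)) n) * co n i y) \<and>
     (\<forall>z\<in>Z. (\<lambda>n. B n (T (\<lambda>k. A k (z k)) n) - D n (z n)) \<in> Z \<and>
        NZ (\<lambda>n. B n (T (\<lambda>k. A k (z k)) n) - D n (z n)) \<le> 16 * lam * \<tau> * NZ z)"
proof -
  have "\<exists>A. bounded_by (Y n) (N n) (Y n) (N n) \<kappa> A \<and> (\<forall>i. A (b n i) = x n i)" for n
    by (rule B.operator_of_dominated_sequence[OF x \<kappa> xdom])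
  then obtain A where A: "\<And>n. bounded_by (Y n) (N n) (Y n) (N n) \<kappa> (A n)" and Ab: "\<And>n i. A n (b n i) = x n i"
    by metis
  have "\<exists>B. bounded_by (Y n) (N n) (Y n) (N n) (\<kappa> * lam) B \<and> (\<forall>y\<in>Y n. \<forall>k. co n k (B y) = f n k y)" for n
  proof (rule B.operator_of_dominated_functionals[OF f \<kappa> fdom])
    fix j
    show "summable (\<lambda>k. \<bar>f n k (b n j)\<bar>)"
      by (rule summable_comparison_test'[where N = "Suc j" and g = "\<lambda>k. (1 / 2) ^ k"])
         (use fb in \<open>auto intro: summable_geometric\<close>)
  qed
  then obtain B where B: "\<And>n. bounded_by (Y n) (N n) (Y n) (N n) (\<kappa> * lam) (B n)"
    and Bco: "\<And>n y k. y \<in> Y n \<Longrightarrow> co n k (B n y) = f n k y"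
    by metis
  define AZ where "AZ z = (\<lambda>n. A n (z n))" for z
  have AZ: "bounded_by Z NZ Z NZ \<kappa> AZ"
    unfolding AZ_def by (rule bounded_by_componentwise[OF A \<kappa>])
  define g where "g n i z = f n i (T (AZ z) n)" for n i z
  have TA: "bounded_by Z NZ Z NZ (cT * \<kappa>) (\<lambda>z. T (AZ z))"
    by (rule bounded_by_compose[OF AZ T cT])
  have TAn: "bounded_by Z NZ (Y n) (N n) (1 * (cT * \<kappa>)) (\<lambda>z. T (AZ z) n)" for n
    by (rule bounded_by_compose[OF TA bounded_by_comp]) simp
  have g: "bounded_by Z NZ UNIV abs (dual_norm_on (Y n) (N n) (f n i) * (1 * (cT * \<kappa>))) (g n i)" for n i
    unfolding g_def by (rule bounded_by_compose[OF TAn Y.dual_on_bounded_by[OF f]])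
  have AZ_embed: "AZ (sum_embed n (b n i)) = sum_embed n (x n i)" for n i
  proof
    fix k show "AZ (sum_embed n (b n i)) k = sum_embed n (x n i) k"
      using Y.bounded_by_0[OF A, of k] by (simp add: AZ_def sum_embed_def Ab)
  qed
  define d where "d n i = f n i (T (sum_embed n (x n i)) n)" for n i
  have g_bt: "g n i (sum_embed n' (b n' i')) = f n i (T (sum_embed n' (x n' i')) n)" for n i n' i'
    by (simp add: g_def AZ_embed)
  have h: "\<bar>g n i z - d n i * co n i (z n)\<bar> \<le> 4 * lam * \<tau> * weight (n, i) * NZ z" if z: "z \<in> Z" for n i z
  proof -
    let ?u = "\<lambda>m. (case p m of (n, i) \<Rightarrow> co n i (z n)) * g n i (bt m)"
    let ?m = "index (n, i)"
    \<comment> \<open>The expansion of \<open>g n i z\<close> along the basis of \<open>Z\<close>, with the diagonal term removed.\<close>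
    let ?v = "\<lambda>m. ?u m - (if m = ?m then ?u m else 0)"
    have "(\<lambda>m. if m = ?m then ?u m else 0) sums ?u ?m" by (rule sums_single)
    then have v: "?v sums (g n i z - ?u ?m)"
      by (rule sums_diff[OF functional_expansion[OF z g]])
    have um: "?u ?m = d n i * co n i (z n)" by (simp add: p_index g_bt d_def)
    define c where "c = 2 * lam * NZ z * (\<tau> * weight (n, i))"
    have NZ0: "0 \<le> NZ z" using z by (rule Z.nonneg)
    have c0: "0 \<le> c" using NZ0 lam1 \<tau> weight_pos[of "(n, i)"] by (simp add: c_def)
    have vle: "\<bar>?v m\<bar> \<le> c * weight (p m)" for m
    proof (cases "m = ?m")
      case True then show ?thesis using c0 weight_pos[of "p m"] by (simp add: less_imp_le)
    next
      case False
      obtain n' i' where pm: "p m = (n', i')" by (cases "p m")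
      have ne: "(n, i) \<noteq> (n', i')" using False pm index_p[of m] by auto
      have "\<bar>co n' i' (z n')\<bar> \<le> 2 * lam * N n' (z n')" by (rule B.coord_bound[OF Z_comp[OF z]])
      also have "\<dots> \<le> 2 * lam * NZ z" using comp_le[OF z] lam1 by (intro mult_left_mono) auto
      finally have "\<bar>co n' i' (z n')\<bar> * \<bar>g n i (bt m)\<bar> \<le> (2 * lam * NZ z) * (\<tau> * weight (n, i) * weight (n', i'))"
        using off[OF ne] NZ0 lam1 by (intro mult_mono) (auto simp: pm g_bt)
      then show ?thesis using False by (simp add: pm c_def abs_mult algebra_simps)
    qed
    have sw: "summable (\<lambda>m. c * weight (p m))" by (rule summable_mult[OF weight_enum(1)])
    have sv: "summable (\<lambda>m. \<bar>?v m\<bar>)"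
      by (rule summable_comparison_test'[OF sw, of 0]) (use vle in simp)
    have "\<bar>g n i z - ?u ?m\<bar> = \<bar>suminf ?v\<bar>" using sums_unique[OF v] by simp
    also have "\<dots> \<le> (\<Sum>m. \<bar>?v m\<bar>)" by (rule summable_rabs[OF sv])
    also have "\<dots> \<le> (\<Sum>m. c * weight (p m))" by (rule suminf_le[OF vle sv sw])
    also have "\<dots> = c * (\<Sum>m. weight (p m))" by (rule suminf_mult[OF weight_enum(1)])
    also have "\<dots> \<le> c * 2" using weight_enum(2) c0 by (rule mult_left_mono)
    also have "\<dots> = 4 * lam * \<tau> * weight (n, i) * NZ z" by (simp add: c_def)
    finally show ?thesis unfolding um .
  qed
  have "\<exists>D. bounded_linear_on (Y n) (N n) (Y n) (N n) D \<and> (\<forall>y\<in>Y n. \<forall>i. co n i (D y) = d n i * co n i y)" for n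
  proof -
    have "bounded_by (Y n) (N n) (Y n) (N n) (1 * (cT * \<kappa>) * 1) (\<lambda>y. T (AZ (sum_embed n y)) n)"
      by (rule bounded_by_compose[OF bounded_by_embed TAn]) (use cT \<kappa> in simp)
    then have L: "bounded_by (Y n) (N n) (Y n) (N n) (\<kappa> * lam * (1 * (cT * \<kappa>) * 1))
        (\<lambda>y. B n (T (AZ (sum_embed n y)) n))"
      by (rule bounded_by_compose[OF _ B]) (use lam1 \<kappa> in simp)
    have "\<bar>co n i (B n (T (AZ (sum_embed n y)) n)) - d n i * co n i y\<bar> \<le> 4 * lam * \<tau> * weight (n, i) * N n y"
      if y: "y \<in> Y n" for y i
      using h[OF embed_in_Z(1)[OF y], of n i] bounded_byD(1)[OF TAn embed_in_Z(1)[OF y]]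
      by (simp add: Bco g_def embed_in_Z(2)[OF y]) (simp add: sum_embed_def)
    from B.diagonal_part[OF L _ this] show ?thesis
      using weight_row(1)[of n] by (auto simp: bounded_linear_on_iff summable_mult)
  qed
  then obtain D where D: "\<And>n. bounded_linear_on (Y n) (N n) (Y n) (N n) (D n)"
    and Dco: "\<And>n y i. y \<in> Y n \<Longrightarrow> co n i (D n y) = d n i * co n i y"
    by metis
  have E: "(\<lambda>n. B n (T (\<lambda>k. A k (z k)) n) - D n (z n)) \<in> Z \<and>
     NZ (\<lambda>n. B n (T (\<lambda>k. A k (z k)) n) - D n (z n)) \<le> 16 * lam * \<tau> * NZ z" if z: "z \<in> Z" for z
  proof -
    define v where "v n = B n (T (AZ z) n) - D n (z n)" for n
    define c where "c = 4 * lam * \<tau> * NZ z"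
    have c0: "0 \<le> c" using Z.nonneg[OF z] lam1 \<tau> by (simp add: c_def)
    have zn: "z n \<in> Y n" for n by (rule Z_comp[OF z])
    have TY: "T (AZ z) n \<in> Y n" for n by (rule bounded_byD(1)[OF TAn z])
    have BY: "B n (T (AZ z) n) \<in> Y n" for n by (rule bounded_byD(1)[OF B TY])
    have DY: "D n (z n) \<in> Y n" for n using D[of n] zn by (auto simp: bounded_linear_on_def)
    have vY: "v n \<in> Y n" for n unfolding v_def by (intro Y.mem_diff BY DY)
    have "N n (v n) \<le> (\<Sum>i. c * weight (n, i))" for n
    proof (rule B.N_le_suminf_coord[OF vY])
      show "summable (\<lambda>i. c * weight (n, i))" by (rule summable_mult[OF weight_row(1)])
      fix i
      have "co n i (v n) = g n i z - d n i * co n i (z n)"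
        unfolding v_def
        using Y.bounded_by_minus[OF B.coord_bounded_by BY DY] by (simp add: Bco[OF TY] Dco[OF zn] g_def)
      then show "\<bar>co n i (v n)\<bar> \<le> c * weight (n, i)"
        using h[OF z, of n i] by (simp add: c_def algebra_simps)
    qed
    also have "(\<Sum>i. c * weight (n, i)) \<le> c * (2 * (1 / 2) ^ n)" for n
      unfolding suminf_mult[OF weight_row(1)] by (rule mult_left_mono[OF weight_row(2) c0])
    finally have vle: "N n (v n) \<le> c * (2 * (1 / 2) ^ n)" for n .
    have s: "summable (\<lambda>n. c * (2 * (1 / 2 :: real) ^ n))" by (intro summable_mult summable_geometric) simp
    have "(\<Sum>n. c * (2 * (1 / 2 :: real) ^ n)) = c * (2 * (\<Sum>n. (1 / 2) ^ n))"
      by (simp add: suminf_mult summable_mult summable_geometric)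
    also have "\<dots> = 4 * c" by (simp add: suminf_geometric)
    finally have "v \<in> Z \<and> NZ v \<le> 4 * c"
      using absolute_in_Z[OF vY s vle] by simp
    then show ?thesis by (simp add: v_def[abs_def] c_def AZ_def)
  qed
  show ?thesis
    using A B D E Dco unfolding d_def by (intro exI[of _ A] exI[of _ B] exI[of _ D]) auto
qed

end

section \<open>Playing the games simultaneously\<close>

context basis_space
begin

lemma reply_vector_mem: "reply_vector b r \<epsilon> \<in> V"
  by (auto simp: reply_vector_def split: prod.split intro!: mem b_mem)

lemma reply_functional_dual: "reply_functional (coord V N b) r \<epsilon> \<in> dual_on V N"
  by (auto simp: reply_functional_def split: prod.split
      intro!: subspace_sum[OF subspace_dual_on] subspace_scale[OF subspace_dual_on] coord_dual)

text \<open>The reply is supported where all diagonal entries of \<open>L\<close> have the same sign, so they cannot cancel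
  in \<open>\<Sum>\<^sub>k \<lambda>\<^sub>k \<mu>\<^sub>k b\<^sub>k\<^sup>*(L b\<^sub>k)\<close>, the average of \<open>x\<^sup>*(L x)\<close> over all signs. Some signs reach this average.\<close>

lemma exists_good_signs:
  assumes L: "bounded_by V N V N c L" and r: "legal_reply N1 N2 \<eta> r" and \<delta>: "0 \<le> \<delta>"
    and N1: "\<And>k. k \<in> N1 \<Longrightarrow> \<delta> \<le> coord V N b k (L (b k))"
    and N2: "\<And>k. k \<in> N2 \<Longrightarrow> coord V N b k (L (b k)) \<le> - \<delta>"
  shows "\<exists>\<epsilon>\<in>reply_support r \<rightarrow>\<^sub>E {-1, 1}.
    \<delta> * (1 - \<eta>) \<le> \<bar>reply_functional (coord V N b) r \<epsilon> (L (reply_vector b r \<epsilon>))\<bar>"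
proof -
  obtain i0 E l m where r_eq: "r = (i0, E, l, m)" by (cases r)
  have E: "finite E" "E \<subseteq> (if i0 = 1 then N1 else N2)" and lm: "\<And>j. j \<in> E \<Longrightarrow> 0 \<le> l j \<and> 0 \<le> m j"
    and sum: "1 - \<eta> < (\<Sum>j\<in>E. l j * m j)"
    using r by (auto simp: legal_reply_def r_eq)
  define s :: real where "s = (if i0 = 1 then 1 else -1)"
  define a where "a k j = coord V N b k (L (b j))" for k j
  obtain \<epsilon> where \<epsilon>: "\<epsilon> \<in> E \<rightarrow>\<^sub>E {-1, 1}"
    "(\<Sum>k\<in>E. s * (m k * l k * a k k)) \<le> (\<Sum>k\<in>E. \<Sum>j\<in>E. \<epsilon> k * \<epsilon> j * (s * (m k * l j * a k j)))"
    using exists_signs[OF E(1), of "\<lambda>k j. s * (m k * l j * a k j)"] by blast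
  have "\<delta> * (1 - \<eta>) \<le> \<delta> * (\<Sum>j\<in>E. l j * m j)"
    using \<delta> sum by (intro mult_left_mono) auto
  also have "\<dots> \<le> (\<Sum>k\<in>E. s * (m k * l k * a k k))"
    unfolding sum_distrib_left
  proof (rule sum_mono)
    fix k assume k: "k \<in> E"
    then have "\<delta> \<le> s * a k k"
      using N1[of k] N2[of k] E(2) by (auto simp: s_def a_def split: if_splits)
    then have "l k * m k * \<delta> \<le> l k * m k * (s * a k k)"
      using lm[OF k] by (intro mult_left_mono) auto
    then show "\<delta> * (l k * m k) \<le> s * (m k * l k * a k k)" by (simp add: mult_ac)
  qed
  also have "\<dots> \<le> (\<Sum>k\<in>E. \<Sum>j\<in>E. \<epsilon> k * \<epsilon> j * (s * (m k * l j * a k j)))" by (rule \<epsilon>(2))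
  also have "\<dots> = s * (\<Sum>k\<in>E. (\<epsilon> k * m k) * (\<Sum>j\<in>E. (\<epsilon> j * l j) * a k j))"
    by (simp add: sum_distrib_left mult_ac)
  also have "(\<lambda>k. \<Sum>j\<in>E. (\<epsilon> j * l j) * a k j) = (\<lambda>k. coord V N b k (L (reply_vector b r \<epsilon>)))"
  proof
    fix k
    have LV: "L (b j) \<in> V" for j using bounded_byD(1)[OF L b_mem] .
    have "L (reply_vector b r \<epsilon>) = (\<Sum>j\<in>E. (\<epsilon> j * l j) *\<^sub>R L (b j))"
      unfolding reply_vector_def r_eq prod.case by (rule bounded_by_scaled_sum[OF L b_mem])
    then show "(\<Sum>j\<in>E. (\<epsilon> j * l j) * a k j) = coord V N b k (L (reply_vector b r \<epsilon>))"
      using bounded_by_scaled_sum[OF coord_bounded_by LV, where A = E and a = "\<lambda>j. \<epsilon> j * l j"] by (simp add: a_def)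
  qed
  also have "s * (\<Sum>k\<in>E. (\<epsilon> k * m k) * coord V N b k (L (reply_vector b r \<epsilon>)))
      = s * reply_functional (coord V N b) r \<epsilon> (L (reply_vector b r \<epsilon>))"
    by (simp add: reply_functional_def r_eq scaled_sum_fun_apply)
  also have "\<dots> \<le> \<bar>reply_functional (coord V N b) r \<epsilon> (L (reply_vector b r \<epsilon>))\<bar>"
    by (auto simp: s_def)
  finally show ?thesis using \<epsilon>(1) by (intro bexI[of _ \<epsilon>]) (auto simp: reply_support_def r_eq)
qed

end

context basis_sum
begin

text \<open>The turns of all games are interleaved along the enumeration: turn \<open>i\<close> of the game on \<open>Y n\<close> takes
  place at time \<open>index (n, i)\<close>. A play is a function \<open>F\<close> assigning to each pair the opening and the signs
  of player (I); it is built by recursion on that time. An off-diagonal entry is made small at the later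
  of its two times, through \<open>W\<close> if the vector is the newer one and through \<open>G\<close> if the functional is.\<close>

lemma reproduced_sequences:
  assumes T: "bounded_by Z NZ Z NZ cT T" and cT: "0 \<le> cT"
    and \<sigma>: "\<And>n. winning_strategy (Y n) (N n) (b n) C \<eta> (\<sigma> n)"
    and \<delta>: "0 < \<delta>" and diag: "\<And>n i. \<delta> \<le> \<bar>co n i (T (sum_embed n (b n i)) n)\<bar>" and \<tau>: "0 < \<tau>"
  shows "\<exists>x f.
     (\<forall>n i. x n i \<in> Y n) \<and> (\<forall>n i. f n i \<in> dual_on (Y n) (N n)) \<and>
     (\<forall>n. impartially_equivalent (N n) (x n) (N n) (b n) (C + \<eta>)) \<and>
     (\<forall>n. impartially_equivalent (dual_norm_on (Y n) (N n)) (f n) (dual_norm_on (Y n) (N n)) (co n) (C + \<eta>)) \<and>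
     (\<forall>n i k. i < k \<longrightarrow> \<bar>f n k (b n i)\<bar> \<le> (1 / 2) ^ k) \<and>
     (\<forall>n i n' i'. (n, i) \<noteq> (n', i') \<longrightarrow>
        \<bar>f n i (T (sum_embed n' (x n' i')) n)\<bar> \<le> \<tau> * weight (n, i) * weight (n', i')) \<and>
     (\<forall>n i. \<delta> * (1 - \<eta>) \<le> \<bar>f n i (T (sum_embed n (x n i)) n)\<bar>)"
proof -
  define N1 where "N1 n = {i. 0 \<le> co n i (T (sum_embed n (b n i)) n)}" for n
  define N2 where "N2 n = - N1 n" for n
  define rep where "rep F n i = \<sigma> n (N1 n, N2 n) (map (\<lambda>j. fst (F (n, j))) [0..<Suc i]) (map (\<lambda>j. snd (F (n, j))) [0..<i])"
    for F :: "nat \<times> nat \<Rightarrow> 'a rep_opening \<times> (nat \<Rightarrow> real)" and n i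
  define xv where "xv F n i = reply_vector (b n) (rep F n i) (snd (F (n, i)))" for F n i
  define xf where "xf F n i = reply_functional (co n) (rep F n i) (snd (F (n, i)))" for F n i
  define tol where "tol q q' = \<tau> * weight q * weight q'" for q q'
  have tol: "0 < tol q q'" for q q' using \<tau> weight_pos by (simp add: tol_def)
  have tol_commute: "tol q q' = tol q' q" for q q' by (simp add: tol_def)
  \<comment> \<open>The last bound, at earlier basis vectors of the same space, makes \<open>\<Sum>\<^sub>k |x\<^sub>k\<^sup>*(b\<^sub>j)|\<close> converge.\<close>
  define good_opening where "good_opening F n i = (\<lambda>(h, W, G).
      legal_opening (Y n) (N n) (h, W, G) \<and>
      (\<forall>y\<in>Y n. dist_to (N n) y W < h \<longrightarrow> (\<forall>q. index q < index (n, i) \<longrightarrow>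
         \<bar>xf F (fst q) (snd q) (T (sum_embed n y) (fst q))\<bar> \<le> tol q (n, i))) \<and>
      (\<forall>\<phi>\<in>dual_on (Y n) (N n). dist_to (dual_norm_on (Y n) (N n)) \<phi> G < h \<longrightarrow>
         (\<forall>q. index q < index (n, i) \<longrightarrow> \<bar>\<phi> (T (sum_embed (fst q) (xv F (fst q) (snd q))) n)\<bar> \<le> tol q (n, i)) \<and>
         (\<forall>j<i. \<bar>\<phi> (b n j)\<bar> \<le> (1 / 2) ^ i)))" for F n i
  \<comment> \<open>A winning strategy guarantees legal replies only in complete plays. The condition on the signs is
    therefore conditional here; once the whole play exists, all its replies turn out to be legal.\<close>
  define good where "good F n i \<longleftrightarrow> good_opening F n i (fst (F (n, i))) \<and>
      snd (F (n, i)) \<in> reply_support (rep F n i) \<rightarrow>\<^sub>E {-1, 1} \<and>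
      (legal_reply (N1 n) (N2 n) \<eta> (rep F n i) \<longrightarrow>
         \<delta> * (1 - \<eta>) \<le> \<bar>xf F n i (T (sum_embed n (xv F n i)) n)\<bar>)" for F n i
  have xvY: "xv F n i \<in> Y n" for F n i unfolding xv_def by (rule B.reply_vector_mem)
  have xfD: "xf F n i \<in> dual_on (Y n) (N n)" for F n i unfolding xf_def by (rule B.reply_functional_dual)
  have rep_cong: "rep F n i = rep G n i"
    if "\<And>j. j \<le> i \<Longrightarrow> fst (F (n, j)) = fst (G (n, j))" "\<And>j. j < i \<Longrightarrow> snd (F (n, j)) = snd (G (n, j))" for F G n i
    unfolding rep_def by (intro arg_cong2[where f = "\<sigma> n (N1 n, N2 n)"] map_cong) (use that in auto)
  have past_cong: "rep F (fst q) (snd q) = rep G (fst q) (snd q) \<and> xv F (fst q) (snd q) = xv G (fst q) (snd q)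
      \<and> xf F (fst q) (snd q) = xf G (fst q) (snd q)"
    if eq: "\<And>q'. index q' \<le> index q \<Longrightarrow> F q' = G q'" for F G q
  proof -
    have "F (fst q, j) = G (fst q, j)" if "j \<le> snd q" for j
      by (rule eq) (use index_le[OF that, of "fst q"] in simp)
    then have "rep F (fst q) (snd q) = rep G (fst q) (snd q)"
      by (auto intro!: rep_cong)
    moreover have "F q = G q" by (rule eq) simp
    ultimately show ?thesis by (simp add: xv_def xf_def)
  qed
  have good_opening_cong: "good_opening F n i = good_opening G n i"
    if eq: "\<And>q. index q < index (n, i) \<Longrightarrow> F q = G q" for F G n i
  proof -
    have "xv F (fst q) (snd q) = xv G (fst q) (snd q)" "xf F (fst q) (snd q) = xf G (fst q) (snd q)"
      if "index q < index (n, i)" for q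
      using past_cong[of q F G] eq that by (meson le_less_trans)+
    then show ?thesis unfolding good_opening_def by (simp cong: imp_cong)
  qed
  \<comment> \<open>Written as an update, so that the recursion separates the current move from the past.\<close>
  have "\<exists>F. \<forall>q. good (F(q := F q)) (fst q) (snd q)"
  proof (rule dependent_wf_choice[where R = "inv_image less_than index" and P = "\<lambda>F q r. good (F(q := r)) (fst q) (snd q)"])
    fix F G :: "nat \<times> nat \<Rightarrow> 'a rep_opening \<times> (nat \<Rightarrow> real)" and q r
    assume eq: "\<And>q'. (q', q) \<in> inv_image less_than index \<Longrightarrow> F q' = G q'"
    have eq': "(F(q := r)) q' = (G(q := r)) q'" if "index q' \<le> index q" for q'
      using eq[of q'] that index_eq_iff[of q' q] by (cases "q' = q") auto
    have "good_opening (F(q := r)) (fst q) (snd q) = good_opening (G(q := r)) (fst q) (snd q)"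
      by (rule good_opening_cong) (use eq' in \<open>simp add: less_imp_le\<close>)
    with past_cong[of q "F(q := r)" "G(q := r)", OF eq'] show "good (F(q := r)) (fst q) (snd q) = good (G(q := r)) (fst q) (snd q)"
      unfolding good_def by simp
  next
    fix q :: "nat \<times> nat" and F :: "nat \<times> nat \<Rightarrow> 'a rep_opening \<times> (nat \<Rightarrow> real)"
    obtain n i where q: "q = (n, i)" by (cases q)
    let ?P = "{q. index q < index (n, i)}"
    define \<Phi> where "\<Phi> = (\<lambda>q. (\<lambda>y. xf F (fst q) (snd q) (T (sum_embed n y) (fst q)), tol q (n, i))) ` ?P"
    define Fv where "Fv = (\<lambda>q. (T (sum_embed (fst q) (xv F (fst q) (snd q))) n, tol q (n, i))) ` ?P
      \<union> (\<lambda>j. (b n j, (1 / 2) ^ i)) ` {..<i}"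
    have fin: "finite \<Phi>" "finite Fv" using finite_index_less by (auto simp: \<Phi>_def Fv_def)
    have bl: "bounded_linear_on (Y n) (N n) UNIV abs (\<lambda>y. xf F n' i' (T (sum_embed n y) n'))" for n' i'
      unfolding bounded_linear_on_iff
      using bounded_by_compose[OF bounded_by_compose[OF bounded_by_compose[OF bounded_by_embed T cT] bounded_by_comp]
          Y.dual_on_bounded_by[OF xfD]] by (metis zero_le_one)
    have TY: "T (sum_embed n' (xv F n' i')) n \<in> Y n" for n' i'
      by (intro Z_comp bounded_byD(1)[OF T] embed_in_Z xvY)
    have \<Phi>: "0 < t \<and> bounded_linear_on (Y n) (N n) UNIV abs \<phi>" if "(\<phi>, t) \<in> \<Phi>" for \<phi> t
      using that tol bl by (auto simp: \<Phi>_def)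
    have Fv: "0 < t \<and> v \<in> Y n" if "(v, t) \<in> Fv" for v t
      using that tol TY B.b_mem by (auto simp: Fv_def)
    obtain h W G where o: "legal_opening (Y n) (N n) (h, W, G)"
      "\<forall>y\<in>Y n. dist_to (N n) y W < h \<longrightarrow> (\<forall>(\<phi>, t)\<in>\<Phi>. \<bar>\<phi> y\<bar> \<le> t)"
      "\<forall>f\<in>dual_on (Y n) (N n). dist_to (dual_norm_on (Y n) (N n)) f G < h \<longrightarrow> (\<forall>(v, t)\<in>Fv. \<bar>f v\<bar> \<le> t)"
      using Y.exists_opening[OF fin(1) \<Phi> fin(2) Fv] by blast
    then have go: "good_opening F n i (h, W, G)"
      by (auto simp: good_opening_def \<Phi>_def Fv_def ball_Un)
    define R where "R = rep (F(q := ((h, W, G), undefined))) n i"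
    \<comment> \<open>The reply depends on the current opening, but not yet on the signs that answer it.\<close>
    have rep: "rep (F(q := ((h, W, G), \<epsilon>))) n i = R" for \<epsilon>
      unfolding R_def by (rule rep_cong) (auto simp: q)
    define L where "L y = T (sum_embed n y) n" for y
    have L: "bounded_by (Y n) (N n) (Y n) (N n) (1 * (cT * 1)) L"
      unfolding L_def by (rule bounded_by_compose[OF bounded_by_compose[OF bounded_by_embed T cT] bounded_by_comp]) simp
    have "\<exists>\<epsilon>\<in>reply_support R \<rightarrow>\<^sub>E {-1, 1}. legal_reply (N1 n) (N2 n) \<eta> R \<longrightarrow>
        \<delta> * (1 - \<eta>) \<le> \<bar>reply_functional (co n) R \<epsilon> (L (reply_vector (b n) R \<epsilon>))\<bar>"
    proof (cases "legal_reply (N1 n) (N2 n) \<eta> R")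
      case True
      have "\<delta> \<le> co n k (L (b n k))" if "k \<in> N1 n" for k
        using that diag[of n k] by (simp add: N1_def L_def)
      moreover have "co n k (L (b n k)) \<le> - \<delta>" if "k \<in> N2 n" for k
        using that diag[of n k] by (simp add: N1_def N2_def L_def)
      ultimately show ?thesis
        using B.exists_good_signs[OF L True] \<delta> by (meson less_imp_le)
    next
      case False
      have "(\<lambda>_\<in>reply_support R. 1) \<in> reply_support R \<rightarrow>\<^sub>E {-1, 1 :: real}" by simp
      with False show ?thesis by blast
    qed
    then obtain \<epsilon> where \<epsilon>: "\<epsilon> \<in> reply_support R \<rightarrow>\<^sub>E {-1, 1}" "legal_reply (N1 n) (N2 n) \<eta> R \<longrightarrow>
        \<delta> * (1 - \<eta>) \<le> \<bar>reply_functional (co n) R \<epsilon> (L (reply_vector (b n) R \<epsilon>))\<bar>" by blast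
    have "good_opening (F(q := ((h, W, G), \<epsilon>))) n i = good_opening F n i"
      by (rule good_opening_cong) (auto simp: q)
    then have "good (F(q := ((h, W, G), \<epsilon>))) (fst q) (snd q)"
      using go \<epsilon> by (simp add: good_def xv_def xf_def rep[unfolded q] q L_def)
    then show "\<exists>r. good (F(q := r)) (fst q) (snd q)" by blast
  qed simp
  then obtain F where "\<And>n i. good F n i" by (auto simp: fun_upd_triv)
  then have go: "\<And>n i. good_opening F n i (fst (F (n, i)))"
    and sg: "\<And>n i. snd (F (n, i)) \<in> reply_support (rep F n i) \<rightarrow>\<^sub>E {-1, 1}"
    and dg: "\<And>n i. legal_reply (N1 n) (N2 n) \<eta> (rep F n i) \<Longrightarrow>
        \<delta> * (1 - \<eta>) \<le> \<bar>xf F n i (T (sum_embed n (xv F n i)) n)\<bar>"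
    by (auto simp: good_def)
  define h W G where "h n k = fst (fst (F (n, k)))" and "W n k = fst (snd (fst (F (n, k))))"
    and "G n k = snd (snd (fst (F (n, k))))" for n k
  have hWG: "fst (F (n, k)) = (h n k, W n k, G n k)" for n k
    by (simp add: h_def W_def G_def)
  have play: "(\<forall>k. legal_reply (N1 n) (N2 n) \<eta> (rep F n k)) \<and>
      player_II_wins (Y n) (N n) (b n) C \<eta> (\<lambda>k. fst (F (n, k))) (xv F n) (xf F n)" for n
  proof -
    have "\<forall>k. legal_opening (Y n) (N n) (fst (F (n, k)))"
      using go[of n] by (simp add: good_opening_def hWG)
    moreover have "N1 n \<union> N2 n = UNIV" "N1 n \<inter> N2 n = {}" by (auto simp: N2_def)
    ultimately show ?thesis
      using \<sigma>[of n, unfolded winning_strategy_def Let_def, rule_format, of "N1 n" "N2 n" "\<lambda>k. fst (F (n, k))" "\<lambda>k. snd (F (n, k))",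
          folded rep_def, folded xv_def xf_def] sg[of n] by blast
  qed
  have near: "dist_to (N n) (xv F n k) (W n k) < h n k" "dist_to (dual_norm_on (Y n) (N n)) (xf F n k) (G n k) < h n k" for n k
    using play[of n] hWG[of n k] by (auto simp: player_II_wins_def dest!: spec[of _ k])
  have go': "good_opening F n i (h n i, W n i, G n i)" for n i using go[of n i] by (simp add: hWG)
  have vec: "\<bar>xf F (fst q) (snd q) (T (sum_embed n (xv F n i)) (fst q))\<bar> \<le> tol q (n, i)"
    if "index q < index (n, i)" for q n i
    using go'[of n i] near(1)[of n i] xvY[of F n i] that
    unfolding good_opening_def prod.case by blast
  have functional: "\<bar>xf F n i (T (sum_embed (fst q) (xv F (fst q) (snd q))) n)\<bar> \<le> tol q (n, i)"
    if "index q < index (n, i)" for q n i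
    using go'[of n i] near(2)[of n i] xfD[of F n i] that
    unfolding good_opening_def prod.case by blast
  have fb: "\<bar>xf F n k (b n i)\<bar> \<le> (1 / 2) ^ k" if "i < k" for n i k
    using go'[of n k] near(2)[of n k] xfD[of F n k] that
    unfolding good_opening_def prod.case by blast
  have off: "\<bar>xf F n i (T (sum_embed n' (xv F n' i')) n)\<bar> \<le> \<tau> * weight (n, i) * weight (n', i')"
    if ne: "(n, i) \<noteq> (n', i')" for n i n' i'
  proof -
    consider "index (n, i) < index (n', i')" | "index (n', i') < index (n, i)"
      using ne index_eq_iff by (metis linorder_neqE_nat)
    then show ?thesis
    proof cases
      case 1 from vec[OF this] show ?thesis by (simp add: tol_def)
    next
      case 2 from functional[OF this] show ?thesis by (simp add: tol_def mult_ac)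
    qed
  qed
  show ?thesis
  proof (rule exI[of _ "xv F"], rule exI[of _ "xf F"], intro conjI allI impI)
    fix n i
    show "\<delta> * (1 - \<eta>) \<le> \<bar>xf F n i (T (sum_embed n (xv F n i)) n)\<bar>"
      using play[of n] dg by blast
  qed (use xvY xfD play fb off in \<open>auto simp: player_II_wins_def\<close>)
qed

section \<open>Factoring the identity of the sum\<close>

text \<open>As \<open>S D R\<close> is the identity in each component, \<open>U = S B T A R\<close> differs from the identity of \<open>Z\<close> by
  \<open>S (B T A - D) R\<close>, whose norm is at most \<open>s * c * r\<close>. Hence \<open>U\<close> has a bounded left inverse \<open>G\<close>, and
  the identity factors through \<open>T\<close> by means of \<open>A R\<close> and \<open>G S B\<close>.\<close>

lemma factorization_from_diagonals:
  assumes T: "bounded_by Z NZ Z NZ cT T" and cT: "0 \<le> cT"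
    and A: "\<And>n. bounded_by (Y n) (N n) (Y n) (N n) \<alpha> (A n)" "0 \<le> \<alpha>"
    and B: "\<And>n. bounded_by (Y n) (N n) (Y n) (N n) \<beta> (B n)" "0 \<le> \<beta>"
    and R: "\<And>n. bounded_by (Y n) (N n) (Y n) (N n) r (R n)" "0 \<le> r"
    and S: "\<And>n. bounded_by (Y n) (N n) (Y n) (N n) s (S n)" "0 \<le> s"
    and D: "\<And>n y. y \<in> Y n \<Longrightarrow> D n y \<in> Y n" "\<And>n y. y \<in> Y n \<Longrightarrow> S n (D n (R n y)) = y"
    and E: "\<And>z. z \<in> Z \<Longrightarrow> (\<lambda>n. B n (T (\<lambda>k. A k (z k)) n) - D n (z n)) \<in> Z"
      "\<And>z. z \<in> Z \<Longrightarrow> NZ (\<lambda>n. B n (T (\<lambda>k. A k (z k)) n) - D n (z n)) \<le> c * NZ z"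
    and c: "0 \<le> c" and small: "s * c * r < 1"
  shows "identity_factors Z NZ (\<alpha> * r * (1 / (1 - s * c * r) * (s * \<beta>))) T"
proof -
  define Az where "Az z = (\<lambda>n. A n (z n))" for z
  define Bz where "Bz z = (\<lambda>n. B n (z n))" for z
  define Rz where "Rz z = (\<lambda>n. R n (z n))" for z
  define Sz where "Sz z = (\<lambda>n. S n (z n))" for z
  have Az: "bounded_by Z NZ Z NZ \<alpha> Az" and Bz: "bounded_by Z NZ Z NZ \<beta> Bz"
    and Rz: "bounded_by Z NZ Z NZ r Rz" and Sz: "bounded_by Z NZ Z NZ s Sz"
    unfolding Az_def Bz_def Rz_def Sz_def
    by (rule bounded_by_componentwise; fact)+
  have AR: "bounded_by Z NZ Z NZ (\<alpha> * r) (\<lambda>z. Az (Rz z))"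
    by (rule bounded_by_compose[OF Rz Az A(2)])
  have SB: "bounded_by Z NZ Z NZ (s * \<beta>) (\<lambda>z. Sz (Bz z))"
    by (rule bounded_by_compose[OF Bz Sz S(2)])
  define U where "U z = Sz (Bz (T (Az (Rz z))))" for z
  have U: "bounded_by Z NZ Z NZ (s * \<beta> * (cT * (\<alpha> * r))) U"
    unfolding U_def using cT B(2) S(2)
    by (intro bounded_by_compose[OF bounded_by_compose[OF AR T cT] SB]) simp
  have near: "NZ (U z - z) \<le> s * c * r * NZ z" if z: "z \<in> Z" for z
  proof -
    define v where "v n = B n (T (Az (Rz z)) n) - D n (Rz z n)" for n
    have RZ: "Rz z \<in> Z" by (rule bounded_byD(1)[OF Rz z])
    have v: "v \<in> Z" "NZ v \<le> c * NZ (Rz z)"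
      using E[OF RZ] by (simp_all add: v_def[abs_def] Az_def)
    have "U z - z = Sz v"
    proof
      fix n
      have 1: "B n (T (Az (Rz z)) n) \<in> Y n"
        by (intro bounded_byD(1)[OF B(1)] Z_comp bounded_byD(1)[OF T] bounded_byD(1)[OF Az] RZ)
      have 2: "D n (Rz z n) \<in> Y n" by (intro D(1) Z_comp RZ)
      have "S n (D n (Rz z n)) = z n" unfolding Rz_def by (rule D(2)[OF Z_comp[OF z]])
      then show "(U z - z) n = Sz v n"
        using Y.bounded_by_minus[OF S(1) 1 2] by (simp add: U_def Sz_def Bz_def v_def)
    qed
    then have "NZ (U z - z) \<le> s * NZ v" using bounded_byD(4)[OF Sz v(1)] by simp
    also have "\<dots> \<le> s * (c * (r * NZ z))"
      using v(2) bounded_byD(4)[OF Rz z] c S(2) by (meson mult_left_mono order_trans)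
    finally show ?thesis by (simp add: mult_ac)
  qed
  have th: "0 \<le> s * c * r" using c S(2) R(2) by simp
  obtain G where G: "bounded_by Z NZ Z NZ (1 / (1 - s * c * r)) G" "\<forall>z\<in>Z. G (U z) = z"
    using perturbation_of_identity_inverse[of Z NZ _ U "s * c * r", OF banach_Z U near th small] by blast
  have g0: "0 \<le> 1 / (1 - s * c * r)" using small by simp
  have GSB: "bounded_by Z NZ Z NZ (1 / (1 - s * c * r) * (s * \<beta>)) (\<lambda>z. G (Sz (Bz z)))"
    by (rule bounded_by_compose[OF SB G(1) g0])
  have n1: "onorm_on Z NZ NZ (\<lambda>z. Az (Rz z)) \<le> \<alpha> * r"
    using A(2) R(2) by (intro Z.onorm_on_le[OF AR _ normed_Z]) simp
  have n2: "onorm_on Z NZ NZ (\<lambda>z. G (Sz (Bz z))) \<le> 1 / (1 - s * c * r) * (s * \<beta>)"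
    using g0 B(2) S(2) by (intro Z.onorm_on_le[OF GSB _ normed_Z] mult_nonneg_nonneg)
  have bl: "bounded_linear_on Z NZ Z NZ (\<lambda>z. Az (Rz z))" "bounded_linear_on Z NZ Z NZ (\<lambda>z. G (Sz (Bz z)))"
    using AR GSB unfolding bounded_linear_on_iff by blast+
  have "onorm_on Z NZ NZ (\<lambda>z. Az (Rz z)) * onorm_on Z NZ NZ (\<lambda>z. G (Sz (Bz z)))
      \<le> \<alpha> * r * (1 / (1 - s * c * r) * (s * \<beta>))"
    using n1 n2 Z.bounded_by_onorm_on(2)[OF bl(2) normed_Z] A(2) R(2) by (intro mult_mono) auto
  then show ?thesis
    unfolding identity_factors_def using bl G(2) unfolding U_def
    by (intro exI[of _ "\<lambda>z. Az (Rz z)"] exI[of _ "\<lambda>z. G (Sz (Bz z))"] conjI)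
qed

text \<open>A single parameter \<open>t\<close> serves as the slack of the games, of the diagonal factorizations and of
  the perturbation. The games give diagonal entries of modulus at least \<open>\<delta> (1 - t)\<close>, while \<open>K\<close> may vary
  arbitrarily between \<open>\<delta> (1 - t)\<close> and \<open>\<delta>\<close>; so \<open>D\<close> is divided by \<open>1 - t\<close>, which preserves the argument \<open>\<delta>\<close> of \<open>K\<close>
  and costs a factor \<open>1 / (1 - t)\<close>. The perturbation costs the other one.\<close>

lemma sum_identity_factors:
  assumes fac: "\<And>n. diagonal_factorization_property (Y n) (N n) (b n) K"
    and rep: "\<And>n. strategically_reproducible (Y n) (N n) (b n) C" and C: "1 \<le> C"
    and T: "bounded_linear_on Z NZ Z NZ T" and \<delta>: "0 < \<delta>"
    and diag: "\<And>n i. \<delta> \<le> \<bar>co n i (T (sum_embed n (b n i)) n)\<bar>"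
    and K: "0 \<le> K \<delta>" and t: "0 < t" "t < 1"
  shows "identity_factors Z NZ (lam * (C + t) * (K \<delta> + t) / ((1 - t) * (1 - t))) T"
proof -
  define cT where "cT = onorm_on Z NZ NZ T"
  note Tb = Z.bounded_by_onorm_on[OF T normed_Z, folded cT_def]
  define \<kappa> where "\<kappa> = K \<delta> + t"
  have \<kappa>: "0 < \<kappa>" using K t by (simp add: \<kappa>_def)
  \<comment> \<open>Chosen such that the perturbation of the identity has norm at most \<open>t\<close>; see \<open>th\<close> below.\<close>
  define \<tau> where "\<tau> = t * (1 - t) / (16 * lam * \<kappa>)"
  have \<tau>: "0 < \<tau>" using t lam1 \<kappa> by (simp add: \<tau>_def)
  have "\<exists>\<sigma>. winning_strategy (Y n) (N n) (b n) C t \<sigma>" for n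
    using rep[of n] t by (simp add: strategically_reproducible_def)
  then obtain \<sigma> where \<sigma>: "\<And>n. winning_strategy (Y n) (N n) (b n) C t (\<sigma> n)" by metis
  obtain x f where x: "\<And>n i. x n i \<in> Y n" and f: "\<And>n i. f n i \<in> dual_on (Y n) (N n)"
    and xe: "\<And>n. impartially_equivalent (N n) (x n) (N n) (b n) (C + t)"
    and fe: "\<And>n. impartially_equivalent (dual_norm_on (Y n) (N n)) (f n) (dual_norm_on (Y n) (N n)) (co n) (C + t)"
    and fb: "\<And>n i k. i < k \<Longrightarrow> \<bar>f n k (b n i)\<bar> \<le> (1 / 2) ^ k"
    and off: "\<And>n i n' i'. (n, i) \<noteq> (n', i') \<Longrightarrow>
        \<bar>f n i (T (sum_embed n' (x n' i')) n)\<bar> \<le> \<tau> * weight (n, i) * weight (n', i')"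
    and dg: "\<And>n i. \<delta> * (1 - t) \<le> \<bar>f n i (T (sum_embed n (x n i)) n)\<bar>"
    using reproduced_sequences[OF Tb \<sigma> \<delta> diag \<tau>] by auto
  define d where "d n i = f n i (T (sum_embed n (x n i)) n)" for n i
  have k0: "0 \<le> sqrt (C + t)" using C t by simp
  obtain A B D where A: "\<And>n. bounded_by (Y n) (N n) (Y n) (N n) (sqrt (C + t)) (A n)"
    and B: "\<And>n. bounded_by (Y n) (N n) (Y n) (N n) (sqrt (C + t) * lam) (B n)"
    and D: "\<And>n. bounded_linear_on (Y n) (N n) (Y n) (N n) (D n)"
    and Dco: "\<And>n y i. y \<in> Y n \<Longrightarrow> co n i (D n y) = d n i * co n i y"
    and E: "\<And>z. z \<in> Z \<Longrightarrow> (\<lambda>n. B n (T (\<lambda>k. A k (z k)) n) - D n (z n)) \<in> Z"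
      "\<And>z. z \<in> Z \<Longrightarrow> NZ (\<lambda>n. B n (T (\<lambda>k. A k (z k)) n) - D n (z n)) \<le> 16 * lam * \<tau> * NZ z"
    using almost_diagonal[OF Tb k0 less_imp_le[OF \<tau>] x f
        impartially_equivalent_upper[OF xe] impartially_equivalent_upper[OF fe] fb off, folded d_def]
    by blast
  have "\<exists>R S. bounded_by (Y n) (N n) (Y n) (N n) (sqrt \<kappa>) R \<and>
      bounded_by (Y n) (N n) (Y n) (N n) (sqrt \<kappa>) S \<and> (\<forall>y\<in>Y n. S ((1 / (1 - t)) *\<^sub>R D n (R y)) = y)" for n
  proof (rule Y.balanced_factorization(1))
    let ?D = "\<lambda>y. (1 / (1 - t)) *\<^sub>R D n y"
    obtain c where c: "bounded_by (Y n) (N n) (Y n) (N n) c (D n)" using D[of n] by (auto simp: bounded_linear_on_iff)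
    show bl: "bounded_linear_on (Y n) (N n) (Y n) (N n) ?D"
      using Y.bounded_by_scale[OF c] unfolding bounded_linear_on_iff by blast
    have Dc: "co n i (?D (b n j)) = 1 / (1 - t) * (d n i * (if i = j then 1 else 0))" for i j
      using bounded_byD(1)[OF c B.b_mem] by (simp add: B.coord_scale Dco B.b_mem B.coord_b)
    have "diagonal_operator (Y n) (N n) (b n) ?D"
      unfolding diagonal_operator_def Dc by simp
    moreover have "\<delta> \<le> (INF i. \<bar>co n i (?D (b n i))\<bar>)"
    proof (rule cINF_greatest)
      fix i show "\<delta> \<le> \<bar>co n i (?D (b n i))\<bar>"
        unfolding Dc using dg[of n i] t by (simp add: d_def abs_mult pos_le_divide_eq)
    qed simp
    ultimately have "identity_almost_factors (Y n) (N n) (K \<delta>) ?D"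
      using fac[of n] bl \<delta> by (simp add: diagonal_factorization_property_def)
    then show "identity_factors (Y n) (N n) \<kappa> ?D"
      using t by (simp add: identity_almost_factors_def \<kappa>_def)
  qed (use B.b_mem B.N_b in auto)
  then obtain R S where R: "\<And>n. bounded_by (Y n) (N n) (Y n) (N n) (sqrt \<kappa>) (R n)"
    and S: "\<And>n. bounded_by (Y n) (N n) (Y n) (N n) (sqrt \<kappa>) (S n)"
    and SDR: "\<And>n y. y \<in> Y n \<Longrightarrow> S n ((1 / (1 - t)) *\<^sub>R D n (R n y)) = y"
    by metis
  have DY: "D n y \<in> Y n" if "y \<in> Y n" for n y using D[of n] that by (simp add: bounded_linear_on_def)
  define S' where "S' n y = (1 / (1 - t)) *\<^sub>R S n y" for n y
  define s where "s = 1 / (1 - t) * sqrt \<kappa>"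
  have s0: "0 \<le> s" using t \<kappa> by (simp add: s_def)
  have S': "bounded_by (Y n) (N n) (Y n) (N n) s (S' n)" for n
    using Y.bounded_by_scale[OF S, of n "1 / (1 - t)"] t unfolding S'_def s_def by simp
  have SDR': "S' n (D n (R n y)) = y" if "y \<in> Y n" for n y
    using SDR[OF that] bounded_byD(3)[OF S DY[OF bounded_byD(1)[OF R that]]] by (simp add: S'_def)
  have th: "s * (16 * lam * \<tau>) * sqrt \<kappa> = t"
  proof -
    have "s * (16 * lam * \<tau>) * sqrt \<kappa> = (sqrt \<kappa> * sqrt \<kappa>) * (16 * lam * \<tau>) / (1 - t)"
      by (simp add: s_def)
    also have "\<dots> = \<kappa> * (16 * lam * \<tau>) / (1 - t)" using \<kappa> by simp
    also have "\<dots> = t" using t \<kappa> lam1 by (simp add: \<tau>_def)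
    finally show ?thesis .
  qed
  have factors: "identity_factors Z NZ (sqrt (C + t) * sqrt \<kappa> * (1 / (1 - s * (16 * lam * \<tau>) * sqrt \<kappa>) * (s * (sqrt (C + t) * lam)))) T"
    by (rule factorization_from_diagonals[OF Tb A k0 B _ R _ S' s0 DY SDR' E])
       (use k0 lam1 \<kappa> \<tau> t th in auto)
  have rearrange: "a * q * (1 / u * (1 / u * q * (a * l))) = l * (a * a) * (q * q) / (u * u)" for a q u l :: real
    by (simp add: divide_inverse mult_ac)
  have "sqrt (C + t) * sqrt \<kappa> * (1 / (1 - s * (16 * lam * \<tau>) * sqrt \<kappa>) * (s * (sqrt (C + t) * lam)))
      = lam * (sqrt (C + t) * sqrt (C + t)) * (sqrt \<kappa> * sqrt \<kappa>) / ((1 - t) * (1 - t))"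
    unfolding th unfolding s_def by (rule rearrange)
  also have "\<dots> = lam * (C + t) * (K \<delta> + t) / ((1 - t) * (1 - t))"
    using C t \<kappa> by (simp add: \<kappa>_def)
  finally have eq: "sqrt (C + t) * sqrt \<kappa> * (1 / (1 - s * (16 * lam * \<tau>) * sqrt \<kappa>) * (s * (sqrt (C + t) * lam)))
      = lam * (C + t) * (K \<delta> + t) / ((1 - t) * (1 - t))" .
  show ?thesis using factors unfolding eq .
qed

text \<open>The identity factors through its multiple by \<open>\<delta>\<close>, which is diagonal, and the norms of the
  factors are nonnegative.\<close>

lemma factorization_constant_nonneg:
  assumes fac: "diagonal_factorization_property (Y n) (N n) (b n) K" and \<delta>: "0 < \<delta>"
  shows "0 \<le> K \<delta>"
proof (rule field_le_epsilon)
  fix \<epsilon> :: real assume \<epsilon>: "0 < \<epsilon>"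
  let ?T = "\<lambda>y. \<delta> *\<^sub>R y"
  have "bounded_by (Y n) (N n) (Y n) (N n) 1 (\<lambda>y. y)" by (simp add: bounded_by_def)
  from Y.bounded_by_scale[OF this] have bl: "bounded_linear_on (Y n) (N n) (Y n) (N n) ?T"
    unfolding bounded_linear_on_iff by blast
  have Tc: "co n i (?T (b n j)) = \<delta> * (if i = j then 1 else 0)" for i j
    by (simp add: B.coord_scale B.b_mem B.coord_b)
  have "diagonal_operator (Y n) (N n) (b n) ?T" unfolding diagonal_operator_def Tc by simp
  moreover have "\<delta> \<le> (INF i. \<bar>co n i (?T (b n i))\<bar>)" unfolding Tc using \<delta> by simp
  ultimately have "identity_factors (Y n) (N n) (K \<delta> + \<epsilon>) ?T"
    using fac bl \<delta> \<epsilon> by (simp add: diagonal_factorization_property_def identity_almost_factors_def)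
  from Y.balanced_factorization(2)[OF this bl B.b_mem] show "0 \<le> K \<delta> + \<epsilon>"
    using B.N_b by simp
qed

text \<open>The constant of the preceding factorization tends to \<open>lam * C * K \<delta>\<close> as \<open>t\<close> tends to \<open>0\<close>; this is
  at most \<open>lam * C\<^sup>2 * K \<delta>\<close> because \<open>C \<ge> 1\<close> and \<open>K \<delta> \<ge> 0\<close>.\<close>

lemma sum_factorization_property:
  assumes fac: "\<And>n. diagonal_factorization_property (Y n) (N n) (b n) K"
    and rep: "\<And>n. strategically_reproducible (Y n) (N n) (b n) C" and C: "1 \<le> C"
  shows "factorization_property Z NZ bt (\<lambda>\<delta>. lam * C\<^sup>2 * K \<delta>)"
  unfolding factorization_property_def identity_almost_factors_def
proof (intro allI impI)
  fix \<delta> \<epsilon> :: real and T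
  assume \<delta>: "0 < \<delta>" and T: "bounded_linear_on Z NZ Z NZ T" and inf: "\<delta> \<le> (INF m. \<bar>coord Z NZ bt m (T (bt m))\<bar>)"
    and \<epsilon>: "0 < \<epsilon>"
  have diag: "\<delta> \<le> \<bar>co n i (T (sum_embed n (b n i)) n)\<bar>" for n i
  proof -
    have TZ: "T (sum_embed n (b n i)) \<in> Z"
      using T embed_in_Z(1)[OF B.b_mem] by (simp add: bounded_linear_on_def)
    have "bdd_below (range (\<lambda>m. \<bar>coord Z NZ bt m (T (bt m))\<bar>))" by (rule bdd_belowI2[of _ 0]) simp
    from cINF_lower[OF this, of "index (n, i)"] inf
    have "\<delta> \<le> \<bar>coord Z NZ bt (index (n, i)) (T (bt (index (n, i))))\<bar>" by simp
    then show ?thesis using coord_Z[OF TZ] by (simp add: p_index)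
  qed
  have K: "0 \<le> K \<delta>" by (rule factorization_constant_nonneg[OF fac \<delta>])
  have "((\<lambda>t. lam * (C + t) * (K \<delta> + t) / ((1 - t) * (1 - t))) \<longlongrightarrow> lam * (C + 0) * (K \<delta> + 0) / ((1 - 0) * (1 - 0))) (at_right 0)"
    by (intro tendsto_intros) auto
  moreover have "lam * (C + 0) * (K \<delta> + 0) / ((1 - 0) * (1 - 0)) < lam * C\<^sup>2 * K \<delta> + \<epsilon>"
  proof -
    have "C * (lam * K \<delta>) \<le> C\<^sup>2 * (lam * K \<delta>)"
      using C K lam1 by (intro mult_right_mono) (auto simp: power2_eq_square)
    then show ?thesis using \<epsilon> by (simp add: mult_ac)
  qed
  ultimately have "\<forall>\<^sub>F t in at_right 0. lam * (C + t) * (K \<delta> + t) / ((1 - t) * (1 - t)) < lam * C\<^sup>2 * K \<delta> + \<epsilon>"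
    by (rule order_tendstoD(2))
  moreover have "\<forall>\<^sub>F t::real in at_right 0. t \<in> {0<..<1}" by (rule eventually_at_right_real) simp
  ultimately have "\<forall>\<^sub>F t in at_right 0. t \<in> {0<..<1} \<and> lam * (C + t) * (K \<delta> + t) / ((1 - t) * (1 - t)) < lam * C\<^sup>2 * K \<delta> + \<epsilon>"
    by eventually_elim simp
  then have "\<exists>t. t \<in> {0<..<1} \<and> lam * (C + t) * (K \<delta> + t) / ((1 - t) * (1 - t)) < lam * C\<^sup>2 * K \<delta> + \<epsilon>"
    by (rule eventually_happens'[OF trivial_limit_at_right_real])
  then obtain t where t01: "t \<in> {0<..<1}"
    and le: "lam * (C + t) * (K \<delta> + t) / ((1 - t) * (1 - t)) < lam * C\<^sup>2 * K \<delta> + \<epsilon>"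
    by blast
  from t01 have t: "0 < t" "t < 1" by auto
  have "identity_factors Z NZ (lam * (C + t) * (K \<delta> + t) / ((1 - t) * (1 - t))) T"
    by (rule sum_identity_factors[where K = K]) (fact fac rep C T \<delta> diag K t)+
  then show "identity_factors Z NZ (lam * C\<^sup>2 * K \<delta> + \<epsilon>) T"
    unfolding identity_factors_def using order_trans[OF _ less_imp_le[OF le]] by blast
qed

end

theorem theorem7p6:
  fixes e :: "nat \<Rightarrow> 'x::banach"
    and Y :: "nat \<Rightarrow> 'a::real_vector set"
    and N :: "nat \<Rightarrow> 'a \<Rightarrow> real"
    and b :: "nat \<Rightarrow> nat \<Rightarrow> 'a"
    and lam C :: real
    and K :: "real \<Rightarrow> real"
    and p :: "nat \<Rightarrow> nat \<times> nat"
  assumes "normalized_schauder_basis_on UNIV norm e"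
    and "unconditional_basis_on UNIV norm 1 e"
    and "\<And>n. banach_on (Y n) (N n)"
    and "lam \<ge> 1" and "C \<ge> 1"
    and "\<And>n. normalized_schauder_basis_on (Y n) (N n) (b n)"
    and "\<And>n. basis_constant (Y n) (N n) (b n) \<le> ereal lam"
    and "\<And>n. diagonal_factorization_property (Y n) (N n) (b n) K"
    and "\<And>n. strategically_reproducible (Y n) (N n) (b n) C"
    and "bij p"
    and "\<And>n i j k l. i < j \<Longrightarrow> p k = (n, i) \<Longrightarrow> p l = (n, j) \<Longrightarrow> k < l"
  shows "factorization_property (sum_space e Y N) (sum_norm e N)
           (\<lambda>m. case p m of (n, i) \<Rightarrow> sum_embed n (b n i))
           (\<lambda>\<delta>. lam * C\<^sup>2 * K \<delta>)"
proof -
  interpret basis_sum e Y N b lam p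
  proof
    show "norm (e n) = 1" for n
      using assms(1) by (simp add: normalized_schauder_basis_on_def)
    show "norm (\<Sum>i<n. (\<epsilon> i * a i) *\<^sub>R e i) \<le> norm (\<Sum>i<n. a i *\<^sub>R e i)" if "\<forall>i. \<epsilon> i \<in> {-1, 1}" for n a \<epsilon>
      using assms(2) that by (simp add: unconditional_basis_on_def)
  qed fact+
  show ?thesis
    by (rule sum_factorization_property) fact+
qed

end
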